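(* Let $\rho_o\in(\mathbf{L}^\infty\cap\mathbf{BV})(\mathbb{R}^2;\mathbb{R}^+)$ and let assumptions (v), (H), ($\eta$) of the context hold. Assume that $$\lambda_x\le\frac{1}{3\left(\epsilon L_f+\|v^{stat}_1\|_{\mathbf{L}^\infty}\right)},\qquad \lambda_y\le\frac{1}{3\left(\epsilon L_f+\|v^{stat}_2\|_{\mathbf{L}^\infty}\right)}.$$ Then the piecewise constant approximate solution $\rho_\Delta$, with values $\rho^n_{i,j}$, constructed by the Roe-type scheme with dimensional splitting described in the context satisfies the following estimate: for all $n=0,\dots,N_T$, $$\sum_{i,j\in\mathbb{Z}}\left(\Delta y\,|\rho^n_{i+1,j}-\rho^n_{i,j}|+\Delta x\,|\rho^n_{i,j+1}-\rho^n_{i,j}|\right)\le\mathcal{C}_x(t^n),$$ where $$\mathcal{C}_x(t)=e^{2t\mathcal{K}_1}\sum_{i,j\in\mathbb{Z}}\left(\Delta x\,|\rho^0_{i,j+1}-\rho^0_{i,j}|+\Delta y\,|\rho^0_{i+1,j}-\rho^0_{i,j}|\right)+\frac{2\mathcal{K}_2}{\mathcal{K}_1}\left(e^{2t\mathcal{K}_1}-1\right),$$ $$\mathcal{K}_1=6\left(\|\nabla\boldsymbol{v}^{stat}\|_{\mathbf{L}^\infty}+2\epsilon L_f\|\nabla^2\eta\|_{\mathbf{L}^\infty}\|\rho_o\|_{\mathbf{L}^1}\right),$$ $$\mathcal{K}_2=\left(4\epsilon\left(c_1\|\rho_o\|_{\mathbf{L}^1}+c_2\|\rho_o\|^2_{\mathbf{L}^1}\right)+3\|\nabla^2\boldsymbol{v}^{stat}\|_{\mathbf{L}^\infty}\right)\|\rho_o\|_{\mathbf{L}^1},$$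 with $c_1=2\|\nabla^3\eta\|_{\mathbf{L}^\infty}$ and $c_2=3\|\nabla^2\eta\|^2_{\mathbf{L}^\infty}$.
   Context: Fixed: $\epsilon>0$, $\rho_{max}>0$, $T>0$. Assumptions. (v): $\boldsymbol{v}^{stat}=(v^{stat}_1,v^{stat}_2)\in\mathbf{C}^2(\mathbb{R}^2;\mathbb{R}^2)$. (H): $H$ is a smooth approximation of the Heaviside function such that, setting $f(r)=r\,H(r-\rho_{max})$, the function $f$ has bounded derivative; $L_f=\|f'\|_{\mathbf{L}^\infty(\mathbb{R})}$. ($\eta$): $\eta\in(\mathbf{C}^3\cap\mathbf{W}^{3,\infty})(\mathbb{R}^2;\mathbb{R}^+)$. Notation: $\mathbf{BV}$ is the space of integrable functions of bounded variation; $\|\cdot\|$ is the Euclidean norm. Mesh: $\Delta x,\Delta y,\Delta t>0$; $x_k=(k-\tfrac12)\Delta x$, $y_k=(k-\tfrac12)\Delta y$, $x_{k+1/2}=k\Delta x$, $y_{k+1/2}=k\Delta y$ for $k\in\mathbb{Z}$; $N_T=\lfloor T/\Delta t\rfloor$, $t^n=n\Delta t$; $\lambda_x=\Delta t/\Delta x$, $\lambda_y=\Delta t/\Delta y$; $x_{a,b}=(x_a,y_b)$ for integer or half-integer indices. Initial values: $\rho^0_{i,j}=\frac{1}{\Delta x\Delta y}\int_{x_{i-1/2}}^{x_{i+1/2}}\int_{y_{j-1/2}}^{y_{j+1/2}}\rho_o(x,y)\,dy\,dx$. Numerical fluxes: for $k=1,2$, $$V_k(x,y,u,w)=v^{stat}_k(x,y)\,u+\min\{0,v^{stat}_k(x,y)\}(w-u),\qquad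 F(u,w,J)=J\,f(u)+\min\{0,J\}\,(f(w)-f(u)).$$ Non-local term: $J^n_k(x,y)=-\epsilon\,\dfrac{(\partial_k\eta*\rho^n)(x,y)}{\sqrt{1+\|(\nabla\eta*\rho^n)(x,y)\|^2}}$, $k=1,2$ ($\partial_1=\partial_x$, $\partial_2=\partial_y$), with the quadrature formula $(\partial_k\eta*\rho^n)(x_a,y_b)=\Delta x\,\Delta y\sum_{p,\ell\in\mathbb{Z}}\rho^n_{p,\ell}\,\partial_k\eta(x_{a-p},y_{b-\ell})$ at grid points (integer or half-integer $a,b$). Scheme (for $n=0,\dots,N_T-1$ and all $i,j\in\mathbb{Z}$; the numerical fluxes are evaluated at time $t^n$ in both fractional steps): $$\rho^{n+1/2}_{i,j}=\rho^n_{i,j}-\lambda_x\big[V_1(x_{i+1/2,j},\rho^n_{i,j},\rho^n_{i+1,j})-V_1(x_{i-1/2,j},\rho^n_{i-1,j},\rho^n_{i,j})+F(\rho^n_{i,j},\rho^n_{i+1,j},J^n_1(x_{i+1/2,j}))-F(\rho^n_{i-1,j},\rho^n_{i,j},J^n_1(x_{i-1/2,j}))\big],$$ $$\rho^{n+1}_{i,j}=\rho^{n+1/2}_{i,j}-\lambda_y\big[V_2(x_{i,j+1/2},\rho^n_{i,j},\rho^n_{i,j+1})-V_2(x_{i,j-1/2},\rho^n_{i,j-1},\rho^n_{i,j})+F(\rho^n_{i,j},\rho^n_{i,j+1},J^n_2(x_{i,j+1/2}))-F(\rho^n_{i,j-1},\rho^n_{i,j},J^n_2(x_{i,j-1/2}))\big].$$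 Approximate solution: $\rho_\Delta(t,x,y)=\rho^n_{i,j}$ for $t\in[t^n,t^{n+1}[$, $x\in[x_{i-1/2},x_{i+1/2}[$, $y\in[y_{j-1/2},y_{j+1/2}[$, $n=0,\dots,N_T-1$, $i,j\in\mathbb{Z}$. *)

theory Defs
  imports "HOL-Analysis.Analysis" "HOL-Probability.Essential_Supremum"
begin

section \<open>Derivatives and function spaces\<close>

text \<open>For \<open>b \<in> Basis\<close> this is the partial derivative in the coordinate direction \<open>b\<close>;
  the plane is \<open>real \<times> real\<close>, whose basis vectors are \<open>(1, 0)\<close> and \<open>(0, 1)\<close>
  and whose norm is the Euclidean one.\<close>

definition partial :: "'a::euclidean_space \<Rightarrow> ('a \<Rightarrow> 'b::real_normed_vector) \<Rightarrow> 'a \<Rightarrow> 'b" where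
  "partial b g x = frechet_derivative g (at x) b"

primrec C_class :: "nat \<Rightarrow> ('a::euclidean_space \<Rightarrow> 'b::real_normed_vector) \<Rightarrow> bool" where
  "C_class 0 g \<longleftrightarrow> continuous_on UNIV g"
| "C_class (Suc m) g \<longleftrightarrow>
     (\<forall>x. g differentiable (at x)) \<and> (\<forall>b\<in>Basis. C_class m (partial b g))"

text \<open>Squared Euclidean (Frobenius) norm of the tensor of all \<open>m\<close>-th order partial derivatives.\<close>

primrec nabla_sq :: "nat \<Rightarrow> ('a::euclidean_space \<Rightarrow> 'b::real_normed_vector) \<Rightarrow> 'a \<Rightarrow> real" where
  "nabla_sq 0 g x = (norm (g x))\<^sup>2"
| "nabla_sq (Suc m) g x = (\<Sum>b\<in>Basis. nabla_sq m (partial b g) x)"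

definition nabla_norm :: "nat \<Rightarrow> ('a::euclidean_space \<Rightarrow> 'b::real_normed_vector) \<Rightarrow> 'a \<Rightarrow> real" where
  "nabla_norm m g x = sqrt (nabla_sq m g x)"

definition Linf_norm :: "('a::euclidean_space \<Rightarrow> 'b::real_normed_vector) \<Rightarrow> ennreal" where
  "Linf_norm g = esssup lebesgue (\<lambda>x. ennreal (norm (g x)))"

definition L1_norm :: "('a::euclidean_space \<Rightarrow> 'b::real_normed_vector) \<Rightarrow> ennreal" where
  "L1_norm g = (\<integral>\<^sup>+ x. ennreal (norm (g x)) \<partial>lebesgue)"

text \<open>The intersection of \<open>C\<^sup>m\<close> and the Sobolev space \<open>W\<^sup>m\<^sup>,\<^sup>\<infinity>\<close>; on \<open>C\<^sup>m\<close> the weak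
  derivatives up to order \<open>m\<close> are the classical ones.\<close>

definition C_W_inf :: "nat \<Rightarrow> ('a::euclidean_space \<Rightarrow> 'b::real_normed_vector) \<Rightarrow> bool" where
  "C_W_inf m g \<longleftrightarrow> C_class m g \<and> (\<forall>k\<le>m. Linf_norm (nabla_norm k g) < \<infinity>)"

definition divergence :: "('a::euclidean_space \<Rightarrow> 'a) \<Rightarrow> 'a \<Rightarrow> real" where
  "divergence \<phi> x = (\<Sum>b\<in>Basis. partial b \<phi> x \<bullet> b)"

text \<open>The set of test fields is closed under negation, so that cutting off negative values
  with \<^const>\<open>ennreal\<close> does not change the supremum.\<close>

definition total_variation :: "('a::euclidean_space \<Rightarrow> real) \<Rightarrow> ennreal" where
  "total_variation u =
     (SUP \<phi> \<in> {\<phi>. C_class 1 \<phi> \<and> compact (closure {x. \<phi> x \<noteq> 0}) \<and> (\<forall>x. norm (\<phi> x) \<le> 1)}.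
        ennreal (\<integral>x. u x * divergence \<phi> x \<partial>lebesgue))"

definition BV :: "('a::euclidean_space \<Rightarrow> real) \<Rightarrow> bool" where
  "BV u \<longleftrightarrow> integrable lebesgue u \<and> total_variation u < \<infinity>"

section \<open>Flux function\<close>

definition smooth_heaviside :: "(real \<Rightarrow> real) \<Rightarrow> bool" where
  "smooth_heaviside H \<longleftrightarrow>
     (\<forall>m. C_class m H) \<and> mono H \<and> (H \<longlongrightarrow> 0) at_bot \<and> (H \<longlongrightarrow> 1) at_top"

definition crowd_flux :: "(real \<Rightarrow> real) \<Rightarrow> real \<Rightarrow> real \<Rightarrow> real" where
  "crowd_flux H \<rho>max r = r * H (r - \<rho>max)"

section \<open>The scheme\<close>

text \<open>The grid coordinate with index \<open>a\<close>; the real argument covers integer and half-integer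
  indices.\<close>

definition grid_pt :: "real \<Rightarrow> real \<Rightarrow> real" where
  "grid_pt \<Delta> a = (a - 1/2) * \<Delta>"

definition cell_average ::
    "real \<Rightarrow> real \<Rightarrow> (real \<times> real \<Rightarrow> real) \<Rightarrow> int \<Rightarrow> int \<Rightarrow> real" where
  "cell_average \<Delta>x \<Delta>y \<rho>o i j = 1 / (\<Delta>x * \<Delta>y) *
     (LINT z : {grid_pt \<Delta>x (i - 1/2) .. grid_pt \<Delta>x (i + 1/2)} \<times>
               {grid_pt \<Delta>y (j - 1/2) .. grid_pt \<Delta>y (j + 1/2)} | lebesgue. \<rho>o z)"

text \<open>In the following, the basis vector \<open>b\<close> selects the index \<open>k\<close> of
  \<open>V\<^sub>k\<close>, \<open>\<partial>\<^sub>k\<close> and \<open>J\<^sub>k\<close>: \<open>(1, 0)\<close> for \<open>k = 1\<close> and \<open>(0, 1)\<close> for \<open>k = 2\<close>.\<close>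

definition V_flux ::
    "(real \<times> real \<Rightarrow> real \<times> real) \<Rightarrow> real \<times> real \<Rightarrow> real \<times> real \<Rightarrow> real \<Rightarrow> real \<Rightarrow> real" where
  "V_flux v b z u w = (v z \<bullet> b) * u + min 0 (v z \<bullet> b) * (w - u)"

definition F_flux :: "(real \<Rightarrow> real) \<Rightarrow> real \<Rightarrow> real \<Rightarrow> real \<Rightarrow> real" where
  "F_flux f u w J = J * f u + min 0 J * (f w - f u)"

text \<open>The quadrature formula evaluates the kernel at the grid point with index
  \<open>(a - p, c - l)\<close>, not at the difference of two grid points.\<close>

definition discrete_conv ::
    "(real \<times> real \<Rightarrow> real) \<Rightarrow> real \<Rightarrow> real \<Rightarrow> (int \<Rightarrow> int \<Rightarrow> real) \<Rightarrow> real \<times> real \<Rightarrow> real \<Rightarrow> real \<Rightarrow> real" where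
  "discrete_conv \<eta> \<Delta>x \<Delta>y \<rho> b a c = \<Delta>x * \<Delta>y *
     (\<Sum>\<^sub>\<infinity>(p, l)\<in>UNIV. \<rho> p l *
        partial b \<eta> (grid_pt \<Delta>x (a - real_of_int p), grid_pt \<Delta>y (c - real_of_int l)))"

definition nonlocal ::
    "real \<Rightarrow> (real \<times> real \<Rightarrow> real) \<Rightarrow> real \<Rightarrow> real \<Rightarrow> (int \<Rightarrow> int \<Rightarrow> real) \<Rightarrow> real \<times> real \<Rightarrow> real \<Rightarrow> real \<Rightarrow> real" where
  "nonlocal \<epsilon> \<eta> \<Delta>x \<Delta>y \<rho> b a c =
     - \<epsilon> * discrete_conv \<eta> \<Delta>x \<Delta>y \<rho> b a c /
     sqrt (1 + (norm (discrete_conv \<eta> \<Delta>x \<Delta>y \<rho> (1, 0) a c,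
                      discrete_conv \<eta> \<Delta>x \<Delta>y \<rho> (0, 1) a c))\<^sup>2)"

definition x_flux ::
    "real \<Rightarrow> (real \<times> real \<Rightarrow> real \<times> real) \<Rightarrow> (real \<Rightarrow> real) \<Rightarrow> (real \<times> real \<Rightarrow> real) \<Rightarrow>
     real \<Rightarrow> real \<Rightarrow> (int \<Rightarrow> int \<Rightarrow> real) \<Rightarrow> int \<Rightarrow> int \<Rightarrow> real" where \<comment> \<open>through the edge at \<open>(i + 1/2, j)\<close>\<close>
  "x_flux \<epsilon> v f \<eta> \<Delta>x \<Delta>y \<rho> i j =
     V_flux v (1, 0) (grid_pt \<Delta>x (i + 1/2), grid_pt \<Delta>y j) (\<rho> i j) (\<rho> (i + 1) j)
     + F_flux f (\<rho> i j) (\<rho> (i + 1) j) (nonlocal \<epsilon> \<eta> \<Delta>x \<Delta>y \<rho> (1, 0) (i + 1/2) j)"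

definition y_flux ::
    "real \<Rightarrow> (real \<times> real \<Rightarrow> real \<times> real) \<Rightarrow> (real \<Rightarrow> real) \<Rightarrow> (real \<times> real \<Rightarrow> real) \<Rightarrow>
     real \<Rightarrow> real \<Rightarrow> (int \<Rightarrow> int \<Rightarrow> real) \<Rightarrow> int \<Rightarrow> int \<Rightarrow> real" where \<comment> \<open>through the edge at \<open>(i, j + 1/2)\<close>\<close>
  "y_flux \<epsilon> v f \<eta> \<Delta>x \<Delta>y \<rho> i j =
     V_flux v (0, 1) (grid_pt \<Delta>x i, grid_pt \<Delta>y (j + 1/2)) (\<rho> i j) (\<rho> i (j + 1))
     + F_flux f (\<rho> i j) (\<rho> i (j + 1)) (nonlocal \<epsilon> \<eta> \<Delta>x \<Delta>y \<rho> (0, 1) i (j + 1/2))"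

definition roe_half ::
    "real \<Rightarrow> (real \<times> real \<Rightarrow> real \<times> real) \<Rightarrow> (real \<Rightarrow> real) \<Rightarrow> (real \<times> real \<Rightarrow> real) \<Rightarrow>
     real \<Rightarrow> real \<Rightarrow> real \<Rightarrow> (int \<Rightarrow> int \<Rightarrow> real) \<Rightarrow> int \<Rightarrow> int \<Rightarrow> real" where
  "roe_half \<epsilon> v f \<eta> \<Delta>x \<Delta>y \<Delta>t \<rho> i j =
     \<rho> i j - \<Delta>t / \<Delta>x * (x_flux \<epsilon> v f \<eta> \<Delta>x \<Delta>y \<rho> i j - x_flux \<epsilon> v f \<eta> \<Delta>x \<Delta>y \<rho> (i - 1) j)"

text \<open>In the second fractional step, too, the fluxes are evaluated at the old time level \<open>\<rho>\<close>.\<close>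

definition roe_step ::
    "real \<Rightarrow> (real \<times> real \<Rightarrow> real \<times> real) \<Rightarrow> (real \<Rightarrow> real) \<Rightarrow> (real \<times> real \<Rightarrow> real) \<Rightarrow>
     real \<Rightarrow> real \<Rightarrow> real \<Rightarrow> (int \<Rightarrow> int \<Rightarrow> real) \<Rightarrow> int \<Rightarrow> int \<Rightarrow> real" where
  "roe_step \<epsilon> v f \<eta> \<Delta>x \<Delta>y \<Delta>t \<rho> i j =
     roe_half \<epsilon> v f \<eta> \<Delta>x \<Delta>y \<Delta>t \<rho> i j
     - \<Delta>t / \<Delta>y * (y_flux \<epsilon> v f \<eta> \<Delta>x \<Delta>y \<rho> i j - y_flux \<epsilon> v f \<eta> \<Delta>x \<Delta>y \<rho> i (j - 1))"

primrec roe ::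
    "real \<Rightarrow> (real \<times> real \<Rightarrow> real \<times> real) \<Rightarrow> (real \<Rightarrow> real) \<Rightarrow> (real \<times> real \<Rightarrow> real) \<Rightarrow>
     real \<Rightarrow> real \<Rightarrow> real \<Rightarrow> (real \<times> real \<Rightarrow> real) \<Rightarrow> nat \<Rightarrow> int \<Rightarrow> int \<Rightarrow> real" where
  "roe \<epsilon> v f \<eta> \<Delta>x \<Delta>y \<Delta>t \<rho>o 0 = cell_average \<Delta>x \<Delta>y \<rho>o"
| "roe \<epsilon> v f \<eta> \<Delta>x \<Delta>y \<Delta>t \<rho>o (Suc n) =
     roe_step \<epsilon> v f \<eta> \<Delta>x \<Delta>y \<Delta>t (roe \<epsilon> v f \<eta> \<Delta>x \<Delta>y \<Delta>t \<rho>o n)"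

section \<open>The bound\<close>

definition grid_TV :: "real \<Rightarrow> real \<Rightarrow> (int \<Rightarrow> int \<Rightarrow> real) \<Rightarrow> ennreal" where
  "grid_TV \<Delta>x \<Delta>y \<rho> =
     (\<Sum>\<^sub>\<infinity>(i, j)\<in>UNIV. ennreal (\<Delta>y * \<bar>\<rho> (i + 1) j - \<rho> i j\<bar> + \<Delta>x * \<bar>\<rho> i (j + 1) - \<rho> i j\<bar>))"

definition ennexp :: "ennreal \<Rightarrow> ennreal" where
  "ennexp x = (if x = \<infinity> then \<infinity> else ennreal (exp (enn2real x)))"

definition K1_const ::
    "real \<Rightarrow> (real \<times> real \<Rightarrow> real \<times> real) \<Rightarrow> (real \<Rightarrow> real) \<Rightarrow> (real \<times> real \<Rightarrow> real) \<Rightarrow>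
     (real \<times> real \<Rightarrow> real) \<Rightarrow> ennreal" where
  "K1_const \<epsilon> v f \<eta> \<rho>o = 6 * (Linf_norm (nabla_norm 1 v)
     + 2 * ennreal \<epsilon> * Linf_norm (deriv f) * Linf_norm (nabla_norm 2 \<eta>) * L1_norm \<rho>o)"

definition K2_const ::
    "real \<Rightarrow> (real \<times> real \<Rightarrow> real \<times> real) \<Rightarrow> (real \<times> real \<Rightarrow> real) \<Rightarrow>
     (real \<times> real \<Rightarrow> real) \<Rightarrow> ennreal" where
  "K2_const \<epsilon> v \<eta> \<rho>o =
     (let c1 = 2 * Linf_norm (nabla_norm 3 \<eta>);
          c2 = 3 * (Linf_norm (nabla_norm 2 \<eta>))\<^sup>2
      in (4 * ennreal \<epsilon> * (c1 * L1_norm \<rho>o + c2 * (L1_norm \<rho>o)\<^sup>2)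
          + 3 * Linf_norm (nabla_norm 2 v)) * L1_norm \<rho>o)"

text \<open>The derivatives of \<open>v\<close> need not be bounded, so the bound takes values in
  \<^typ>\<open>ennreal\<close>.  For real \<open>0 < K1\<close> and \<open>K2\<close> this is the usual formula.  If \<open>K1 = 0\<close> then,
  under the hypotheses on the data, \<open>\<eta>\<close> is constant or \<open>\<rho>o = 0\<close> almost everywhere, and
  \<open>v\<close> is constant, so \<open>K2 = 0\<close>; the second summand is then zero, which is also its limit
  \<open>4 * t * K2\<close>.\<close>

definition TV_bound :: "ennreal \<Rightarrow> ennreal \<Rightarrow> ennreal \<Rightarrow> real \<Rightarrow> ennreal" where
  "TV_bound K1 K2 TV0 t =
     ennexp (2 * ennreal t * K1) * TV0 + 2 * K2 / K1 * (ennexp (2 * ennreal t * K1) - 1)"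

end

theory Submission
  imports Defs
begin

text \<open>Both fractional steps use the fluxes of the old time level, so that one time step adds an
\<open>x\<close>-flux difference and a \<open>y\<close>-flux difference.  The bound comes from the equation that this
step induces for \<open>D i j = \<rho> (i + 1) j - \<rho> i j\<close>; the differences in \<open>y\<close> follow by exchanging
the axes.

A flux \<open>c * h\<^sub>i + min 0 c * (h\<^sub>i\<^sub>+\<^sub>1 - h\<^sub>i)\<close> can be differenced exactly in such a way that the kink of
\<open>min 0 c\<close> is never differenced against \<open>h\<close> itself: the difference of two neighbouring fluxes is an
upwind flux for the differences of \<open>h\<close>, plus \<open>h\<close> times the difference of the smooth coefficient
\<open>c\<close> (\<open>upwind_x_second_difference\<close>, \<open>upwind_y_mixed_difference\<close>).  Hence \<open>D\<close> solves a conservative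
five-point scheme, whose weights leaving each edge sum to one, up to a remainder that consists
of first differences of \<open>c\<close> times differences of \<open>\<rho>\<close> and of second differences of \<open>c\<close> times \<open>\<rho>\<close>
(\<open>step_difference\<close>, \<open>rem_bound\<close>).  As the discrete L1 norm is invariant under translation, the
five-point part multiplies it at most by the supremum of the sum of the absolute weights
(\<open>grid_l1_five_point\<close>).  The remainder produces the term with \<open>K1\<close> and the source with \<open>K2\<close>: the
coefficients are the velocity \<open>v\<close>, paired with \<open>h = \<rho>\<close>, and the nonlocal term, paired with
\<open>h = f \<rho>\<close>.  The nonlocal term is a smooth function with bounded derivatives of discrete
convolutions, and the differences of these fall on the kernel, so that they cost derivatives of
\<open>\<eta>\<close> times the L1 norm of \<open>\<rho>\<close> (\<open>nonlocal_increments\<close>, \<open>sat_second_difference\<close>).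

There are two regimes.  The CFL condition bounds the outflow through each edge of a cell by
\<open>1/3\<close> of its content, hence the outflow of a cell by \<open>4/3\<close>.  More than \<open>2/3\<close> leaves only
if the coefficients on opposite edges differ, and the excess is at most \<open>\<Delta>t * K1 / 3\<close>.
For \<open>\<Delta>t * K1 \<le> 1\<close> the outflow is therefore at most \<open>1\<close>: the step preserves positivity,
does not increase the L1 norm, and all weights for \<open>D\<close> are nonnegative
(\<open>small_step_bound\<close>).  For \<open>\<Delta>t * K1 > 1\<close> positivity may fail and the L1 norm may grow.  But it grows
at most by \<open>5/3\<close> per step, the source, which is at most cubic in it, by \<open>(5/3)\<^sup>3 = 125/27\<close>, and the
variation by \<open>5 + \<Delta>t * K1 / 2\<close>; the factor \<open>exp (2 * \<Delta>t * K1)\<close>, at least \<open>exp 2\<close>, in the claimed bound absorbs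
all of these (\<open>large_step_bound\<close>).

It remains to treat the extended values.  If a derivative of \<open>v\<close> is unbounded, then the bound is
infinite at positive times unless the data vanish.  If \<open>K1 = 0\<close>, then \<open>v\<close> is constant and the second derivatives of
\<open>\<eta>\<close> vanish unless the data do, so that \<open>K2 = 0\<close> as well.\<close>

section \<open>The discrete L1 norm on the integer grid\<close>

text \<open>The values are in \<^typ>\<open>ennreal\<close>, so that sums can be split, shifted and compared without
any summability condition.\<close>

definition grid_l1 :: "(int \<Rightarrow> int \<Rightarrow> real) \<Rightarrow> ennreal" where
  "grid_l1 u = (\<Sum>\<^sub>\<infinity>(i, j)\<in>UNIV. ennreal \<bar>u i j\<bar>)"

lemma ennreal_infsum_cmult_le:
  fixes g :: "'a \<Rightarrow> ennreal"
  shows "(\<Sum>\<^sub>\<infinity>x\<in>A. c * g x) \<le> c * (\<Sum>\<^sub>\<infinity>x\<in>A. g x)"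
proof (rule infsum_le_finite_sums)
  show "(\<lambda>x. c * g x) summable_on A" by (rule nonneg_summable_on_complete) simp
  fix F assume "finite F" "F \<subseteq> A"
  then have "sum g F \<le> infsum g A"
    by (subst nonneg_infsum_complete) (auto intro: SUP_upper)
  then show "(\<Sum>x\<in>F. c * g x) \<le> c * infsum g A"
    by (simp add: sum_distrib_left [symmetric] mult_left_mono)
qed

lemma ennreal_infsum_cmult:
  fixes g :: "'a \<Rightarrow> ennreal"
  assumes "0 < c"
  shows "(\<Sum>\<^sub>\<infinity>x\<in>A. ennreal c * g x) = ennreal c * (\<Sum>\<^sub>\<infinity>x\<in>A. g x)"
proof (rule antisym [OF ennreal_infsum_cmult_le])
  have inv: "ennreal (1 / c) * (ennreal c * y) = y" "ennreal c * (ennreal (1 / c) * y) = y" for y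
    using assms by (simp_all add: mult.assoc [symmetric] ennreal_mult [symmetric])
  have "(\<Sum>\<^sub>\<infinity>x\<in>A. g x) \<le> ennreal (1 / c) * (\<Sum>\<^sub>\<infinity>x\<in>A. ennreal c * g x)"
    using ennreal_infsum_cmult_le [of "ennreal (1 / c)" "\<lambda>x. ennreal c * g x" A] by (simp add: inv)
  from mult_left_mono [OF this, of "ennreal c"]
  show "ennreal c * (\<Sum>\<^sub>\<infinity>x\<in>A. g x) \<le> (\<Sum>\<^sub>\<infinity>x\<in>A. ennreal c * g x)" by (simp add: inv)
qed

lemma ennreal_infsum_add:
  fixes g h :: "'a \<Rightarrow> ennreal"
  shows "(\<Sum>\<^sub>\<infinity>x\<in>A. g x + h x) = (\<Sum>\<^sub>\<infinity>x\<in>A. g x) + (\<Sum>\<^sub>\<infinity>x\<in>A. h x)"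
  by (intro infsum_add nonneg_summable_on_complete) auto

lemma grid_l1_mono:
  assumes "\<And>i j. \<bar>u i j\<bar> \<le> \<bar>w i j\<bar>"
  shows "grid_l1 u \<le> grid_l1 w"
  unfolding grid_l1_def
  by (intro infsum_mono nonneg_summable_on_complete) (use assms in \<open>auto intro: ennreal_leI\<close>)

lemma grid_l1_add_nonneg:
  assumes "\<And>i j. 0 \<le> u i j" "\<And>i j. 0 \<le> w i j"
  shows "grid_l1 (\<lambda>i j. u i j + w i j) = grid_l1 u + grid_l1 w"
  unfolding grid_l1_def ennreal_infsum_add [symmetric]
  by (rule infsum_cong) (use assms in \<open>auto simp: ennreal_plus [symmetric] simp del: ennreal_plus\<close>)

lemma grid_l1_cmult:
  assumes "0 \<le> c"
  shows "grid_l1 (\<lambda>i j. c * u i j) = ennreal c * grid_l1 u"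
proof (cases "c = 0")
  case False
  with assms have "0 < c" by simp
  from ennreal_infsum_cmult [OF this, of "\<lambda>(i, j). ennreal \<bar>u i j\<bar>" UNIV]
  show ?thesis
    unfolding grid_l1_def using assms
    by (simp add: case_prod_unfold abs_mult ennreal_mult)
qed (simp add: grid_l1_def case_prod_unfold)

lemma grid_l1_abs: "grid_l1 (\<lambda>i j. \<bar>u i j\<bar>) = grid_l1 u"
  by (simp add: grid_l1_def)

lemma grid_l1_reindex:
  assumes "bij p"
  shows "grid_l1 (\<lambda>i j. u (fst (p (i, j))) (snd (p (i, j)))) = grid_l1 u"
  using infsum_reindex_bij_betw [OF assms, of "\<lambda>(i, j). ennreal \<bar>u i j\<bar>"]
  unfolding grid_l1_def by (simp add: case_prod_unfold)

lemma grid_l1_shift: "grid_l1 (\<lambda>i j. u (i + k) (j + l)) = grid_l1 u"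
proof -
  have "bij (\<lambda>(i::int, j::int). (i + k, j + l))"
    by (rule o_bij [where g = "\<lambda>(i, j). (i - k, j - l)"]) (auto simp: fun_eq_iff)
  from grid_l1_reindex [OF this, of u] show ?thesis by simp
qed

lemma grid_l1_transpose: "grid_l1 (\<lambda>i j. u j i) = grid_l1 u"
proof -
  have "bij (\<lambda>(i::int, j::int). (j, i))"
    by (rule o_bij [where g = "\<lambda>(i, j). (j, i)"]) (auto simp: fun_eq_iff)
  from grid_l1_reindex [OF this, of u] show ?thesis by simp
qed

text \<open>The four neighbour terms are shifted back to \<open>(i, j)\<close>.  There the weights are those with which the
content of the single cell \<open>(i, j)\<close> is distributed, so that their absolute values can be
added up.\<close>

lemma grid_l1_five_point:
  fixes A B C E :: "int \<Rightarrow> int \<Rightarrow> real"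
  assumes u: "\<And>i j. u i j = (1 - A i j - B i j - C i j - E i j) * D i j
      + A (i - 1) j * D (i - 1) j + B (i + 1) j * D (i + 1) j
      + C i (j - 1) * D i (j - 1) + E i (j + 1) * D i (j + 1) + R i j"
    and W: "\<And>i j. \<bar>1 - A i j - B i j - C i j - E i j\<bar>
      + \<bar>A i j\<bar> + \<bar>B i j\<bar> + \<bar>C i j\<bar> + \<bar>E i j\<bar> \<le> W"
  shows "grid_l1 u \<le> ennreal W * grid_l1 D + grid_l1 R"
proof -
  define P where "P = (\<lambda>i j. \<bar>(1 - A i j - B i j - C i j - E i j) * D i j\<bar>)"
  define a where "a = (\<lambda>i j. \<bar>A i j * D i j\<bar>)"
  define b where "b = (\<lambda>i j. \<bar>B i j * D i j\<bar>)"
  define c where "c = (\<lambda>i j. \<bar>C i j * D i j\<bar>)"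
  define e where "e = (\<lambda>i j. \<bar>E i j * D i j\<bar>)"
  note nonneg = P_def a_def b_def c_def e_def
  have W0: "0 \<le> W" using W [of 0 0] by linarith
  have "grid_l1 u \<le> grid_l1 (\<lambda>i j. P i j + a (i - 1) j + b (i + 1) j + c i (j - 1) + e i (j + 1) + \<bar>R i j\<bar>)"
    by (rule grid_l1_mono) (unfold u nonneg, linarith)
  also have "\<dots> = grid_l1 P + grid_l1 (\<lambda>i j. a (i - 1) j) + grid_l1 (\<lambda>i j. b (i + 1) j)
      + grid_l1 (\<lambda>i j. c i (j - 1)) + grid_l1 (\<lambda>i j. e i (j + 1)) + grid_l1 R"
    by (subst grid_l1_add_nonneg, simp_all add: nonneg grid_l1_abs)+
  also have "\<dots> = grid_l1 P + grid_l1 a + grid_l1 b + grid_l1 c + grid_l1 e + grid_l1 R"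
    using grid_l1_shift [of a "-1" 0] grid_l1_shift [of b 1 0] grid_l1_shift [of c 0 "-1"]
      grid_l1_shift [of e 0 1] by simp
  also have "\<dots> = grid_l1 (\<lambda>i j. P i j + a i j + b i j + c i j + e i j) + grid_l1 R"
    by (simp add: grid_l1_add_nonneg nonneg)
  also have "grid_l1 (\<lambda>i j. P i j + a i j + b i j + c i j + e i j) \<le> grid_l1 (\<lambda>i j. W * D i j)"
  proof (rule grid_l1_mono)
    fix i j
    have "P i j + a i j + b i j + c i j + e i j = (\<bar>1 - A i j - B i j - C i j - E i j\<bar>
      + \<bar>A i j\<bar> + \<bar>B i j\<bar> + \<bar>C i j\<bar> + \<bar>E i j\<bar>) * \<bar>D i j\<bar>"
      by (simp add: nonneg abs_mult distrib_right)
    also have "\<dots> \<le> W * \<bar>D i j\<bar>" using W by (rule mult_right_mono) simp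
    also have "\<dots> = \<bar>W * D i j\<bar>" using W0 by (simp add: abs_mult)
    finally show "\<bar>P i j + a i j + b i j + c i j + e i j\<bar> \<le> \<bar>W * D i j\<bar>" by (simp add: nonneg)
  qed
  also have "\<dots> = ennreal W * grid_l1 D" by (rule grid_l1_cmult [OF W0])
  finally show ?thesis by (simp add: add_right_mono)
qed

lemma grid_TV_eq:
  assumes "0 < dx" "0 < dy"
  shows "grid_TV dx dy r = ennreal dy * grid_l1 (\<lambda>i j. r (i + 1) j - r i j)
    + ennreal dx * grid_l1 (\<lambda>i j. r i (j + 1) - r i j)"
proof -
  have "grid_TV dx dy r = grid_l1 (\<lambda>i j. dy * \<bar>r (i + 1) j - r i j\<bar> + dx * \<bar>r i (j + 1) - r i j\<bar>)"
    unfolding grid_TV_def grid_l1_def using assms by (intro infsum_cong) auto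
  also have "\<dots> = ennreal dy * grid_l1 (\<lambda>i j. \<bar>r (i + 1) j - r i j\<bar>)
      + ennreal dx * grid_l1 (\<lambda>i j. \<bar>r i (j + 1) - r i j\<bar>)"
    using assms by (simp add: grid_l1_add_nonneg grid_l1_cmult)
  finally show ?thesis by (simp add: grid_l1_abs)
qed

lemma grid_l1_eq_0D:
  assumes "grid_l1 r = 0"
  shows "r i j = 0"
proof -
  have "sum (\<lambda>(i, j). ennreal \<bar>r i j\<bar>) {(i, j)} \<le> grid_l1 r"
    unfolding grid_l1_def by (subst nonneg_infsum_complete) (auto intro: SUP_upper2 [of "{(i, j)}"])
  with assms show ?thesis by simp
qed

lemma grid_l1_const_infinite:
  assumes "c \<noteq> 0"
  shows "grid_l1 (\<lambda>i j. c) = \<infinity>"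
  unfolding grid_l1_def
proof (rule infsum_superconst_infinite_ennreal)
  show "ennreal \<bar>c\<bar> \<le> (case x of (i, j) \<Rightarrow> ennreal \<bar>c\<bar>)" for x :: "int \<times> int"
    by (simp add: case_prod_unfold)
  show "ennreal \<bar>c\<bar> > 0" using assms by simp
  show "infinite (UNIV :: (int \<times> int) set)" by (simp add: finite_prod infinite_UNIV_int)
qed

lemma int_constant:
  fixes g :: "int \<Rightarrow> 'a"
  assumes "\<And>i. g (i + 1) = g i"
  shows "g i = g 0"
proof (induction i rule: int_induct [of _ 0])
  case (step2 i)
  with assms [of "i - 1"] show ?case by simp
qed (simp_all add: assms)

text \<open>Vanishing variation makes the grid function constant, and the only constant with a finite norm
is zero.\<close>

lemma grid_TV_eq_0D:
  assumes TV: "grid_TV dx dy r = 0" and pos: "0 < dx" "0 < dy" and fin: "grid_l1 r < \<infinity>"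
  shows "r i j = 0"
proof -
  from TV pos have "grid_l1 (\<lambda>i j. r (i + 1) j - r i j) = 0" "grid_l1 (\<lambda>i j. r i (j + 1) - r i j) = 0"
    by (simp_all add: grid_TV_eq ennreal_eq_0_iff)
  from this [THEN grid_l1_eq_0D] have d: "r (i + 1) j = r i j" "r i (j + 1) = r i j" for i j
    by simp_all
  have c: "r i j = r 0 0" for i j
    using int_constant [of "\<lambda>i. r i j" i] int_constant [of "\<lambda>j. r 0 j" j] d by simp
  then have "r = (\<lambda>i j. r 0 0)" by (intro ext)
  with grid_l1_const_infinite [of "r 0 0"] fin have "r 0 0 = 0" by fastforce
  with c show ?thesis by simp
qed

section \<open>Differences of upwind fluxes\<close>

definition upwind_x :: "(int \<Rightarrow> int \<Rightarrow> real) \<Rightarrow> (int \<Rightarrow> int \<Rightarrow> real) \<Rightarrow> int \<Rightarrow> int \<Rightarrow> real" where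
  "upwind_x c h i j = c i j * h i j + min 0 (c i j) * (h (i + 1) j - h i j)"

definition upwind_y :: "(int \<Rightarrow> int \<Rightarrow> real) \<Rightarrow> (int \<Rightarrow> int \<Rightarrow> real) \<Rightarrow> int \<Rightarrow> int \<Rightarrow> real" where
  "upwind_y c h i j = c i j * h i j + min 0 (c i j) * (h i (j + 1) - h i j)"

definition ppart :: "real \<Rightarrow> real" where "ppart c = max 0 c"
definition npart :: "real \<Rightarrow> real" where "npart c = max 0 (- c)"

lemma pos_neg_parts: "c = ppart c - npart c" "min 0 c = - npart c" "0 \<le> ppart c" "0 \<le> npart c"
  "ppart c + npart c = \<bar>c\<bar>" "\<bar>ppart c - ppart d\<bar> \<le> \<bar>c - d\<bar>" "\<bar>npart c - npart d\<bar> \<le> \<bar>c - d\<bar>"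
  by (auto simp: ppart_def npart_def max_def min_def)

lemma ppart_eq: "ppart c = c + npart c"
  using pos_neg_parts(1) [of c] by linarith

text \<open>What is left when the difference of neighbouring fluxes is compared with an upwind scheme for
the differences of \<open>h\<close>.  Here \<open>h\<close> itself is multiplied only by second differences of \<open>c\<close>, never by those
of its positive or negative part, which have kinks.\<close>

definition rem_x :: "(int \<Rightarrow> int \<Rightarrow> real) \<Rightarrow> (int \<Rightarrow> int \<Rightarrow> real) \<Rightarrow> int \<Rightarrow> int \<Rightarrow> real" where
  "rem_x c h i j = (c (i + 1) j - c i j - (c i j - c (i - 1) j)) * h (i + 1) j
     + (c i j - c (i - 1) j) * (h (i + 1) j - h i j)"

definition rem_y :: "(int \<Rightarrow> int \<Rightarrow> real) \<Rightarrow> (int \<Rightarrow> int \<Rightarrow> real) \<Rightarrow> int \<Rightarrow> int \<Rightarrow> real" where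
  "rem_y c h i j =
     (c (i + 1) j - c i j - (c (i + 1) (j - 1) - c i (j - 1))) * h (i + 1) j
     + (ppart (c (i + 1) (j - 1)) - ppart (c i (j - 1))) * (h (i + 1) j - h (i + 1) (j - 1))
     - (npart (c (i + 1) j) - npart (c i j)) * (h (i + 1) (j + 1) - h (i + 1) j)"

text \<open>The coefficients of \<open>h (i + 1) j - h i j\<close> add up to \<open>\<bar>c i j\<bar>\<close>: the difference across an edge leaves it
only in the direction of the velocity on that edge.  Therefore the outflow in the direction of the
difference obeys the bound for one edge, whatever the sign changes of \<open>c\<close>.\<close>

lemma upwind_x_second_difference:
  "(upwind_x c h (i + 1) j - upwind_x c h i j) - (upwind_x c h i j - upwind_x c h (i - 1) j)
   = (ppart (c i j) + npart (c i j)) * (h (i + 1) j - h i j)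
     - npart (c (i + 1) j) * (h (i + 1 + 1) j - h (i + 1) j)
     - ppart (c (i - 1) j) * (h i j - h (i - 1) j) + rem_x c h i j"
  by (simp add: upwind_x_def rem_x_def pos_neg_parts(2) ppart_eq algebra_simps)

text \<open>The coefficient of \<open>h (i + 1) j - h i j\<close> collects the outflow through the two opposite edges
\<open>j\<close> and \<open>j - 1\<close>.  It can reach twice the maximal speed if \<open>c\<close> changes sign between them.\<close>

lemma upwind_y_mixed_difference:
  "(upwind_y c h (i + 1) j - upwind_y c h (i + 1) (j - 1)) - (upwind_y c h i j - upwind_y c h i (j - 1))
   = (ppart (c i j) + npart (c i (j - 1))) * (h (i + 1) j - h i j)
     - npart (c i j) * (h (i + 1) (j + 1) - h i (j + 1))
     - ppart (c i (j - 1)) * (h (i + 1) (j - 1) - h i (j - 1)) + rem_y c h i j"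
  by (simp add: upwind_y_def rem_y_def pos_neg_parts(2) ppart_eq algebra_simps)

lemma abs_mult_le_mult:
  assumes "\<bar>a\<bar> \<le> a'" "\<bar>x\<bar> \<le> x'"
  shows "\<bar>a * x\<bar> \<le> a' * (x' :: real)"
  using assms by (simp add: abs_mult mult_mono')

section \<open>One step of the scheme with prescribed edge coefficients\<close>

lemma abs_neg_diff_le: "\<bar>- a - b\<bar> \<le> \<bar>a\<bar> + \<bar>b :: real\<bar>"
  by linarith

lemma weights_nonneg_le:
  fixes a b c e W :: real
  assumes "0 \<le> a" "0 \<le> b" "0 \<le> c" "0 \<le> e" "2 * (a + b + c + e) - 1 \<le> W" "1 \<le> W"
  shows "\<bar>1 - a - b - c - e\<bar> + \<bar>a\<bar> + \<bar>b\<bar> + \<bar>c\<bar> + \<bar>e\<bar> \<le> W"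
  using assms by (simp add: abs_if)

text \<open>The weights in the absence of any sign information: \<open>\<bar>1 - o\<bar> + \<bar>o\<bar> \<le> 1 + 2 * \<bar>o\<bar>\<close> with an outflow \<open>o\<close>
of total size at most \<open>1\<close>, three times one third.  The bounds on \<open>c'\<close> and \<open>e'\<close> record the
opposite flow through the same edge.\<close>

lemma weights_le:
  fixes a b c c' e e' :: real
  assumes "\<bar>a\<bar> + \<bar>b\<bar> \<le> 1/3" "\<bar>c\<bar> + \<bar>c'\<bar> \<le> 1/3" "\<bar>e'\<bar> + \<bar>e\<bar> \<le> 1/3"
  shows "\<bar>1 - a - b - c - e\<bar> + \<bar>a\<bar> + \<bar>b\<bar> + \<bar>c\<bar> + \<bar>e\<bar> \<le> 3"
proof -
  have *: "z + a + b + c + e \<le> 3"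
    if "a + b \<le> 1/3" "c \<le> 1/3" "e \<le> 1/3" "z \<le> 2" for a b c e z :: real
    using that by linarith
  have c: "\<bar>c\<bar> \<le> 1/3" and e: "\<bar>e\<bar> \<le> 1/3"
    using add_increasing2 [OF abs_ge_zero order_refl] add_increasing [OF abs_ge_zero order_refl]
      assms(2,3) by (blast intro: order_trans)+
  have "\<bar>1 - a - b - c - e\<bar> \<le> 2"
    using assms(1) c e by (subst abs_le_iff) linarith
  with assms(1) c e show ?thesis by (rule *)
qed

text \<open>One time step with arbitrary coefficients on the edges: \<open>v1\<close>, \<open>J1\<close> at \<open>(i + 1/2, j)\<close> and
\<open>v2\<close>, \<open>J2\<close> at \<open>(i, j + 1/2)\<close>.  The number \<open>S\<close> bounds the relative change of the fluxes between neighbouring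
edges in one time step, and \<open>G\<close> bounds the second divided differences.  The assumptions are symmetric
under exchange of the axes, so that only differences in \<open>x\<close> need to be estimated.\<close>

locale roe_coefficients =
  fixes dx dy dt Lf G S :: real and f :: "real \<Rightarrow> real" and v1 J1 v2 J2 :: "int \<Rightarrow> int \<Rightarrow> real"
  assumes pos: "0 < dx" "0 < dy" "0 < dt" "0 \<le> Lf" "0 \<le> G" "0 \<le> S"
    and f_bound: "\<bar>f r\<bar> \<le> \<bar>r\<bar>"
    and f_sign: "0 \<le> f r / r"
    and f_lip: "\<bar>f r - f s\<bar> \<le> Lf * \<bar>r - s\<bar>"
    and f_mono: "0 \<le> r \<Longrightarrow> r \<le> s \<Longrightarrow> f r \<le> f s"
    and cfl_x: "dt / dx * (\<bar>v1 i j\<bar> + \<bar>J1 i j\<bar> * Lf) \<le> 1/3"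
    and cfl_y: "dt / dy * (\<bar>v2 i j\<bar> + \<bar>J2 i j\<bar> * Lf) \<le> 1/3"
    and dx1: "dt / dx * (\<bar>v1 (i + 1) j - v1 i j\<bar> + \<bar>J1 (i + 1) j - J1 i j\<bar> * Lf) \<le> S"
    and dy1: "dt / dy * (\<bar>v1 i (j + 1) - v1 i j\<bar> + \<bar>J1 i (j + 1) - J1 i j\<bar> * Lf) \<le> S"
    and dx2: "dt / dx * (\<bar>v2 (i + 1) j - v2 i j\<bar> + \<bar>J2 (i + 1) j - J2 i j\<bar> * Lf) \<le> S"
    and dy2: "dt / dy * (\<bar>v2 i (j + 1) - v2 i j\<bar> + \<bar>J2 i (j + 1) - J2 i j\<bar> * Lf) \<le> S"
    and dxx1: "\<bar>v1 (i + 1) j - v1 i j - (v1 i j - v1 (i - 1) j)\<bar>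
        + \<bar>J1 (i + 1) j - J1 i j - (J1 i j - J1 (i - 1) j)\<bar> \<le> G * (dx * dx)"
    and dxy1: "\<bar>v1 (i + 1) j - v1 i j - (v1 (i + 1) (j - 1) - v1 i (j - 1))\<bar>
        + \<bar>J1 (i + 1) j - J1 i j - (J1 (i + 1) (j - 1) - J1 i (j - 1))\<bar> \<le> G * (dx * dy)"
    and dxy2: "\<bar>v2 (i + 1) j - v2 i j - (v2 (i + 1) (j - 1) - v2 i (j - 1))\<bar>
        + \<bar>J2 (i + 1) j - J2 i j - (J2 (i + 1) (j - 1) - J2 i (j - 1))\<bar> \<le> G * (dx * dy)"
    and dyy2: "\<bar>v2 i (j + 1) - v2 i j - (v2 i j - v2 i (j - 1))\<bar>
        + \<bar>J2 i (j + 1) - J2 i j - (J2 i j - J2 i (j - 1))\<bar> \<le> G * (dy * dy)"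
begin

definition flux_x where
  "flux_x r i j = upwind_x v1 r i j + upwind_x J1 (\<lambda>i j. f (r i j)) i j"

definition flux_y where
  "flux_y r i j = upwind_y v2 r i j + upwind_y J2 (\<lambda>i j. f (r i j)) i j"

definition step where
  "step r i j = r i j - dt / dx * (flux_x r i j - flux_x r (i - 1) j)
     - dt / dy * (flux_y r i j - flux_y r i (j - 1))"

lemma f_0: "f 0 = 0" using f_bound [of 0] by simp

text \<open>Since \<open>f\<close> is not differentiated, the difference quotient plays the role of \<open>f'\<close>.  Its value \<open>0\<close> on the
diagonal is harmless, because it is always multiplied by \<open>b - a\<close>.\<close>

definition slope where "slope a b = (f b - f a) / (b - a)"

lemma slope_mult: "f b - f a = slope a b * (b - a)"
  by (cases "a = b") (simp_all add: slope_def)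

lemma slope_bound: "\<bar>slope a b\<bar> \<le> Lf"
  using f_lip [of b a] pos(4) by (cases "a = b") (simp_all add: slope_def abs_divide divide_le_eq)

lemma slope_nonneg: "0 \<le> a \<Longrightarrow> 0 \<le> b \<Longrightarrow> 0 \<le> slope a b"
  using f_mono [of a b] f_mono [of b a]
  by (cases "a \<le> b") (auto simp: slope_def zero_le_divide_iff)

lemma slope_0: "slope 0 r = f r / r" by (simp add: slope_def f_0)

definition rem where
  "rem r i j = - (dt / dx * (rem_x v1 r i j + rem_x J1 (\<lambda>i j. f (r i j)) i j))
     - dt / dy * (rem_y v2 r i j + rem_y J2 (\<lambda>i j. f (r i j)) i j)"

text \<open>The fractions of the quantity in a cell that leave through the right, left, upper and lower edge;
\<open>k\<close> is the slope of \<open>f\<close> seen by the quantity.\<close>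

definition out_r where "out_r k i j = dt / dx * (ppart (v1 i j) + ppart (J1 i j) * k)"
definition out_l where "out_l k i j = dt / dx * (npart (v1 i j) + npart (J1 i j) * k)"
definition out_u where "out_u k i j = dt / dy * (ppart (v2 i j) + ppart (J2 i j) * k)"
definition out_d where "out_d k i j = dt / dy * (npart (v2 i j) + npart (J2 i j) * k)"

lemmas out_defs = out_r_def out_l_def out_u_def out_d_def

text \<open>Conservation form of the step for the differences in \<open>x\<close>.  The difference sits on the edge
\<open>(i + 1/2, j)\<close>; so \<open>A\<close> and \<open>B\<close> both use the coefficients of this edge, while \<open>C\<close> and \<open>E\<close> use
those of the upper and the lower edge of the cell \<open>(i, j)\<close>.\<close>

lemma step_difference:
  fixes r
  defines "D \<equiv> \<lambda>i j. r (i + 1) j - r i j"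
    and "k \<equiv> \<lambda>i j. slope (r i j) (r (i + 1) j)"
  defines "A \<equiv> \<lambda>i j. out_r (k i j) i j" and "B \<equiv> \<lambda>i j. out_l (k i j) i j"
    and "C \<equiv> \<lambda>i j. out_u (k i j) i j" and "E \<equiv> \<lambda>i j. out_d (k i j) i (j - 1)"
  shows "step r (i + 1) j - step r i j = (1 - A i j - B i j - C i j - E i j) * D i j
      + A (i - 1) j * D (i - 1) j + B (i + 1) j * D (i + 1) j
      + C i (j - 1) * D i (j - 1) + E i (j + 1) * D i (j + 1) + rem r i j"
proof -
  have fD: "f (r (i + 1) j) - f (r i j) = k i j * D i j" for i j
    unfolding k_def D_def by (rule slope_mult)
  have fD': "f (r i j) - f (r (i - 1) j) = k (i - 1) j * D (i - 1) j" for i j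
    using fD [of "i - 1" j] by simp
  have D': "r i j - r (i - 1) j = D (i - 1) j" for i j
    by (simp add: D_def)
  have D0: "r (i + 1) j - r i j = D i j" for i j by (simp add: D_def)
  have X: "(flux_x r (i + 1) j - flux_x r i j) - (flux_x r i j - flux_x r (i - 1) j)
    = (ppart (v1 i j) + npart (v1 i j)) * D i j - npart (v1 (i + 1) j) * D (i + 1) j
      - ppart (v1 (i - 1) j) * D (i - 1) j
      + (ppart (J1 i j) + npart (J1 i j)) * (k i j * D i j)
      - npart (J1 (i + 1) j) * (k (i + 1) j * D (i + 1) j)
      - ppart (J1 (i - 1) j) * (k (i - 1) j * D (i - 1) j)
      + (rem_x v1 r i j + rem_x J1 (\<lambda>i j. f (r i j)) i j)"
    using upwind_x_second_difference [of v1 r i j]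
      upwind_x_second_difference [of J1 "\<lambda>i j. f (r i j)" i j]
    unfolding flux_x_def fD fD' D' D0 by linarith
  have Y: "(flux_y r (i + 1) j - flux_y r (i + 1) (j - 1)) - (flux_y r i j - flux_y r i (j - 1))
    = (ppart (v2 i j) + npart (v2 i (j - 1))) * D i j - npart (v2 i j) * D i (j + 1)
      - ppart (v2 i (j - 1)) * D i (j - 1)
      + (ppart (J2 i j) + npart (J2 i (j - 1))) * (k i j * D i j)
      - npart (J2 i j) * (k i (j + 1) * D i (j + 1))
      - ppart (J2 i (j - 1)) * (k i (j - 1) * D i (j - 1))
      + (rem_y v2 r i j + rem_y J2 (\<lambda>i j. f (r i j)) i j)"
    using upwind_y_mixed_difference [of v2 r i j]
      upwind_y_mixed_difference [of J2 "\<lambda>i j. f (r i j)" i j]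
    unfolding flux_y_def fD D0 by linarith
  have "step r (i + 1) j - step r i j = D i j
      - dt / dx * ((flux_x r (i + 1) j - flux_x r i j) - (flux_x r i j - flux_x r (i - 1) j))
      - dt / dy * ((flux_y r (i + 1) j - flux_y r (i + 1) (j - 1)) - (flux_y r i j - flux_y r i (j - 1)))"
    by (simp add: step_def D_def algebra_simps)
  then show ?thesis
    unfolding X Y A_def B_def C_def E_def out_defs rem_def
    by (simp add: algebra_simps)
qed

text \<open>The same form for the values themselves.  As \<open>f 0 = 0\<close>, the slope between \<open>0\<close> and
\<open>r i j\<close> turns \<open>f (r i j)\<close> into a multiple of \<open>r i j\<close>.\<close>

lemma step_five_point:
  fixes r
  defines "k \<equiv> \<lambda>i j. slope 0 (r i j)"
  defines "A \<equiv> \<lambda>i j. out_r (k i j) i j" and "B \<equiv> \<lambda>i j. out_l (k i j) (i - 1) j"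
    and "C \<equiv> \<lambda>i j. out_u (k i j) i j" and "E \<equiv> \<lambda>i j. out_d (k i j) i (j - 1)"
  shows "step r i j = (1 - A i j - B i j - C i j - E i j) * r i j
      + A (i - 1) j * r (i - 1) j + B (i + 1) j * r (i + 1) j
      + C i (j - 1) * r i (j - 1) + E i (j + 1) * r i (j + 1)"
proof -
  have fr: "f (r i j) = k i j * r i j" for i j
    using slope_mult [of "r i j" 0] by (simp add: k_def f_0)
  show ?thesis
    unfolding step_def flux_x_def flux_y_def upwind_x_def upwind_y_def A_def B_def C_def E_def out_defs fr
    by (simp add: pos_neg_parts(2) ppart_eq algebra_simps)
qed

lemma ratios_pos: "0 \<le> dt / dx" "0 \<le> dt / dy"
  using pos by simp_all

lemma transpose: "roe_coefficients dy dx dt Lf G S f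
    (\<lambda>i j. v2 j i) (\<lambda>i j. J2 j i) (\<lambda>i j. v1 j i) (\<lambda>i j. J1 j i)"
proof
  fix i j
  show "\<bar>v2 j (i + 1) - v2 j i - (v2 (j - 1) (i + 1) - v2 (j - 1) i)\<bar>
      + \<bar>J2 j (i + 1) - J2 j i - (J2 (j - 1) (i + 1) - J2 (j - 1) i)\<bar> \<le> G * (dy * dx)"
    using dxy2 [of "j - 1" "i + 1"] by (simp add: algebra_simps)
  show "\<bar>v1 j (i + 1) - v1 j i - (v1 (j - 1) (i + 1) - v1 (j - 1) i)\<bar>
      + \<bar>J1 j (i + 1) - J1 j i - (J1 (j - 1) (i + 1) - J1 (j - 1) i)\<bar> \<le> G * (dy * dx)"
    using dxy1 [of "j - 1" "i + 1"] by (simp add: algebra_simps)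
qed (fact pos f_bound f_sign f_lip f_mono cfl_x cfl_y dx1 dy1 dx2 dy2 dxx1 dyy2)+

lemma step_transpose:
  "roe_coefficients.step dy dx dt f (\<lambda>i j. v2 j i) (\<lambda>i j. J2 j i) (\<lambda>i j. v1 j i) (\<lambda>i j. J1 j i)
     (\<lambda>i j. r j i) i j = step r j i"
proof -
  interpret t: roe_coefficients dy dx dt Lf G S f
    "\<lambda>i j. v2 j i" "\<lambda>i j. J2 j i" "\<lambda>i j. v1 j i" "\<lambda>i j. J1 j i"
    by (rule transpose)
  show ?thesis
    by (simp add: t.step_def step_def t.flux_x_def t.flux_y_def flux_x_def flux_y_def
        upwind_x_def upwind_y_def)
qed

lemma out_abs_x: "\<bar>k\<bar> \<le> Lf \<Longrightarrow> \<bar>out_r k i j\<bar> + \<bar>out_l k i j\<bar> \<le> 1/3"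
proof -
  assume k: "\<bar>k\<bar> \<le> Lf"
  have "\<bar>out_r k i j\<bar> + \<bar>out_l k i j\<bar>
      \<le> dt / dx * (ppart (v1 i j) + ppart (J1 i j) * \<bar>k\<bar>) + dt / dx * (npart (v1 i j) + npart (J1 i j) * \<bar>k\<bar>)"
    unfolding out_r_def out_l_def abs_mult
    using ratios_pos pos_neg_parts(3,4)
    by (intro add_mono mult_mono abs_triangle_ineq [THEN order_trans]) (auto simp: abs_mult)
  also have "\<dots> = dt / dx * ((ppart (v1 i j) + npart (v1 i j)) + (ppart (J1 i j) + npart (J1 i j)) * \<bar>k\<bar>)"
    by (simp only: algebra_simps)
  also have "\<dots> \<le> dt / dx * (\<bar>v1 i j\<bar> + \<bar>J1 i j\<bar> * Lf)"
    unfolding pos_neg_parts(5) using ratios_pos k by (intro mult_left_mono add_left_mono) auto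
  also have "\<dots> \<le> 1/3" by (rule cfl_x)
  finally show ?thesis .
qed

lemma out_nonneg:
  assumes "0 \<le> k"
  shows "0 \<le> out_r k i j" "0 \<le> out_l k i j" "0 \<le> out_u k i j" "0 \<le> out_d k i j"
  unfolding out_defs using assms
  by (intro mult_nonneg_nonneg add_nonneg_nonneg ratios_pos pos_neg_parts(3,4); assumption)+

text \<open>If opposite edges carried the same coefficients, at most one third could leave, since a coefficient
drives outflow through only one of them.  Replacing the coefficients of the left edge by those of the
right one costs the change \<open>S\<close>.\<close>

lemma out_sum_x:
  assumes "0 \<le> k" "k \<le> Lf"
  shows "out_r k i j + out_l k (i - 1) j \<le> 1/3 + S"
proof -
  have "npart (v1 (i - 1) j) \<le> npart (v1 i j) + \<bar>v1 i j - v1 (i - 1) j\<bar>"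
    and J: "npart (J1 (i - 1) j) \<le> npart (J1 i j) + \<bar>J1 i j - J1 (i - 1) j\<bar>"
    using pos_neg_parts(7) [of "v1 i j" "v1 (i - 1) j"] pos_neg_parts(7) [of "J1 i j" "J1 (i - 1) j"] by linarith+
  moreover have "npart (J1 (i - 1) j) * k \<le> npart (J1 i j) * k + \<bar>J1 i j - J1 (i - 1) j\<bar> * Lf"
  proof -
    have "npart (J1 (i - 1) j) * k \<le> (npart (J1 i j) + \<bar>J1 i j - J1 (i - 1) j\<bar>) * k"
      using J assms by (intro mult_right_mono) auto
    also have "\<dots> \<le> npart (J1 i j) * k + \<bar>J1 i j - J1 (i - 1) j\<bar> * Lf"
      using assms by (simp add: distrib_right mult_left_mono)
    finally show ?thesis .
  qed
  ultimately have "dt / dx * (npart (v1 (i - 1) j) + npart (J1 (i - 1) j) * k)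
      \<le> dt / dx * ((npart (v1 i j) + npart (J1 i j) * k)
        + (\<bar>v1 i j - v1 (i - 1) j\<bar> + \<bar>J1 i j - J1 (i - 1) j\<bar> * Lf))"
    using ratios_pos by (intro mult_left_mono) auto
  then have "out_l k (i - 1) j \<le> out_l k i j + dt / dx * (\<bar>v1 i j - v1 (i - 1) j\<bar> + \<bar>J1 i j - J1 (i - 1) j\<bar> * Lf)"
    unfolding out_l_def by (simp add: distrib_left)
  also have "\<dots> \<le> out_l k i j + S" using dx1 [of "i - 1" j] by simp
  finally show ?thesis
    using out_abs_x [of k i j] out_nonneg [of k i j] assms by auto
qed

lemma out_sum_y:
  assumes "0 \<le> k" "k \<le> Lf"
  shows "out_u k i j + out_d k i (j - 1) \<le> 1/3 + S"
proof -
  interpret t: roe_coefficients dy dx dt Lf G S f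
    "\<lambda>i j. v2 j i" "\<lambda>i j. J2 j i" "\<lambda>i j. v1 j i" "\<lambda>i j. J1 j i"
    by (rule transpose)
  show ?thesis
    using t.out_sum_x [OF assms, of j i] by (simp add: t.out_defs out_defs)
qed

lemma out_abs_y: "\<bar>k\<bar> \<le> Lf \<Longrightarrow> \<bar>out_u k i j\<bar> + \<bar>out_d k i j\<bar> \<le> 1/3"
proof -
  assume k: "\<bar>k\<bar> \<le> Lf"
  interpret t: roe_coefficients dy dx dt Lf G S f
    "\<lambda>i j. v2 j i" "\<lambda>i j. J2 j i" "\<lambda>i j. v1 j i" "\<lambda>i j. J1 j i"
    by (rule transpose)
  show ?thesis
    using t.out_abs_x [OF k, of j i] by (simp add: t.out_defs out_defs)
qed

lemma out_le:
  assumes "0 \<le> k" "k \<le> Lf"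
  shows "out_r k i j + out_l k i j \<le> 1/3" "out_u k i j + out_d k i j \<le> 1/3"
  using out_abs_x [of k i j] out_abs_y [of k i j] out_nonneg [OF assms(1), of i j] assms
  by (simp_all only: abs_of_nonneg)

lemma slope_0_bounds: "0 \<le> slope 0 r" "slope 0 r \<le> Lf"
  using f_sign [of r] slope_bound [of 0 r] by (simp add: slope_0, linarith)

text \<open>For nonnegative weights \<open>\<bar>1 - o\<bar> + o\<close> is either \<open>1\<close> or \<open>2 * o - 1\<close>, where \<open>o\<close> is the total
outflow.  No sign of \<open>r\<close> is involved, because \<open>f r / r\<close> is always nonnegative.\<close>

lemma grid_l1_step:
  assumes W: "\<And>k i j. 0 \<le> k \<Longrightarrow> k \<le> Lf \<Longrightarrow>
      2 * (out_r k i j + out_l k (i - 1) j + out_u k i j + out_d k i (j - 1)) - 1 \<le> W"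
    and "1 \<le> W"
  shows "grid_l1 (step r) \<le> ennreal W * grid_l1 r"
proof -
  have "grid_l1 (step r) \<le> ennreal W * grid_l1 r + grid_l1 (\<lambda>i j. 0)"
  proof (rule grid_l1_five_point)
    fix i j
    show "step r i j = (1 - out_r (slope 0 (r i j)) i j - out_l (slope 0 (r i j)) (i - 1) j
        - out_u (slope 0 (r i j)) i j - out_d (slope 0 (r i j)) i (j - 1)) * r i j
      + out_r (slope 0 (r (i - 1) j)) (i - 1) j * r (i - 1) j
      + out_l (slope 0 (r (i + 1) j)) (i + 1 - 1) j * r (i + 1) j
      + out_u (slope 0 (r i (j - 1))) i (j - 1) * r i (j - 1)
      + out_d (slope 0 (r i (j + 1))) i (j + 1 - 1) * r i (j + 1) + 0"
      using step_five_point [of r i j] by simp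
    show "\<bar>1 - out_r (slope 0 (r i j)) i j - out_l (slope 0 (r i j)) (i - 1) j
        - out_u (slope 0 (r i j)) i j - out_d (slope 0 (r i j)) i (j - 1)\<bar>
      + \<bar>out_r (slope 0 (r i j)) i j\<bar> + \<bar>out_l (slope 0 (r i j)) (i - 1) j\<bar>
      + \<bar>out_u (slope 0 (r i j)) i j\<bar> + \<bar>out_d (slope 0 (r i j)) i (j - 1)\<bar> \<le> W"
      by (intro weights_nonneg_le W out_nonneg slope_0_bounds \<open>1 \<le> W\<close>)
  qed
  moreover have "grid_l1 (\<lambda>i j. 0) = 0"
    by (simp add: grid_l1_def case_prod_unfold)
  ultimately show ?thesis by simp
qed

text \<open>The outflow is at most \<open>4/3\<close>, one third for each edge, and \<open>2 * 4/3 - 1 = 5/3\<close>.\<close>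

lemma grid_l1_step_le: "grid_l1 (step r) \<le> ennreal (5/3) * grid_l1 r"
proof (rule grid_l1_step)
  fix k i j assume k: "0 \<le> k" "k \<le> Lf"
  show "2 * (out_r k i j + out_l k (i - 1) j + out_u k i j + out_d k i (j - 1)) - 1 \<le> 5/3"
    using out_le(1) [OF k, of i j] out_le(1) [OF k, of "i - 1" j]
      out_le(2) [OF k, of i j] out_le(2) [OF k, of i "j - 1"]
      out_nonneg [OF k(1), of i j] out_nonneg [OF k(1), of "i - 1" j] out_nonneg [OF k(1), of i "j - 1"]
    by auto
qed simp

lemma grid_l1_step_nonincreasing:
  assumes "S \<le> 1/6"
  shows "grid_l1 (step r) \<le> grid_l1 r"
proof -
  have "grid_l1 (step r) \<le> ennreal 1 * grid_l1 r"
  proof (rule grid_l1_step)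
    fix k i j assume k: "0 \<le> k" "k \<le> Lf"
    show "2 * (out_r k i j + out_l k (i - 1) j + out_u k i j + out_d k i (j - 1)) - 1 \<le> 1"
      using out_sum_x [OF k, of i j] out_sum_y [OF k, of i j] assms by auto
  qed simp
  then show ?thesis by simp
qed

lemma step_nonneg:
  assumes "S \<le> 1/6" and r: "\<And>i j. 0 \<le> r i j"
  shows "0 \<le> step r i j"
proof -
  note k = slope_0_bounds [of "r i j"]
  have "0 \<le> 1 - out_r (slope 0 (r i j)) i j - out_l (slope 0 (r i j)) (i - 1) j
        - out_u (slope 0 (r i j)) i j - out_d (slope 0 (r i j)) i (j - 1)"
    using out_sum_x [OF k, of i j] out_sum_y [OF k, of i j] assms(1) by linarith
  then show ?thesis
    unfolding step_five_point
    using r out_nonneg [OF slope_0_bounds(1)] by (intro add_nonneg_nonneg mult_nonneg_nonneg) auto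
qed

lemma rem_x_bound:
  assumes "\<And>i j. \<bar>h (i + 1) j - h i j\<bar> \<le> l * \<bar>r (i + 1) j - r i j\<bar>" "\<And>i j. \<bar>h i j\<bar> \<le> \<bar>r i j\<bar>"
  shows "\<bar>rem_x c h i j\<bar> \<le> \<bar>c (i + 1) j - c i j - (c i j - c (i - 1) j)\<bar> * \<bar>r (i + 1) j\<bar>
    + \<bar>c i j - c (i - 1) j\<bar> * l * \<bar>r (i + 1) j - r i j\<bar>"
  unfolding rem_x_def mult.assoc
  by (intro abs_triangle_ineq [THEN order_trans] add_mono abs_mult_le_mult assms order_refl)

lemma rem_y_bound:
  assumes "\<And>i j. \<bar>h i (j + 1) - h i j\<bar> \<le> l * \<bar>r i (j + 1) - r i j\<bar>" "\<And>i j. \<bar>h i j\<bar> \<le> \<bar>r i j\<bar>"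
  shows "\<bar>rem_y c h i j\<bar>
    \<le> \<bar>c (i + 1) j - c i j - (c (i + 1) (j - 1) - c i (j - 1))\<bar> * \<bar>r (i + 1) j\<bar>
      + \<bar>c (i + 1) (j - 1) - c i (j - 1)\<bar> * l * \<bar>r (i + 1) j - r (i + 1) (j - 1)\<bar>
      + \<bar>c (i + 1) j - c i j\<bar> * l * \<bar>r (i + 1) (j + 1) - r (i + 1) j\<bar>"
proof -
  have h: "\<bar>h (i + 1) j - h (i + 1) (j - 1)\<bar> \<le> l * \<bar>r (i + 1) j - r (i + 1) (j - 1)\<bar>"
    using assms(1) [of "i + 1" "j - 1"] by simp
  show ?thesis
    unfolding rem_y_def mult.assoc
    by (intro abs_triangle_ineq [THEN order_trans] abs_triangle_ineq4 [THEN order_trans]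
        add_mono abs_mult_le_mult assms h pos_neg_parts order_refl)
qed

text \<open>The change in \<open>x\<close> of the coefficients on the horizontal edges is bounded by \<open>S\<close> in units of \<open>dx / dt\<close>, but it
enters with the factor \<open>dt / dy\<close>.  The ratio \<open>dx / dy\<close> is just the one between the weights of the
two kinds of differences in the total variation.\<close>

lemma rem_bound:
  "\<bar>rem r i j\<bar> \<le> S * \<bar>r (i + 1) j - r i j\<bar>
     + S * dx / dy * (\<bar>r (i + 1) j - r (i + 1) (j - 1)\<bar> + \<bar>r (i + 1) (j + 1) - r (i + 1) j\<bar>)
     + 2 * dt * G * dx * \<bar>r (i + 1) j\<bar>"
proof -
  let ?D = "\<bar>r (i + 1) j - r i j\<bar>"
  let ?E = "\<lambda>j. \<bar>r (i + 1) j - r (i + 1) (j - 1)\<bar>"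
  let ?xv = "\<bar>v1 (i + 1) j - v1 i j - (v1 i j - v1 (i - 1) j)\<bar>"
  let ?xJ = "\<bar>J1 (i + 1) j - J1 i j - (J1 i j - J1 (i - 1) j)\<bar>"
  let ?yv = "\<bar>v2 (i + 1) j - v2 i j - (v2 (i + 1) (j - 1) - v2 i (j - 1))\<bar>"
  let ?yJ = "\<bar>J2 (i + 1) j - J2 i j - (J2 (i + 1) (j - 1) - J2 i (j - 1))\<bar>"
  let ?a = "\<bar>v1 i j - v1 (i - 1) j\<bar> + \<bar>J1 i j - J1 (i - 1) j\<bar> * Lf"
  let ?b = "\<lambda>j. \<bar>v2 (i + 1) j - v2 i j\<bar> + \<bar>J2 (i + 1) j - J2 i j\<bar> * Lf"
  have x: "\<bar>rem_x v1 r i j + rem_x J1 (\<lambda>i j. f (r i j)) i j\<bar>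
      \<le> (?xv + ?xJ) * \<bar>r (i + 1) j\<bar> + ?a * ?D"
  proof -
    have b1: "\<bar>rem_x v1 r i j\<bar> \<le> ?xv * \<bar>r (i + 1) j\<bar> + \<bar>v1 i j - v1 (i - 1) j\<bar> * 1 * ?D"
      by (rule rem_x_bound) simp_all
    have b2: "\<bar>rem_x J1 (\<lambda>i j. f (r i j)) i j\<bar>
        \<le> ?xJ * \<bar>r (i + 1) j\<bar> + \<bar>J1 i j - J1 (i - 1) j\<bar> * Lf * ?D"
      by (rule rem_x_bound) (rule f_lip f_bound)+
    show ?thesis
      by (rule order_trans [OF abs_triangle_ineq order_trans [OF add_mono [OF b1 b2]]])
        (simp add: algebra_simps)
  qed
  have y: "\<bar>rem_y v2 r i j + rem_y J2 (\<lambda>i j. f (r i j)) i j\<bar>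
      \<le> (?yv + ?yJ) * \<bar>r (i + 1) j\<bar> + ?b (j - 1) * ?E j + ?b j * ?E (j + 1)"
  proof -
    have b1: "\<bar>rem_y v2 r i j\<bar> \<le> ?yv * \<bar>r (i + 1) j\<bar>
        + \<bar>v2 (i + 1) (j - 1) - v2 i (j - 1)\<bar> * 1 * ?E j + \<bar>v2 (i + 1) j - v2 i j\<bar> * 1 * ?E (j + 1)"
      using rem_y_bound [of r 1 r v2 i j] by simp
    have b2: "\<bar>rem_y J2 (\<lambda>i j. f (r i j)) i j\<bar> \<le> ?yJ * \<bar>r (i + 1) j\<bar>
        + \<bar>J2 (i + 1) (j - 1) - J2 i (j - 1)\<bar> * Lf * ?E j + \<bar>J2 (i + 1) j - J2 i j\<bar> * Lf * ?E (j + 1)"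
      using rem_y_bound [of "\<lambda>i j. f (r i j)" Lf r J2 i j, OF f_lip f_bound] by simp
    show ?thesis
      by (rule order_trans [OF abs_triangle_ineq order_trans [OF add_mono [OF b1 b2]]])
        (simp add: algebra_simps)
  qed
  have expand: "l * (X * z + a * D) + m * (Y * z + b * E + b' * E')
      = l * X * z + (l * a) * D + m * Y * z + (m * b) * E + (m * b') * E'"
    for l m X Y z a b b' D E E' :: real
    by (simp add: distrib_left)
  have b: "dt / dy * ?b j \<le> S * dx / dy" for j
  proof -
    have "dt / dy * ?b j = dx / dy * (dt / dx * ?b j)" using pos by simp
    also have "\<dots> \<le> dx / dy * S" using dx2 pos by (intro mult_left_mono) auto
    finally show ?thesis by (simp add: mult.commute)
  qed
  have "\<bar>rem r i j\<bar> \<le> dt / dx * ((?xv + ?xJ) * \<bar>r (i + 1) j\<bar> + ?a * ?D)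
      + dt / dy * ((?yv + ?yJ) * \<bar>r (i + 1) j\<bar> + ?b (j - 1) * ?E j + ?b j * ?E (j + 1))"
  proof -
    have "\<bar>rem r i j\<bar> \<le> \<bar>dt / dx * (rem_x v1 r i j + rem_x J1 (\<lambda>i j. f (r i j)) i j)\<bar>
        + \<bar>dt / dy * (rem_y v2 r i j + rem_y J2 (\<lambda>i j. f (r i j)) i j)\<bar>"
      unfolding rem_def by (rule abs_neg_diff_le)
    also have "\<dots> = dt / dx * \<bar>rem_x v1 r i j + rem_x J1 (\<lambda>i j. f (r i j)) i j\<bar>
        + dt / dy * \<bar>rem_y v2 r i j + rem_y J2 (\<lambda>i j. f (r i j)) i j\<bar>"
      using ratios_pos by (simp only: abs_mult abs_of_nonneg)
    also have "\<dots> \<le> dt / dx * ((?xv + ?xJ) * \<bar>r (i + 1) j\<bar> + ?a * ?D)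
      + dt / dy * ((?yv + ?yJ) * \<bar>r (i + 1) j\<bar> + ?b (j - 1) * ?E j + ?b j * ?E (j + 1))"
      by (intro add_mono mult_left_mono x y ratios_pos)
    finally show ?thesis .
  qed
  also have "\<dots> = dt / dx * (?xv + ?xJ) * \<bar>r (i + 1) j\<bar> + (dt / dx * ?a) * ?D
      + dt / dy * (?yv + ?yJ) * \<bar>r (i + 1) j\<bar> + (dt / dy * ?b (j - 1)) * ?E j + (dt / dy * ?b j) * ?E (j + 1)"
    by (rule expand)
  also have "\<dots> \<le> dt / dx * (G * (dx * dx)) * \<bar>r (i + 1) j\<bar> + S * ?D
      + dt / dy * (G * (dx * dy)) * \<bar>r (i + 1) j\<bar> + (S * dx / dy) * ?E j + (S * dx / dy) * ?E (j + 1)"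
    using dx1 [of "i - 1" j] dxx1 dxy2 b ratios_pos
    by (intro add_mono mult_right_mono mult_left_mono) auto
  also have "\<dots> = S * ?D + S * dx / dy * (?E j + ?E (j + 1)) + 2 * dt * G * dx * \<bar>r (i + 1) j\<bar>"
    using pos by (simp add: algebra_simps)
  finally show ?thesis by simp
qed

lemma grid_l1_rem:
  "ennreal dy * grid_l1 (rem r) \<le> ennreal S * (ennreal dy * grid_l1 (\<lambda>i j. r (i + 1) j - r i j))
     + ennreal (2 * S) * (ennreal dx * grid_l1 (\<lambda>i j. r i (j + 1) - r i j))
     + ennreal (2 * dt * G) * (ennreal (dx * dy) * grid_l1 r)"
proof -
  define X where "X = (\<lambda>i j. r (i + 1) j - r i j)"
  define Y where "Y = (\<lambda>i j. r i (j + 1) - r i j)"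
  define s where "s = S * dx / dy"
  define g where "g = 2 * dt * G * dx"
  have nonneg: "0 \<le> s" "0 \<le> g" "0 \<le> S" using pos by (simp_all add: s_def g_def)
  have "grid_l1 (rem r) \<le> grid_l1 (\<lambda>i j. S * \<bar>X i j\<bar> + s * \<bar>Y (i + 1) (j - 1)\<bar> + s * \<bar>Y (i + 1) j\<bar>
      + g * \<bar>r (i + 1) j\<bar>)"
  proof (rule grid_l1_mono)
    fix i j
    have "0 \<le> S * \<bar>X i j\<bar> + s * \<bar>Y (i + 1) (j - 1)\<bar> + s * \<bar>Y (i + 1) j\<bar> + g * \<bar>r (i + 1) j\<bar>"
      using nonneg by simp
    moreover have "\<bar>rem r i j\<bar> \<le> S * \<bar>X i j\<bar> + s * \<bar>Y (i + 1) (j - 1)\<bar> + s * \<bar>Y (i + 1) j\<bar> + g * \<bar>r (i + 1) j\<bar>"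
      using rem_bound [of r i j] by (simp add: X_def Y_def s_def g_def distrib_left)
    ultimately show "\<bar>rem r i j\<bar> \<le> \<bar>S * \<bar>X i j\<bar> + s * \<bar>Y (i + 1) (j - 1)\<bar> + s * \<bar>Y (i + 1) j\<bar> + g * \<bar>r (i + 1) j\<bar>\<bar>"
      by simp
  qed
  also have "\<dots> = grid_l1 (\<lambda>i j. S * \<bar>X i j\<bar>) + grid_l1 (\<lambda>i j. s * \<bar>Y (i + 1) (j - 1)\<bar>)
      + grid_l1 (\<lambda>i j. s * \<bar>Y (i + 1) j\<bar>) + grid_l1 (\<lambda>i j. g * \<bar>r (i + 1) j\<bar>)"
    using nonneg by (simp add: grid_l1_add_nonneg)
  also have "\<dots> = ennreal S * grid_l1 X + ennreal s * grid_l1 Y + ennreal s * grid_l1 Y + ennreal g * grid_l1 r"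
    using nonneg grid_l1_shift [of Y 1 "-1"] grid_l1_shift [of Y 1 0] grid_l1_shift [of r 1 0]
    by (simp add: grid_l1_cmult grid_l1_abs)
  finally have "ennreal dy * grid_l1 (rem r)
      \<le> ennreal dy * (ennreal S * grid_l1 X + ennreal s * grid_l1 Y + ennreal s * grid_l1 Y + ennreal g * grid_l1 r)"
    by (rule mult_left_mono) simp
  also have "\<dots> = ennreal S * (ennreal dy * grid_l1 X) + (ennreal dy * ennreal s + ennreal dy * ennreal s) * grid_l1 Y
      + ennreal dy * ennreal g * grid_l1 r"
    by (simp add: algebra_simps)
  also have "ennreal dy * ennreal s + ennreal dy * ennreal s = ennreal (2 * S) * ennreal dx"
    using pos by (simp add: s_def ennreal_mult [symmetric] ennreal_plus [symmetric] del: ennreal_plus)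
  also have "ennreal dy * ennreal g = ennreal (2 * dt * G) * ennreal (dx * dy)"
    using pos by (simp add: g_def ennreal_mult [symmetric] algebra_simps)
  finally show ?thesis by (simp add: X_def Y_def mult.assoc)
qed

lemma grid_l1_step_difference_x:
  assumes W: "\<And>i j. \<bar>1 - out_r (k i j) i j - out_l (k i j) i j - out_u (k i j) i j - out_d (k i j) i (j - 1)\<bar>
      + \<bar>out_r (k i j) i j\<bar> + \<bar>out_l (k i j) i j\<bar> + \<bar>out_u (k i j) i j\<bar> + \<bar>out_d (k i j) i (j - 1)\<bar> \<le> W"
    and k: "k = (\<lambda>i j. slope (r i j) (r (i + 1) j))"
  shows "ennreal dy * grid_l1 (\<lambda>i j. step r (i + 1) j - step r i j)
     \<le> ennreal (W + S) * (ennreal dy * grid_l1 (\<lambda>i j. r (i + 1) j - r i j))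
     + ennreal (2 * S) * (ennreal dx * grid_l1 (\<lambda>i j. r i (j + 1) - r i j))
     + ennreal (2 * dt * G) * (ennreal (dx * dy) * grid_l1 r)"
proof -
  have "0 \<le> W" using W [of 0 0] by linarith
  have "grid_l1 (\<lambda>i j. step r (i + 1) j - step r i j)
      \<le> ennreal W * grid_l1 (\<lambda>i j. r (i + 1) j - r i j) + grid_l1 (rem r)"
  proof (rule grid_l1_five_point)
    fix i j
    show "step r (i + 1) j - step r i j = (1 - out_r (k i j) i j - out_l (k i j) i j - out_u (k i j) i j
        - out_d (k i j) i (j - 1)) * (r (i + 1) j - r i j)
      + out_r (k (i - 1) j) (i - 1) j * (r (i - 1 + 1) j - r (i - 1) j)
      + out_l (k (i + 1) j) (i + 1) j * (r (i + 1 + 1) j - r (i + 1) j)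
      + out_u (k i (j - 1)) i (j - 1) * (r (i + 1) (j - 1) - r i (j - 1))
      + out_d (k i (j + 1)) i (j + 1 - 1) * (r (i + 1) (j + 1) - r i (j + 1)) + rem r i j"
      unfolding k by (rule step_difference)
  qed (rule W)
  from mult_left_mono [OF this, of "ennreal dy"]
  have "ennreal dy * grid_l1 (\<lambda>i j. step r (i + 1) j - step r i j)
    \<le> ennreal W * (ennreal dy * grid_l1 (\<lambda>i j. r (i + 1) j - r i j)) + ennreal dy * grid_l1 (rem r)"
    by (simp add: algebra_simps)
  also note add_left_mono [OF grid_l1_rem]
  finally show ?thesis
    using \<open>0 \<le> W\<close> pos by (simp add: algebra_simps)
qed

lemma grid_l1_step_difference_x_le:
  "ennreal dy * grid_l1 (\<lambda>i j. step r (i + 1) j - step r i j)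
     \<le> ennreal (3 + S) * (ennreal dy * grid_l1 (\<lambda>i j. r (i + 1) j - r i j))
     + ennreal (2 * S) * (ennreal dx * grid_l1 (\<lambda>i j. r i (j + 1) - r i j))
     + ennreal (2 * dt * G) * (ennreal (dx * dy) * grid_l1 r)"
proof (rule grid_l1_step_difference_x [OF _ refl])
  fix i j
  have k: "\<bar>slope (r i j) (r (i + 1) j)\<bar> \<le> Lf" by (rule slope_bound)
  show "\<bar>1 - out_r (slope (r i j) (r (i + 1) j)) i j - out_l (slope (r i j) (r (i + 1) j)) i j
        - out_u (slope (r i j) (r (i + 1) j)) i j - out_d (slope (r i j) (r (i + 1) j)) i (j - 1)\<bar>
      + \<bar>out_r (slope (r i j) (r (i + 1) j)) i j\<bar> + \<bar>out_l (slope (r i j) (r (i + 1) j)) i j\<bar>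
      + \<bar>out_u (slope (r i j) (r (i + 1) j)) i j\<bar> + \<bar>out_d (slope (r i j) (r (i + 1) j)) i (j - 1)\<bar> \<le> 3"
    by (rule weights_le [OF out_abs_x [OF k] out_abs_y [OF k] out_abs_y [OF k]])
qed

text \<open>For nonnegative \<open>r\<close> the slopes of \<open>f\<close> are nonnegative, and the outflow is at most
\<open>1/3 + (1/3 + S) \<le> 1\<close>; so the five-point part does not increase the norm.\<close>

lemma grid_l1_step_difference_x_mono:
  assumes "S \<le> 1/6" and r: "\<And>i j. 0 \<le> r i j"
  shows "ennreal dy * grid_l1 (\<lambda>i j. step r (i + 1) j - step r i j)
     \<le> ennreal (1 + S) * (ennreal dy * grid_l1 (\<lambda>i j. r (i + 1) j - r i j))
     + ennreal (2 * S) * (ennreal dx * grid_l1 (\<lambda>i j. r i (j + 1) - r i j))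
     + ennreal (2 * dt * G) * (ennreal (dx * dy) * grid_l1 r)"
proof (rule grid_l1_step_difference_x [OF _ refl])
  fix i j
  define k where "k = slope (r i j) (r (i + 1) j)"
  have k0: "0 \<le> k" unfolding k_def by (rule slope_nonneg [OF r r])
  have k1: "\<bar>k\<bar> \<le> Lf" unfolding k_def by (rule slope_bound)
  have k2: "k \<le> Lf" using k1 by simp
  from out_le(1) [OF k0 k2, of i j] out_sum_y [OF k0 k2, of i j] assms(1)
  have "2 * (out_r k i j + out_l k i j + out_u k i j + out_d k i (j - 1)) - 1 \<le> 1" by auto
  then show "\<bar>1 - out_r (slope (r i j) (r (i + 1) j)) i j - out_l (slope (r i j) (r (i + 1) j)) i j
        - out_u (slope (r i j) (r (i + 1) j)) i j - out_d (slope (r i j) (r (i + 1) j)) i (j - 1)\<bar>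
      + \<bar>out_r (slope (r i j) (r (i + 1) j)) i j\<bar> + \<bar>out_l (slope (r i j) (r (i + 1) j)) i j\<bar>
      + \<bar>out_u (slope (r i j) (r (i + 1) j)) i j\<bar> + \<bar>out_d (slope (r i j) (r (i + 1) j)) i (j - 1)\<bar> \<le> 1"
    unfolding k_def [symmetric] by (intro weights_nonneg_le out_nonneg k0) simp_all
qed

text \<open>The remainder contributes \<open>S\<close> to the differences in the own direction and \<open>2 * S\<close> to those in the
other one, which makes \<open>3 * S\<close> after summation over the two directions.\<close>

lemma grid_TV_step:
  assumes x: "ennreal dy * grid_l1 (\<lambda>i j. step r (i + 1) j - step r i j)
     \<le> ennreal (W + S) * (ennreal dy * grid_l1 (\<lambda>i j. r (i + 1) j - r i j))
     + ennreal (2 * S) * (ennreal dx * grid_l1 (\<lambda>i j. r i (j + 1) - r i j))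
     + ennreal (2 * dt * G) * (ennreal (dx * dy) * grid_l1 r)"
   and y: "ennreal dx * grid_l1 (\<lambda>i j. step r i (j + 1) - step r i j)
     \<le> ennreal (W + S) * (ennreal dx * grid_l1 (\<lambda>i j. r i (j + 1) - r i j))
     + ennreal (2 * S) * (ennreal dy * grid_l1 (\<lambda>i j. r (i + 1) j - r i j))
     + ennreal (2 * dt * G) * (ennreal (dx * dy) * grid_l1 r)"
   and "0 \<le> W"
  shows "grid_TV dx dy (step r) \<le> ennreal (W + 3 * S) * grid_TV dx dy r
     + ennreal (4 * dt * G) * (ennreal (dx * dy) * grid_l1 r)"
proof -
  have *: "ennreal (W + 3 * S) = ennreal (W + S) + ennreal (2 * S)"
    "ennreal (4 * dt * G) = ennreal (2 * dt * G) + ennreal (2 * dt * G)"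
    using pos \<open>0 \<le> W\<close> by (simp_all add: ennreal_plus [symmetric] del: ennreal_plus)
  have regroup: "(a * p + b * q + u * z) + (a * q + b * p + u * z) = (a + b) * (p + q) + (u + u) * z"
    for a b p q u z :: ennreal
    by (simp add: distrib_left distrib_right add_ac)
  show ?thesis
    unfolding grid_TV_eq [OF pos(1,2)] *
    using add_mono [OF x y] unfolding regroup .
qed

lemma grid_l1_transposed_differences:
  "grid_l1 (\<lambda>i j. r j (i + 1) - r j i) = grid_l1 (\<lambda>i j. r i (j + 1) - r i j)"
  "grid_l1 (\<lambda>i j. r (j + 1) i - r j i) = grid_l1 (\<lambda>i j. r (i + 1) j - r i j)"
  by (rule grid_l1_transpose)+

lemma grid_TV_step_le:
  "grid_TV dx dy (step r) \<le> ennreal (3 + 3 * S) * grid_TV dx dy r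
     + ennreal (4 * dt * G) * (ennreal (dx * dy) * grid_l1 r)"
proof (rule grid_TV_step [OF grid_l1_step_difference_x_le])
  interpret t: roe_coefficients dy dx dt Lf G S f
    "\<lambda>i j. v2 j i" "\<lambda>i j. J2 j i" "\<lambda>i j. v1 j i" "\<lambda>i j. J1 j i"
    by (rule transpose)
  show "ennreal dx * grid_l1 (\<lambda>i j. step r i (j + 1) - step r i j)
     \<le> ennreal (3 + S) * (ennreal dx * grid_l1 (\<lambda>i j. r i (j + 1) - r i j))
     + ennreal (2 * S) * (ennreal dy * grid_l1 (\<lambda>i j. r (i + 1) j - r i j))
     + ennreal (2 * dt * G) * (ennreal (dx * dy) * grid_l1 r)"
    using t.grid_l1_step_difference_x_le [of "\<lambda>i j. r j i"]
    unfolding step_transpose grid_l1_transposed_differences grid_l1_transpose [of r]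
      mult.commute [of dy dx] .
qed simp

lemma grid_TV_step_mono:
  assumes "S \<le> 1/6" and r: "\<And>i j. 0 \<le> r i j"
  shows "grid_TV dx dy (step r) \<le> ennreal (1 + 3 * S) * grid_TV dx dy r
     + ennreal (4 * dt * G) * (ennreal (dx * dy) * grid_l1 r)"
proof (rule grid_TV_step [OF grid_l1_step_difference_x_mono [OF assms]])
  interpret t: roe_coefficients dy dx dt Lf G S f
    "\<lambda>i j. v2 j i" "\<lambda>i j. J2 j i" "\<lambda>i j. v1 j i" "\<lambda>i j. J1 j i"
    by (rule transpose)
  show "ennreal dx * grid_l1 (\<lambda>i j. step r i (j + 1) - step r i j)
     \<le> ennreal (1 + S) * (ennreal dx * grid_l1 (\<lambda>i j. r i (j + 1) - r i j))
     + ennreal (2 * S) * (ennreal dy * grid_l1 (\<lambda>i j. r (i + 1) j - r i j))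
     + ennreal (2 * dt * G) * (ennreal (dx * dy) * grid_l1 r)"
    using t.grid_l1_step_difference_x_mono [OF assms(1), of "\<lambda>i j. r j i", OF r]
    unfolding step_transpose grid_l1_transposed_differences grid_l1_transpose [of r]
      mult.commute [of dy dx] .
qed simp

end

section \<open>The saturating nonlinearity\<close>

text \<open>The nonlocal velocity is \<open>- \<epsilon>\<close> times this function of the two components of the discrete
gradient.  It is the first component of the gradient of \<open>(x, y) \<mapsto> sqrt (1 + x\<^sup>2 + y\<^sup>2)\<close>; the second one
arises by exchanging the arguments.\<close>

definition sat :: "real \<Rightarrow> real \<Rightarrow> real" where
  "sat x y = x / sqrt (1 + x\<^sup>2 + y\<^sup>2)"

definition inv_length :: "real \<Rightarrow> real \<Rightarrow> real" where
  "inv_length x y = inverse (sqrt (1 + x\<^sup>2 + y\<^sup>2))"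

definition sat_dx :: "real \<Rightarrow> real \<Rightarrow> real" where
  "sat_dx x y = (1 + y\<^sup>2) * inv_length x y ^ 3"

definition sat_dy :: "real \<Rightarrow> real \<Rightarrow> real" where
  "sat_dy x y = - (x * y) * inv_length x y ^ 3"

lemma inv_length_pos: "0 < inv_length x y"
  by (simp add: inv_length_def add_pos_nonneg)

lemma inv_length_sq: "(1 + x\<^sup>2 + y\<^sup>2) * (inv_length x y)\<^sup>2 = 1"
proof -
  have "0 < 1 + x\<^sup>2 + y\<^sup>2" by (simp add: add_pos_nonneg)
  then show ?thesis by (simp add: inv_length_def power_inverse)
qed

lemma inv_length_bounds:
  fixes x y :: real
  defines "R \<equiv> inv_length x y"
  shows "R \<le> 1" "x\<^sup>2 * R\<^sup>2 \<le> 1" "y\<^sup>2 * R\<^sup>2 \<le> 1" "(1 + y\<^sup>2) * R\<^sup>2 \<le> 1"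
    "\<bar>x\<bar> * R\<^sup>2 \<le> 1/2" "\<bar>y\<bar> * R\<^sup>2 \<le> 1/2" "\<bar>x\<bar> * R \<le> 1"
proof -
  have R0: "0 < R" unfolding R_def by (rule inv_length_pos)
  have e: "R\<^sup>2 + x\<^sup>2 * R\<^sup>2 + y\<^sup>2 * R\<^sup>2 = 1"
    using inv_length_sq [of x y] unfolding R_def by (simp add: distrib_right)
  have n: "0 \<le> x\<^sup>2 * R\<^sup>2" "0 \<le> y\<^sup>2 * R\<^sup>2" "0 \<le> R\<^sup>2" by simp_all
  from e n have "R\<^sup>2 \<le> 1" by linarith
  then show "R \<le> 1" using R0 by (simp add: power_le_one_iff)
  show x: "x\<^sup>2 * R\<^sup>2 \<le> 1" and y: "y\<^sup>2 * R\<^sup>2 \<le> 1" using e n by linarith+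
  show "(1 + y\<^sup>2) * R\<^sup>2 \<le> 1" unfolding distrib_right mult_1_left using e n by linarith
  \<comment> \<open>from \<open>2 * \<bar>z\<bar> \<le> 1 + z\<^sup>2\<close>\<close>
  have half: "\<bar>z\<bar> * R\<^sup>2 \<le> 1/2" if "R\<^sup>2 + z\<^sup>2 * R\<^sup>2 \<le> 1" for z :: real
  proof -
    have "0 \<le> (1 - \<bar>z\<bar>)\<^sup>2 * R\<^sup>2" by simp
    then have "2 * (\<bar>z\<bar> * R\<^sup>2) \<le> R\<^sup>2 + z\<^sup>2 * R\<^sup>2"
      by (simp add: power2_eq_square algebra_simps)
    with that show ?thesis by simp
  qed
  show "\<bar>x\<bar> * R\<^sup>2 \<le> 1/2" "\<bar>y\<bar> * R\<^sup>2 \<le> 1/2" by (rule half, use e n in linarith)+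
  have "(\<bar>x\<bar> * R)\<^sup>2 \<le> 1" using x by (simp add: power_mult_distrib)
  then show "\<bar>x\<bar> * R \<le> 1" using R0 by (simp add: power_le_one_iff)
qed

lemma sat_eq: "sat x y = x * inv_length x y"
  by (simp add: sat_def inv_length_def divide_inverse)

lemma abs_sat_le: "\<bar>sat x y\<bar> \<le> 1"
  using inv_length_bounds(7) [where x = x and y = y] inv_length_pos [of x y] by (simp add: sat_eq abs_mult)

lemma inv_length_derivative:
  fixes a b h k t :: real
  defines "x \<equiv> \<lambda>t. a + t * h" and "y \<equiv> \<lambda>t. b + t * k"
  shows "((\<lambda>t. inv_length (x t) (y t)) has_real_derivative
    - (x t * h + y t * k) * inv_length (x t) (y t) ^ 3) (at t)"
proof -
  have p: "0 < 1 + (x t)\<^sup>2 + (y t)\<^sup>2" by (simp add: add_pos_nonneg)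
  have u: "((\<lambda>t. 1 + (x t)\<^sup>2 + (y t)\<^sup>2) has_real_derivative 2 * x t * h + 2 * y t * k) (at t)"
    unfolding x_def y_def by (auto intro!: derivative_eq_intros simp: algebra_simps)
  have "((\<lambda>t. inverse (sqrt (1 + (x t)\<^sup>2 + (y t)\<^sup>2))) has_real_derivative
     - ((inverse (sqrt (1 + (x t)\<^sup>2 + (y t)\<^sup>2)) / 2 * (2 * x t * h + 2 * y t * k))
       * inverse (sqrt (1 + (x t)\<^sup>2 + (y t)\<^sup>2) ^ Suc (Suc 0)))) (at t)"
    using p by (intro DERIV_inverse_fun DERIV_chain2 [OF DERIV_real_sqrt u]) auto
  then have d: "((\<lambda>t. inv_length (x t) (y t)) has_real_derivative
     - ((inv_length (x t) (y t) / 2 * (2 * x t * h + 2 * y t * k)) * inv_length (x t) (y t) ^ 2)) (at t)"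
    unfolding inv_length_def power_inverse by (simp add: power2_eq_square)
  show ?thesis
    by (rule DERIV_cong [OF d]) (simp add: power3_eq_cube power2_eq_square algebra_simps)
qed

lemma sat_derivative:
  fixes a b h k t :: real
  defines "x \<equiv> \<lambda>t. a + t * h" and "y \<equiv> \<lambda>t. b + t * k"
  shows "((\<lambda>t. sat (x t) (y t)) has_real_derivative sat_dx (x t) (y t) * h + sat_dy (x t) (y t) * k) (at t)"
proof -
  define R where "R = inv_length (x t) (y t)"
  have R: "((\<lambda>t. inv_length (x t) (y t)) has_real_derivative - (x t * h + y t * k) * R ^ 3) (at t)"
    unfolding R_def x_def y_def by (rule inv_length_derivative)
  have x: "(x has_real_derivative h) (at t)"
    unfolding x_def by (auto intro!: derivative_eq_intros)
  have "R = (1 + (x t)\<^sup>2 + (y t)\<^sup>2) * R ^ 3"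
    using inv_length_sq [of "x t" "y t"] unfolding R_def by (simp add: power3_eq_cube power2_eq_square)
  then have "h * R + (- (x t * h + y t * k) * R ^ 3) * x t
      = h * ((1 + (x t)\<^sup>2 + (y t)\<^sup>2) * R ^ 3) + (- (x t * h + y t * k) * R ^ 3) * x t"
    by simp
  also have "\<dots> = sat_dx (x t) (y t) * h + sat_dy (x t) (y t) * k"
    unfolding sat_dx_def sat_dy_def R_def [symmetric] by (simp add: power2_eq_square algebra_simps)
  finally show ?thesis
    using DERIV_mult [OF x R] unfolding sat_eq R_def [symmetric] by simp
qed

text \<open>The second derivatives are grouped into the factors that \<open>inv_length_bounds\<close> controls.\<close>

lemma sat_partials_derivative:
  fixes a b h k t :: real
  defines "x \<equiv> a + t * h" and "y \<equiv> b + t * k"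
  defines "R \<equiv> inv_length x y"
  shows "((\<lambda>t. sat_dx (a + t * h) (b + t * k)) has_real_derivative
      - 3 * (1 + y\<^sup>2) * R\<^sup>2 * (x * R\<^sup>2) * R * h
      + (2 - 3 * ((1 + y\<^sup>2) * R\<^sup>2)) * (y * R\<^sup>2) * R * k) (at t)"
    and "((\<lambda>t. sat_dy (a + t * h) (b + t * k)) has_real_derivative
      (3 * (x\<^sup>2 * R\<^sup>2) - 1) * (y * R\<^sup>2) * R * h + (3 * (y\<^sup>2 * R\<^sup>2) - 1) * (x * R\<^sup>2) * R * k) (at t)"
proof -
  have R: "((\<lambda>t. inv_length (a + t * h) (b + t * k)) has_real_derivative - (x * h + y * k) * R ^ 3) (at t)"
    unfolding x_def y_def R_def by (rule inv_length_derivative)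
  have dx: "((\<lambda>t. a + t * h) has_real_derivative h) (at t)" and dy: "((\<lambda>t. b + t * k) has_real_derivative k) (at t)"
    by (auto intro!: derivative_eq_intros)
  note R3 = DERIV_power [OF R, of 3]
  have "((\<lambda>t. 1 + (b + t * k)\<^sup>2) has_real_derivative 2 * y * k) (at t)"
    unfolding y_def by (auto intro!: derivative_eq_intros)
  from DERIV_mult [OF this R3]
  show "((\<lambda>t. sat_dx (a + t * h) (b + t * k)) has_real_derivative
      - 3 * (1 + y\<^sup>2) * R\<^sup>2 * (x * R\<^sup>2) * R * h
      + (2 - 3 * ((1 + y\<^sup>2) * R\<^sup>2)) * (y * R\<^sup>2) * R * k) (at t)"
    unfolding sat_dx_def x_def [symmetric] y_def [symmetric] R_def [symmetric]
    by (rule DERIV_cong) (simp add: eval_nat_numeral algebra_simps)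
  from DERIV_mult [OF DERIV_minus [OF DERIV_mult [OF dx dy]] R3]
  show "((\<lambda>t. sat_dy (a + t * h) (b + t * k)) has_real_derivative
      (3 * (x\<^sup>2 * R\<^sup>2) - 1) * (y * R\<^sup>2) * R * h + (3 * (y\<^sup>2 * R\<^sup>2) - 1) * (x * R\<^sup>2) * R * k) (at t)"
    unfolding sat_dy_def x_def [symmetric] y_def [symmetric] R_def [symmetric]
    by (rule DERIV_cong) (simp add: eval_nat_numeral algebra_simps)
qed

lemma unit_segment_bound:
  fixes g g' :: "real \<Rightarrow> real"
  assumes "\<And>t. 0 \<le> t \<Longrightarrow> t \<le> 1 \<Longrightarrow> (g has_real_derivative g' t) (at t)"
    and "\<And>t. 0 \<le> t \<Longrightarrow> t \<le> 1 \<Longrightarrow> \<bar>g' t\<bar> \<le> M"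
  shows "\<bar>g 1 - g 0\<bar> \<le> M"
proof -
  obtain z where "0 < z" "z < 1" "g 1 - g 0 = (1 - 0) * g' z"
    using MVT2 [of 0 1 g g'] assms(1) by auto
  with assms(2) [of z] show ?thesis by simp
qed

lemma abs_sat_partials_le: "\<bar>sat_dx x y\<bar> \<le> 1" "\<bar>sat_dy x y\<bar> \<le> 1"
proof -
  define R where "R = inv_length x y"
  note b = inv_length_bounds [where x = x and y = y, folded R_def]
  have R0: "0 < R" unfolding R_def by (rule inv_length_pos)
  have "sat_dx x y = ((1 + y\<^sup>2) * R\<^sup>2) * R"
    unfolding sat_dx_def R_def by (simp add: eval_nat_numeral)
  then show "\<bar>sat_dx x y\<bar> \<le> 1"
    using mult_mono [OF b(4,1)] R0 by (simp add: abs_mult add_nonneg_nonneg)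
  have "\<bar>sat_dy x y\<bar> = (\<bar>x\<bar> * R) * (\<bar>y\<bar> * R\<^sup>2)"
    unfolding sat_dy_def R_def [symmetric] using R0 by (simp add: abs_mult eval_nat_numeral)
  also have "\<dots> \<le> 1 * (1/2)"
    using R0 by (intro mult_mono b) auto
  finally show "\<bar>sat_dy x y\<bar> \<le> 1" by simp
qed

lemma sat_lipschitz: "\<bar>sat x' y' - sat x y\<bar> \<le> \<bar>x' - x\<bar> + \<bar>y' - y\<bar>"
proof -
  have "\<bar>sat (x + 1 * (x' - x)) (y + 1 * (y' - y)) - sat (x + 0 * (x' - x)) (y + 0 * (y' - y))\<bar>
      \<le> \<bar>x' - x\<bar> + \<bar>y' - y\<bar>"
  proof (rule unit_segment_bound [OF sat_derivative])
    fix t :: real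
    show "\<bar>sat_dx (x + t * (x' - x)) (y + t * (y' - y)) * (x' - x)
        + sat_dy (x + t * (x' - x)) (y + t * (y' - y)) * (y' - y)\<bar> \<le> \<bar>x' - x\<bar> + \<bar>y' - y\<bar>"
      using abs_sat_partials_le
      by (intro order_trans [OF abs_triangle_ineq] add_mono) (simp_all add: abs_mult mult_left_le_one_le)
  qed
  then show ?thesis by simp
qed

lemma three_factor_le:
  fixes a b c h :: real
  assumes "\<bar>a\<bar> \<le> A" "\<bar>b\<bar> \<le> B" "\<bar>c\<bar> \<le> 1"
  shows "\<bar>a * b * c * h\<bar> \<le> A * B * \<bar>h\<bar>"
proof -
  have "\<bar>a * b * c\<bar> \<le> A * B * 1"
    unfolding abs_mult using assms by (intro mult_mono) auto
  then show ?thesis by (simp add: abs_mult mult_right_mono)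
qed

lemma sat_partials_lipschitz:
  "\<bar>sat_dx x' y' - sat_dx x y\<bar> \<le> 3/2 * \<bar>x' - x\<bar> + \<bar>y' - y\<bar>"
  "\<bar>sat_dy x' y' - sat_dy x y\<bar> \<le> \<bar>x' - x\<bar> + \<bar>y' - y\<bar>"
proof -
  have "\<bar>sat_dx (x + 1 * (x' - x)) (y + 1 * (y' - y)) - sat_dx (x + 0 * (x' - x)) (y + 0 * (y' - y))\<bar>
      \<le> 3 * (1/2) * \<bar>x' - x\<bar> + 2 * (1/2) * \<bar>y' - y\<bar>"
  proof (rule unit_segment_bound [OF sat_partials_derivative(1)])
    fix t :: real
    let ?x = "x + t * (x' - x)" and ?y = "y + t * (y' - y)"
    define R where "R = inv_length ?x ?y"
    note b = inv_length_bounds [where x = ?x and y = ?y, folded R_def]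
    have R0: "0 < R" unfolding R_def by (rule inv_length_pos)
    have c: "\<bar>R\<bar> \<le> 1" "\<bar>?x * R\<^sup>2\<bar> \<le> 1/2" "\<bar>?y * R\<^sup>2\<bar> \<le> 1/2"
      using b R0 by (simp_all add: abs_mult)
    have q: "0 \<le> (1 + ?y\<^sup>2) * R\<^sup>2" by (simp add: add_nonneg_nonneg)
    show "\<bar>- 3 * (1 + ?y\<^sup>2) * R\<^sup>2 * (?x * R\<^sup>2) * R * (x' - x)
        + (2 - 3 * ((1 + ?y\<^sup>2) * R\<^sup>2)) * (?y * R\<^sup>2) * R * (y' - y)\<bar>
        \<le> 3 * (1/2) * \<bar>x' - x\<bar> + 2 * (1/2) * \<bar>y' - y\<bar>"
    proof (intro order_trans [OF abs_triangle_ineq] add_mono three_factor_le c)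
      show "\<bar>- 3 * (1 + ?y\<^sup>2) * R\<^sup>2\<bar> \<le> 3"
        using b(4) q by (subst abs_le_iff) (simp only: mult.assoc, linarith)
      show "\<bar>2 - 3 * ((1 + ?y\<^sup>2) * R\<^sup>2)\<bar> \<le> 2" using b(4) q by (simp only: abs_le_iff) linarith
    qed
  qed
  then show "\<bar>sat_dx x' y' - sat_dx x y\<bar> \<le> 3/2 * \<bar>x' - x\<bar> + \<bar>y' - y\<bar>" by simp
  have "\<bar>sat_dy (x + 1 * (x' - x)) (y + 1 * (y' - y)) - sat_dy (x + 0 * (x' - x)) (y + 0 * (y' - y))\<bar>
      \<le> 2 * (1/2) * \<bar>x' - x\<bar> + 2 * (1/2) * \<bar>y' - y\<bar>"
  proof (rule unit_segment_bound [OF sat_partials_derivative(2)])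
    fix t :: real
    let ?x = "x + t * (x' - x)" and ?y = "y + t * (y' - y)"
    define R where "R = inv_length ?x ?y"
    note b = inv_length_bounds [where x = ?x and y = ?y, folded R_def]
    have R0: "0 < R" unfolding R_def by (rule inv_length_pos)
    have c: "\<bar>R\<bar> \<le> 1" "\<bar>?x * R\<^sup>2\<bar> \<le> 1/2" "\<bar>?y * R\<^sup>2\<bar> \<le> 1/2"
      using b R0 by (simp_all add: abs_mult)
    have q: "0 \<le> ?x\<^sup>2 * R\<^sup>2" "0 \<le> ?y\<^sup>2 * R\<^sup>2" by simp_all
    show "\<bar>(3 * (?x\<^sup>2 * R\<^sup>2) - 1) * (?y * R\<^sup>2) * R * (x' - x)
        + (3 * (?y\<^sup>2 * R\<^sup>2) - 1) * (?x * R\<^sup>2) * R * (y' - y)\<bar>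
        \<le> 2 * (1/2) * \<bar>x' - x\<bar> + 2 * (1/2) * \<bar>y' - y\<bar>"
    proof (intro order_trans [OF abs_triangle_ineq] add_mono three_factor_le c)
      show "\<bar>3 * (?x\<^sup>2 * R\<^sup>2) - 1\<bar> \<le> 2" using b(2) q(1) by (simp only: abs_le_iff) linarith
      show "\<bar>3 * (?y\<^sup>2 * R\<^sup>2) - 1\<bar> \<le> 2" using b(3) q(2) by (simp only: abs_le_iff) linarith
    qed
  qed
  then show "\<bar>sat_dy x' y' - sat_dy x y\<bar> \<le> \<bar>x' - x\<bar> + \<bar>y' - y\<bar>" by simp
qed

lemma convex_combination_abs_le:
  fixes u w t :: real
  assumes "\<bar>u\<bar> \<le> p" "\<bar>w\<bar> \<le> p" "0 \<le> t" "t \<le> 1"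
  shows "\<bar>(1 - t) * u + t * w\<bar> \<le> p"
proof -
  have "\<bar>(1 - t) * u + t * w\<bar> \<le> (1 - t) * \<bar>u\<bar> + t * \<bar>w\<bar>"
    using assms abs_triangle_ineq [of "(1 - t) * u" "t * w"] by (simp add: abs_mult)
  also have "\<dots> \<le> p" using assms by (intro convex_bound_le) auto
  finally show ?thesis .
qed

text \<open>The points \<open>A\<close>, \<open>B\<close>, \<open>C\<close>, \<open>D\<close> are the corners of a quadrilateral with sides \<open>AB\<close> and \<open>CD\<close>.  The mean
value theorem is applied to the difference of \<^const>\<open>sat\<close> along these two sides.  Its derivative
compares the gradients at two points at distance \<open>p'\<close> and the sides themselves, which differ by \<open>q\<close>.\<close>

lemma sat_second_difference:
  fixes xA xB xC xD yA yB yC yD p p' q :: real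
  assumes h: "\<bar>xB - xA\<bar> \<le> p" "\<bar>yB - yA\<bar> \<le> p"
    and s: "\<bar>xC - xA\<bar> \<le> p'" "\<bar>yC - yA\<bar> \<le> p'" "\<bar>xD - xB\<bar> \<le> p'" "\<bar>yD - yB\<bar> \<le> p'"
    and m: "\<bar>xD - xC - (xB - xA)\<bar> \<le> q" "\<bar>yD - yC - (yB - yA)\<bar> \<le> q"
  shows "\<bar>sat xD yD - sat xC yC - (sat xB yB - sat xA yA)\<bar> \<le> 2 * q + 6 * (p * p')"
proof -
  let ?hx = "xB - xA" and ?hy = "yB - yA" and ?kx = "xD - xC" and ?ky = "yD - yC"
  have pp: "0 \<le> p" "0 \<le> p'" using h s by linarith+
  define g where "g = (\<lambda>t. sat (xC + t * ?kx) (yC + t * ?ky) - sat (xA + t * ?hx) (yA + t * ?hy))"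
  have "\<bar>g 1 - g 0\<bar> \<le> 2 * q + 6 * (p * p')"
    unfolding g_def
  proof (rule unit_segment_bound [OF DERIV_diff [OF sat_derivative sat_derivative]])
    fix t :: real assume t: "0 \<le> t" "t \<le> 1"
    let ?x1 = "xC + t * ?kx" and ?y1 = "yC + t * ?ky" and ?x0 = "xA + t * ?hx" and ?y0 = "yA + t * ?hy"
    have x: "\<bar>?x1 - ?x0\<bar> \<le> p'"
      using convex_combination_abs_le [OF s(1,3) t] by (simp add: algebra_simps)
    have y: "\<bar>?y1 - ?y0\<bar> \<le> p'"
      using convex_combination_abs_le [OF s(2,4) t] by (simp add: algebra_simps)
    have P: "\<bar>sat_dx ?x1 ?y1 - sat_dx ?x0 ?y0\<bar> \<le> 3 * p'"
      using add_mono [OF mult_left_mono [OF x, of "3/2"] y] pp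
      by (intro order_trans [OF sat_partials_lipschitz(1)]) auto
    have Q: "\<bar>sat_dy ?x1 ?y1 - sat_dy ?x0 ?y0\<bar> \<le> 3 * p'"
      using add_mono [OF x y] pp
      by (intro order_trans [OF sat_partials_lipschitz(2)]) auto
    have split: "P1 * kx + Q1 * ky - (P0 * hx + Q0 * hy)
        = (P1 * (kx - hx) + Q1 * (ky - hy)) + ((P1 - P0) * hx + (Q1 - Q0) * hy)"
      for P1 Q1 P0 Q0 kx ky hx hy :: real by (simp add: algebra_simps)
    have "\<bar>sat_dx ?x1 ?y1 * ?kx + sat_dy ?x1 ?y1 * ?ky - (sat_dx ?x0 ?y0 * ?hx + sat_dy ?x0 ?y0 * ?hy)\<bar>
        \<le> (1 * q + 1 * q) + (3 * p' * p + 3 * p' * p)"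
      unfolding split
      by (intro order_trans [OF abs_triangle_ineq] add_mono abs_mult_le_mult abs_sat_partials_le m P Q h)
    then show "\<bar>sat_dx ?x1 ?y1 * ?kx + sat_dy ?x1 ?y1 * ?ky - (sat_dx ?x0 ?y0 * ?hx + sat_dy ?x0 ?y0 * ?hy)\<bar>
        \<le> 2 * q + 6 * (p * p')" by (simp add: mult.commute)
  qed
  then show ?thesis by (simp add: g_def)
qed

section \<open>Increments of differentiable maps and essential suprema of derivatives\<close>

lemma C_class_Suc_D:
  assumes "C_class (Suc m) g"
  shows "g differentiable (at x)" "b \<in> Basis \<Longrightarrow> C_class m (partial b g)"
  using assms by auto

lemma C_class_continuous: "C_class m g \<Longrightarrow> continuous_on UNIV g"
  by (cases m) (auto simp: differentiable_imp_continuous_within continuous_at_imp_continuous_on)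

lemma norm_increment_le:
  fixes g :: "'a::euclidean_space \<Rightarrow> 'b::real_normed_vector"
  assumes g: "\<And>x. g differentiable (at x)" and M: "\<And>x. norm (partial b g x) \<le> M"
  shows "norm (g (z + t *\<^sub>R b) - g z) \<le> M * \<bar>t\<bar>"
proof -
  have "norm (g (z + t *\<^sub>R b) - g (z + 0 *\<^sub>R b)) \<le> M * norm (t - 0)"
  proof (rule differentiable_bound [of UNIV "\<lambda>s. g (z + s *\<^sub>R b)" "\<lambda>s u. u *\<^sub>R partial b g (z + s *\<^sub>R b)"])
    fix s :: real
    have d: "(g has_derivative frechet_derivative g (at (z + s *\<^sub>R b))) (at (z + s *\<^sub>R b))"
      using g frechet_derivative_works by blast
    have "((\<lambda>s. z + s *\<^sub>R b) has_derivative (\<lambda>u. u *\<^sub>R b)) (at s)"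
      by (auto intro!: derivative_eq_intros)
    from diff_chain_at [OF this d]
    show "((\<lambda>s. g (z + s *\<^sub>R b)) has_derivative (\<lambda>u. u *\<^sub>R partial b g (z + s *\<^sub>R b))) (at s within UNIV)"
      by (simp add: o_def partial_def linear_frechet_derivative [OF g, THEN linear_scale])
    show "onorm (\<lambda>u. u *\<^sub>R partial b g (z + s *\<^sub>R b)) \<le> M"
    proof (rule onorm_le)
      show "norm (u *\<^sub>R partial b g (z + s *\<^sub>R b)) \<le> M * norm u" for u
        using mult_right_mono [OF M, of "norm u"] by (simp add: mult.commute)
    qed
  qed simp_all
  then show ?thesis by simp
qed

lemma norm_second_increment_le:
  fixes g :: "'a::euclidean_space \<Rightarrow> 'b::real_normed_vector"
  assumes g: "\<And>x. g differentiable (at x)" and pg: "\<And>x. partial b g differentiable (at x)"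
    and M: "\<And>x. norm (partial c (partial b g) x) \<le> M"
  shows "norm (g (z + t *\<^sub>R b + s *\<^sub>R c) - g (z + s *\<^sub>R c) - (g (z + t *\<^sub>R b) - g z)) \<le> M * \<bar>s\<bar> * \<bar>t\<bar>"
proof -
  define G where "G = (\<lambda>w. g (w + s *\<^sub>R c) - g w)"
  have G: "(G has_derivative (\<lambda>u. frechet_derivative g (at (w + s *\<^sub>R c)) u - frechet_derivative g (at w) u)) (at w)" for w
  proof -
    have d: "(g has_derivative frechet_derivative g (at x)) (at x)" for x
      using g frechet_derivative_works by blast
    have "((\<lambda>w. w + s *\<^sub>R c) has_derivative (\<lambda>u. u)) (at w)"
      by (auto intro!: derivative_eq_intros)
    from has_derivative_diff [OF diff_chain_at [OF this d] d]
    show ?thesis unfolding G_def by (simp add: o_def)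
  qed
  have "norm (G (z + t *\<^sub>R b) - G z) \<le> (M * \<bar>s\<bar>) * \<bar>t\<bar>"
  proof (rule norm_increment_le)
    fix w
    show "G differentiable at w" using G by (blast intro: differentiableI)
    have "partial b G w = partial b g (w + s *\<^sub>R c) - partial b g w"
      unfolding partial_def frechet_derivative_at [OF G, symmetric] ..
    then show "norm (partial b G w) \<le> M * \<bar>s\<bar>"
      using norm_increment_le [OF pg M] by simp
  qed
  then show ?thesis by (simp add: G_def algebra_simps)
qed

text \<open>The exceptional set of a continuous function is open, hence empty as soon as it is negligible.\<close>

lemma continuous_AE_le:
  fixes h :: "'a::euclidean_space \<Rightarrow> real"
  assumes h: "continuous_on UNIV h" and ae: "AE x in lebesgue. h x \<le> M"
  shows "h x \<le> M"
proof (rule ccontr)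
  assume "\<not> h x \<le> M"
  then have "x \<in> {x. M < h x}" by simp
  then have ne: "{x. M < h x} \<noteq> {}" by blast
  have op: "open {x. M < h x}"
    using open_Collect_less [OF continuous_on_const h] .
  have "{x. M < h x} \<in> null_sets lebesgue"
  proof -
    have "{x. M < h x} \<in> sets lebesgue" using op by (simp add: borel_open)
    moreover have "AE x in lebesgue. x \<notin> {x. M < h x}" using ae by eventually_elim auto
    ultimately show ?thesis using AE_iff_null_sets by blast
  qed
  then have "negligible {x. M < h x}" by (simp add: negligible_iff_null_sets)
  with open_not_negligible [OF op ne] show False by blast
qed

lemma Linf_norm_dominates:
  fixes h :: "'a::euclidean_space \<Rightarrow> 'b::real_normed_vector" and G :: "'a \<Rightarrow> 'c::real_normed_vector"
  assumes h: "continuous_on UNIV h" and G: "\<And>x. norm (h x) \<le> norm (G x)"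
    and M: "Linf_norm G \<le> ennreal M" "0 \<le> M"
  shows "norm (h x) \<le> M"
proof (rule continuous_AE_le [of "\<lambda>x. norm (h x)"])
  show "continuous_on UNIV (\<lambda>x. norm (h x))" using h by (rule continuous_on_norm)
  have "AE x in lebesgue. ennreal (norm (G x)) \<le> Linf_norm G"
    unfolding Linf_norm_def by (rule esssup_AE)
  then show "AE x in lebesgue. norm (h x) \<le> M"
  proof eventually_elim
    case (elim x)
    with M have "norm (G x) \<le> M" using ennreal_le_iff order_trans by blast
    with G show ?case using order_trans by blast
  qed
qed

lemma nabla_sq_nonneg: "0 \<le> nabla_sq m g x"
  by (induction m arbitrary: g) (auto intro: sum_nonneg)

lemma nabla_sq_partial_le: "b \<in> Basis \<Longrightarrow> nabla_sq m (partial b g) x \<le> nabla_sq (Suc m) g x"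
  using member_le_sum [of b Basis "\<lambda>b. nabla_sq m (partial b g) x"] by (simp add: nabla_sq_nonneg)

text \<open>Each single partial derivative is dominated by the Euclidean norm of all of them, and this makes
the essential supremum a pointwise bound.\<close>

lemma Linf_nabla_dominates:
  assumes h: "continuous_on UNIV h" and le: "\<And>x. nabla_sq 0 h x \<le> nabla_sq m g x"
    and M: "Linf_norm (nabla_norm m g) \<le> ennreal M" "0 \<le> M"
  shows "norm (h x) \<le> M"
proof (rule Linf_norm_dominates [OF h _ M])
  fix x
  show "norm (h x) \<le> norm (nabla_norm m g x)"
    using le [of x] by (simp add: nabla_norm_def real_le_rsqrt nabla_sq_nonneg)
qed

lemma partial1_le:
  assumes "C_class (Suc m) g" "Linf_norm (nabla_norm 1 g) \<le> ennreal M" "0 \<le> M" "b \<in> Basis"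
  shows "norm (partial b g x) \<le> M"
proof (rule Linf_nabla_dominates [OF _ _ assms(2,3)])
  show "continuous_on UNIV (partial b g)"
    using assms C_class_Suc_D(2) C_class_continuous by blast
  show "nabla_sq 0 (partial b g) x \<le> nabla_sq 1 g x" for x
    using nabla_sq_partial_le [OF assms(4), of 0 g] by simp
qed

lemma partial2_le:
  assumes "C_class (Suc (Suc m)) g" "Linf_norm (nabla_norm 2 g) \<le> ennreal M" "0 \<le> M" "b \<in> Basis" "c \<in> Basis"
  shows "norm (partial c (partial b g) x) \<le> M"
proof (rule Linf_nabla_dominates [OF _ _ assms(2,3)])
  show "continuous_on UNIV (partial c (partial b g))"
    using assms C_class_Suc_D(2) C_class_continuous by blast
  show "nabla_sq 0 (partial c (partial b g)) x \<le> nabla_sq 2 g x" for x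
    using nabla_sq_partial_le [OF assms(5), of 0 "partial b g" x]
      nabla_sq_partial_le [OF assms(4), of 1 g x] by (simp only: numeral_2_eq_2 One_nat_def)
qed

lemma partial3_le:
  assumes "C_class (Suc (Suc (Suc m))) g" "Linf_norm (nabla_norm 3 g) \<le> ennreal M" "0 \<le> M"
    "b \<in> Basis" "c \<in> Basis" "d \<in> Basis"
  shows "norm (partial d (partial c (partial b g)) x) \<le> M"
proof (rule Linf_nabla_dominates [OF _ _ assms(2,3)])
  show "continuous_on UNIV (partial d (partial c (partial b g)))"
    using assms C_class_Suc_D(2) C_class_continuous by blast
  show "nabla_sq 0 (partial d (partial c (partial b g))) x \<le> nabla_sq 3 g x" for x
    using nabla_sq_partial_le [OF assms(6), of 0 "partial c (partial b g)" x]
      nabla_sq_partial_le [OF assms(5), of 1 "partial b g" x]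
      nabla_sq_partial_le [OF assms(4), of 2 g x]
    by (simp only: numeral_2_eq_2 numeral_3_eq_3 One_nat_def)
qed

lemma partial_zero: "partial b (\<lambda>x. 0) = (\<lambda>x. 0)"
  by (rule ext) (simp add: partial_def frechet_derivative_const)

lemma Linf_norm_zero:
  fixes g :: "'a::euclidean_space \<Rightarrow> 'b::real_normed_vector"
  assumes "\<And>x. g x = 0"
  shows "Linf_norm g = 0"
proof -
  have "esssup lebesgue (\<lambda>x::'a. 0 :: ennreal) \<le> 0" by (rule esssup_I) auto
  then show ?thesis using assms by (simp add: Linf_norm_def)
qed

lemma Linf_nabla2_eq_0:
  assumes g: "C_class 2 g" and z: "Linf_norm (nabla_norm 1 g) = 0"
  shows "Linf_norm (nabla_norm 2 g) = 0"
proof (rule Linf_norm_zero)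
  fix x
  have "partial b g = (\<lambda>x. 0)" if "b \<in> Basis" for b
    using partial1_le [of 1 g 0 b] g z that by (auto simp: numeral_2_eq_2)
  then show "nabla_norm 2 g x = 0"
    by (simp add: nabla_norm_def numeral_2_eq_2 partial_zero)
qed

lemma Linf_nabla3_eq_0:
  assumes g: "C_class 3 g" and z: "Linf_norm (nabla_norm 2 g) = 0"
  shows "Linf_norm (nabla_norm 3 g) = 0"
proof (rule Linf_norm_zero)
  fix x
  have "partial c (partial b g) = (\<lambda>x. 0)" if "b \<in> Basis" "c \<in> Basis" for b c
    using partial2_le [of 1 g 0 b c] g z that by (auto simp: numeral_3_eq_3)
  then show "nabla_norm 3 g x = 0"
    by (simp add: nabla_norm_def numeral_3_eq_3 partial_zero)
qed

lemma Basis_real2: "(Basis :: (real \<times> real) set) = {(1, 0), (0, 1)}"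
  by (auto simp: Basis_prod_def)

section \<open>Increments of the nonlocal velocity\<close>

lemma ennreal_scaled_finite:
  assumes "0 < m" "ennreal m * x \<le> ennreal L"
  shows "x < \<infinity>"
proof (rule ccontr)
  assume "\<not> x < \<infinity>"
  then have "x = \<infinity>" by (simp add: not_less top_unique)
  with assms show False by (simp add: ennreal_mult_top top_unique)
qed

lemma grid_abs_summable:
  assumes "grid_l1 r < \<infinity>"
  shows "(\<lambda>(p, l). \<bar>r p l\<bar>) summable_on UNIV"
    and "ennreal (\<Sum>\<^sub>\<infinity>(p, l)\<in>UNIV. \<bar>r p l\<bar>) = grid_l1 r"
proof -
  have eq: "(\<Sum>(p, l)\<in>F. ennreal \<bar>r p l\<bar>) = ennreal (\<Sum>(p, l)\<in>F. \<bar>r p l\<bar>)" for F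
    by (simp add: case_prod_unfold sum_ennreal)
  have sup: "grid_l1 r = (SUP F\<in>{F. finite F \<and> F \<subseteq> UNIV}. ennreal (\<Sum>(p, l)\<in>F. \<bar>r p l\<bar>))"
    unfolding grid_l1_def by (subst nonneg_infsum_complete) (auto simp: eq)
  show s: "(\<lambda>(p, l). \<bar>r p l\<bar>) summable_on UNIV"
  proof (rule nonneg_bdd_above_summable_on)
    show "bdd_above (sum (\<lambda>(p, l). \<bar>r p l\<bar>) ` {F. F \<subseteq> UNIV \<and> finite F})"
    proof (rule bdd_aboveI2)
      fix F assume F: "F \<in> {F :: (int \<times> int) set. F \<subseteq> UNIV \<and> finite F}"
      then have "ennreal (\<Sum>(p, l)\<in>F. \<bar>r p l\<bar>) \<le> grid_l1 r"
        unfolding sup by (intro SUP_upper) auto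
      then show "(\<Sum>(p, l)\<in>F. \<bar>r p l\<bar>) \<le> enn2real (grid_l1 r)"
        using ennreal_enn2real [of "grid_l1 r"] assms enn2real_nonneg [of "grid_l1 r"]
        by (metis ennreal_le_iff infinity_ennreal_def)
    qed
  qed auto
  show "ennreal (\<Sum>\<^sub>\<infinity>(p, l)\<in>UNIV. \<bar>r p l\<bar>) = grid_l1 r"
    unfolding sup using infsum_nonneg_is_SUPREMUM_ennreal [OF s] by auto
qed

text \<open>The quadrature formula for a convolution, with the cell area \<open>m\<close> and the shifted kernel \<open>K\<close>.  It
is linear in \<open>K\<close>, so that differences of discrete convolutions are weighted sums of differences of
kernels.\<close>

definition weighted_sum :: "real \<Rightarrow> (int \<Rightarrow> int \<Rightarrow> real) \<Rightarrow> (int \<Rightarrow> int \<Rightarrow> real) \<Rightarrow> real" where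
  "weighted_sum m r K = m * (\<Sum>\<^sub>\<infinity>(p, l)\<in>UNIV. r p l * K p l)"

lemma weighted_sum_summable:
  assumes "grid_l1 r < \<infinity>" and K: "\<And>p l. \<bar>K p l\<bar> \<le> M"
  shows "(\<lambda>x. norm (case x of (p, l) \<Rightarrow> r p l * K p l)) summable_on UNIV"
proof (rule Infinite_Sum.abs_summable_on_comparison_test')
  show "(\<lambda>x. M * (case x of (p, l) \<Rightarrow> \<bar>r p l\<bar>)) summable_on UNIV"
    by (intro summable_on_cmult_right grid_abs_summable assms)
  show "norm (case x of (p, l) \<Rightarrow> r p l * K p l) \<le> M * (case x of (p, l) \<Rightarrow> \<bar>r p l\<bar>)" for x
    using K by (cases x) (simp add: abs_mult mult.commute mult_right_mono)
qed

lemma weighted_sum_bound: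
  assumes m: "0 < m" and r: "ennreal m * grid_l1 r \<le> ennreal L" and L: "0 \<le> L"
    and K: "\<And>p l. \<bar>K p l\<bar> \<le> M"
  shows "\<bar>weighted_sum m r K\<bar> \<le> M * L"
proof -
  have fin: "grid_l1 r < \<infinity>"
    by (rule ennreal_scaled_finite [OF m r])
  have M: "0 \<le> M" using K [of 0 0] by linarith
  have s: "(\<lambda>x. M * (case x of (p, l) \<Rightarrow> \<bar>r p l\<bar>)) summable_on UNIV"
    by (intro summable_on_cmult_right grid_abs_summable fin)
  have "\<bar>\<Sum>\<^sub>\<infinity>(p, l)\<in>UNIV. r p l * K p l\<bar> \<le> (\<Sum>\<^sub>\<infinity>x\<in>UNIV. norm (case x of (p, l) \<Rightarrow> r p l * K p l))"
    using norm_infsum_bound [OF weighted_sum_summable [OF fin K]] by simp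
  also have "\<dots> \<le> (\<Sum>\<^sub>\<infinity>x\<in>UNIV. M * (case x of (p, l) \<Rightarrow> \<bar>r p l\<bar>))"
  proof (rule infsum_mono [OF weighted_sum_summable [OF fin K] s])
    show "norm (case x of (p, l) \<Rightarrow> r p l * K p l) \<le> M * (case x of (p, l) \<Rightarrow> \<bar>r p l\<bar>)" for x
      using K by (cases x) (simp add: abs_mult mult.commute mult_right_mono)
  qed
  also have "\<dots> = M * (\<Sum>\<^sub>\<infinity>(p, l)\<in>UNIV. \<bar>r p l\<bar>)"
    by (rule infsum_cmult_right')
  finally have bound: "\<bar>weighted_sum m r K\<bar> \<le> M * (m * (\<Sum>\<^sub>\<infinity>(p, l)\<in>UNIV. \<bar>r p l\<bar>))"
    using m by (simp add: weighted_sum_def abs_mult mult.left_commute)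
  have "m * (\<Sum>\<^sub>\<infinity>(p, l)\<in>UNIV. \<bar>r p l\<bar>) \<le> L"
  proof -
    have "0 \<le> (\<Sum>\<^sub>\<infinity>(p, l)\<in>UNIV. \<bar>r p l\<bar>)" by (intro infsum_nonneg) auto
    then have "ennreal (m * (\<Sum>\<^sub>\<infinity>(p, l)\<in>UNIV. \<bar>r p l\<bar>)) \<le> ennreal L"
      using r m by (simp add: ennreal_mult grid_abs_summable(2) [OF fin])
    then show ?thesis using L by simp
  qed
  from mult_left_mono [OF this M] bound show ?thesis by (rule order_trans [rotated])
qed

lemma weighted_sum_diff:
  assumes m: "0 < m" and r: "ennreal m * grid_l1 r \<le> ennreal L"
    and K: "\<And>p l. \<bar>K p l\<bar> \<le> M" and K': "\<And>p l. \<bar>K' p l\<bar> \<le> M'"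
  shows "weighted_sum m r K - weighted_sum m r K' = weighted_sum m r (\<lambda>p l. K p l - K' p l)"
proof -
  have fin: "grid_l1 r < \<infinity>"
    by (rule ennreal_scaled_finite [OF m r])
  let ?F = "\<lambda>K x. case x of (p, l) \<Rightarrow> r p l * K p l"
  have "(?F K has_sum infsum (?F K) UNIV) UNIV" "(?F K' has_sum infsum (?F K') UNIV) UNIV"
    by (rule has_sum_infsum [OF Infinite_Sum.abs_summable_summable [OF weighted_sum_summable [OF fin K]]]
        has_sum_infsum [OF Infinite_Sum.abs_summable_summable [OF weighted_sum_summable [OF fin K']]])+
  from has_sum_add [OF this(1) has_sum_uminusI [OF this(2)]]
  have "infsum (\<lambda>x. ?F K x + - ?F K' x) UNIV = infsum (?F K) UNIV + - infsum (?F K') UNIV"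
    by (rule infsumI)
  moreover have "(\<lambda>x. ?F K x + - ?F K' x) = ?F (\<lambda>p l. K p l - K' p l)"
    by (auto simp: algebra_simps)
  ultimately have "infsum (?F (\<lambda>p l. K p l - K' p l)) UNIV = infsum (?F K) UNIV - infsum (?F K') UNIV"
    by simp
  then show ?thesis
    unfolding weighted_sum_def by (simp only: right_diff_distrib)
qed

text \<open>The mesh width in the coordinate direction \<open>d\<close>.  Together with \<open>fst d\<close> and \<open>snd d\<close> as index shifts it allows
to treat all pairs of directions at once.\<close>

definition mesh :: "real \<Rightarrow> real \<Rightarrow> real \<times> real \<Rightarrow> real" where
  "mesh dx dy d = dx * fst d + dy * snd d"

lemma grid_shift:
  assumes "d \<in> Basis"
  shows "(grid_pt dx (a + fst d), grid_pt dy (c + snd d)) = (grid_pt dx a, grid_pt dy c) + mesh dx dy d *\<^sub>R d"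
  using assms by (auto simp: Basis_real2 mesh_def grid_pt_def algebra_simps)

lemma mesh_pos: "0 < dx \<Longrightarrow> 0 < dy \<Longrightarrow> d \<in> Basis \<Longrightarrow> 0 < mesh dx dy d"
  by (auto simp: Basis_real2 mesh_def)

definition grid_fun :: "real \<Rightarrow> real \<Rightarrow> (real \<times> real \<Rightarrow> 'b) \<Rightarrow> real \<Rightarrow> real \<Rightarrow> 'b" where
  "grid_fun dx dy g a c = g (grid_pt dx a, grid_pt dy c)"

lemma grid_fun_increments:
  fixes g :: "real \<times> real \<Rightarrow> 'b::real_normed_vector"
  assumes pos: "0 < dx" "0 < dy" and d: "d \<in> Basis" "e \<in> Basis"
    and g: "\<And>x. g differentiable (at x)"
  shows "(\<And>x. norm (partial d g x) \<le> M) \<Longrightarrow>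
      norm (grid_fun dx dy g (a + fst d) (c + snd d) - grid_fun dx dy g a c) \<le> M * mesh dx dy d"
    and "(\<And>x. partial d g differentiable (at x)) \<Longrightarrow> (\<And>x. norm (partial e (partial d g) x) \<le> M') \<Longrightarrow>
      norm (grid_fun dx dy g (a + fst d + fst e) (c + snd d + snd e) - grid_fun dx dy g (a + fst e) (c + snd e)
        - (grid_fun dx dy g (a + fst d) (c + snd d) - grid_fun dx dy g a c)) \<le> M' * mesh dx dy e * mesh dx dy d"
proof -
  assume M: "\<And>x. norm (partial d g x) \<le> M"
  show "norm (grid_fun dx dy g (a + fst d) (c + snd d) - grid_fun dx dy g a c) \<le> M * mesh dx dy d"
    using norm_increment_le [OF g M, of "(grid_pt dx a, grid_pt dy c)" "mesh dx dy d"] mesh_pos [OF pos d(1)]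
    unfolding grid_fun_def grid_shift [OF d(1)] by simp
next
  assume pg: "\<And>x. partial d g differentiable (at x)" and M: "\<And>x. norm (partial e (partial d g) x) \<le> M'"
  show "norm (grid_fun dx dy g (a + fst d + fst e) (c + snd d + snd e) - grid_fun dx dy g (a + fst e) (c + snd e)
        - (grid_fun dx dy g (a + fst d) (c + snd d) - grid_fun dx dy g a c)) \<le> M' * mesh dx dy e * mesh dx dy d"
    using norm_second_increment_le [OF g pg M, of "(grid_pt dx a, grid_pt dy c)" "mesh dx dy d" "mesh dx dy e"]
      mesh_pos [OF pos d(1)] mesh_pos [OF pos d(2)]
    unfolding grid_fun_def grid_shift [OF d(1)] grid_shift [OF d(2)] by simp
qed

lemma discrete_conv_eq:
  "discrete_conv \<eta> dx dy r b a c
   = weighted_sum (dx * dy) r (\<lambda>p l. grid_fun dx dy (partial b \<eta>) (a - p) (c - l))"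
  by (simp add: discrete_conv_def weighted_sum_def grid_fun_def)

lemma discrete_conv_increments:
  fixes \<eta> :: "real \<times> real \<Rightarrow> real"
  assumes pos: "0 < dx" "0 < dy"
    and r: "ennreal (dx * dy) * grid_l1 r \<le> ennreal L" "0 \<le> L"
    and \<eta>: "C_class 3 \<eta>"
    and e1: "\<forall>b\<in>Basis. \<forall>x. \<bar>partial b \<eta> x\<bar> \<le> E1"
    and e2: "\<forall>b\<in>Basis. \<forall>d\<in>Basis. \<forall>x. \<bar>partial d (partial b \<eta>) x\<bar> \<le> E2"
    and e3: "\<forall>b\<in>Basis. \<forall>d\<in>Basis. \<forall>e\<in>Basis. \<forall>x. \<bar>partial e (partial d (partial b \<eta>)) x\<bar> \<le> E3"
    and b: "b \<in> Basis" and d: "d \<in> Basis" and e: "e \<in> Basis"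
  defines "C \<equiv> discrete_conv \<eta> dx dy r b"
  shows "\<bar>C (a + fst d) (c + snd d) - C a c\<bar> \<le> mesh dx dy d * (E2 * L)"
    and "\<bar>C (a + fst d + fst e) (c + snd d + snd e) - C (a + fst e) (c + snd e)
        - (C (a + fst d) (c + snd d) - C a c)\<bar> \<le> mesh dx dy d * mesh dx dy e * (E3 * L)"
proof -
  let ?g = "grid_fun dx dy (partial b \<eta>)"
  have m: "0 < dx * dy" using pos by simp
  have C2: "C_class (Suc (Suc 0)) (partial b \<eta>)"
    using \<eta> b by (simp only: numeral_3_eq_3 C_class_Suc_D(2))
  note g = C_class_Suc_D(1) [OF C2] and pg = C_class_Suc_D(1) [OF C_class_Suc_D(2) [OF C2 d]]
  have bound: "\<bar>?g a' c'\<bar> \<le> E1" for a' c' unfolding grid_fun_def using e1 b by blast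
  have bound2: "\<bar>?g a' c' - ?g a'' c''\<bar> \<le> E1 + E1" for a' c' a'' c''
    by (rule order_trans [OF abs_triangle_ineq4 add_mono [OF bound bound]])
  have inc: "\<bar>?g (a' + fst d) (c' + snd d) - ?g a' c'\<bar> \<le> mesh dx dy d * E2" for a' c'
  proof -
    have "norm (?g (a' + fst d) (c' + snd d) - ?g a' c') \<le> E2 * mesh dx dy d"
      by (rule grid_fun_increments(1) [OF pos d e g]) (use e2 b d in \<open>simp only: real_norm_def\<close>)
    then show ?thesis by (simp add: mult.commute)
  qed
  have inc2: "\<bar>?g (a' + fst d + fst e) (c' + snd d + snd e) - ?g (a' + fst e) (c' + snd e)
      - (?g (a' + fst d) (c' + snd d) - ?g a' c')\<bar> \<le> mesh dx dy d * mesh dx dy e * E3" for a' c'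
  proof -
    have "norm (?g (a' + fst d + fst e) (c' + snd d + snd e) - ?g (a' + fst e) (c' + snd e)
      - (?g (a' + fst d) (c' + snd d) - ?g a' c')) \<le> E3 * mesh dx dy e * mesh dx dy d"
      by (rule grid_fun_increments(2) [OF pos d e g pg]) (use e3 b d e in \<open>simp only: real_norm_def\<close>)
    then show ?thesis by (simp only: real_norm_def mult_ac)
  qed
  have diff: "C a1 c1 - C a2 c2 = weighted_sum (dx * dy) r
      (\<lambda>p l. ?g (a1 - p) (c1 - l) - ?g (a2 - p) (c2 - l))" for a1 c1 a2 c2
    unfolding C_def discrete_conv_eq by (rule weighted_sum_diff [OF m r(1)]) (rule bound)+
  show "\<bar>C (a + fst d) (c + snd d) - C a c\<bar> \<le> mesh dx dy d * (E2 * L)"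
    unfolding diff mult.assoc [symmetric]
  proof (rule weighted_sum_bound [OF m r])
    show "\<bar>?g (a + fst d - of_int p) (c + snd d - of_int l) - ?g (a - of_int p) (c - of_int l)\<bar> \<le> mesh dx dy d * E2" for p l
      using inc [of "a - of_int p" "c - of_int l"] by (simp add: algebra_simps)
  qed
  have diff2: "C a1 c1 - C a2 c2 - (C a3 c3 - C a4 c4) = weighted_sum (dx * dy) r
      (\<lambda>p l. ?g (a1 - p) (c1 - l) - ?g (a2 - p) (c2 - l) - (?g (a3 - p) (c3 - l) - ?g (a4 - p) (c4 - l)))"
    for a1 c1 a2 c2 a3 c3 a4 c4
    unfolding diff by (rule weighted_sum_diff [OF m r(1)]) (rule bound2)+
  show "\<bar>C (a + fst d + fst e) (c + snd d + snd e) - C (a + fst e) (c + snd e)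
        - (C (a + fst d) (c + snd d) - C a c)\<bar> \<le> mesh dx dy d * mesh dx dy e * (E3 * L)"
    unfolding diff2 mult.assoc [symmetric]
  proof (rule weighted_sum_bound [OF m r])
    show "\<bar>?g (a + fst d + fst e - of_int p) (c + snd d + snd e - of_int l)
        - ?g (a + fst e - of_int p) (c + snd e - of_int l)
        - (?g (a + fst d - of_int p) (c + snd d - of_int l) - ?g (a - of_int p) (c - of_int l))\<bar>
        \<le> mesh dx dy d * mesh dx dy e * E3" for p l
      using inc2 [of "a - of_int p" "c - of_int l"] by (simp add: algebra_simps)
  qed
qed

lemma nonlocal_eq:
  "nonlocal \<epsilon> \<eta> dx dy r (1, 0) a c
     = - \<epsilon> * sat (discrete_conv \<eta> dx dy r (1, 0) a c) (discrete_conv \<eta> dx dy r (0, 1) a c)"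
  "nonlocal \<epsilon> \<eta> dx dy r (0, 1) a c
     = - \<epsilon> * sat (discrete_conv \<eta> dx dy r (0, 1) a c) (discrete_conv \<eta> dx dy r (1, 0) a c)"
  by (simp_all add: nonlocal_def sat_def norm_Pair add_ac)

lemma nonlocal_sat:
  assumes "b \<in> Basis"
  obtains b' where "b' \<in> Basis" "\<And>a c. nonlocal \<epsilon> \<eta> dx dy r b a c
     = - \<epsilon> * sat (discrete_conv \<eta> dx dy r b a c) (discrete_conv \<eta> dx dy r b' a c)"
proof -
  from assms consider "b = (1, 0)" | "b = (0, 1)" by (auto simp: Basis_real2)
  then show thesis
  proof cases
    case 1
    with nonlocal_eq(1) show thesis by (intro that [of "(0, 1)"]) (simp_all add: Basis_real2)
  next
    case 2
    with nonlocal_eq(2) show thesis by (intro that [of "(1, 0)"]) (simp_all add: Basis_real2)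
  qed
qed

lemma abs_nonlocal_le:
  assumes "b \<in> Basis" "0 \<le> \<epsilon>"
  shows "\<bar>nonlocal \<epsilon> \<eta> dx dy r b a c\<bar> \<le> \<epsilon>"
proof -
  obtain b' where "nonlocal \<epsilon> \<eta> dx dy r b a c
     = - \<epsilon> * sat (discrete_conv \<eta> dx dy r b a c) (discrete_conv \<eta> dx dy r b' a c)"
    using nonlocal_sat [OF assms(1)] by metis
  then show ?thesis using assms(2) by (simp add: abs_mult abs_sat_le mult_left_le)
qed

text \<open>The factor \<open>2\<close> in the first bound stems from the two arguments of \<^const>\<open>sat\<close>, both of
which change by at most \<open>mesh dx dy d * (E2 * L)\<close>.\<close>

lemma nonlocal_increments:
  fixes \<eta> :: "real \<times> real \<Rightarrow> real"
  assumes pos: "0 < dx" "0 < dy"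
    and r: "ennreal (dx * dy) * grid_l1 r \<le> ennreal L" "0 \<le> L"
    and \<eta>: "C_class 3 \<eta>"
    and e1: "\<forall>b\<in>Basis. \<forall>x. \<bar>partial b \<eta> x\<bar> \<le> E1"
    and e2: "\<forall>b\<in>Basis. \<forall>d\<in>Basis. \<forall>x. \<bar>partial d (partial b \<eta>) x\<bar> \<le> E2"
    and e3: "\<forall>b\<in>Basis. \<forall>d\<in>Basis. \<forall>e\<in>Basis. \<forall>x. \<bar>partial e (partial d (partial b \<eta>)) x\<bar> \<le> E3"
    and b: "b \<in> Basis" and d: "d \<in> Basis" and e: "e \<in> Basis" and \<epsilon>: "0 \<le> \<epsilon>"
  defines "J \<equiv> nonlocal \<epsilon> \<eta> dx dy r b"
  shows "\<bar>J (a + fst d) (c + snd d) - J a c\<bar> \<le> mesh dx dy d * (2 * \<epsilon> * E2 * L)"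
    and "\<bar>J (a + fst d + fst e) (c + snd d + snd e) - J (a + fst e) (c + snd e)
        - (J (a + fst d) (c + snd d) - J a c)\<bar>
      \<le> mesh dx dy d * mesh dx dy e * (\<epsilon> * (2 * E3 * L + 6 * (E2 * L)\<^sup>2))"
proof -
  obtain b' where b': "b' \<in> Basis" and eq: "\<And>a c. J a c
     = - \<epsilon> * sat (discrete_conv \<eta> dx dy r b a c) (discrete_conv \<eta> dx dy r b' a c)"
    unfolding J_def using nonlocal_sat [OF b] by metis
  note inc = discrete_conv_increments [OF pos r \<eta> e1 e2 e3]
  have regroup1: "\<epsilon> * (m * (E2 * L) + m * (E2 * L)) = m * (2 * \<epsilon> * E2 * L)" for m
    by simp
  have regroup2: "\<epsilon> * (2 * (m * m' * (E3 * L)) + 6 * ((m * (E2 * L)) * (m' * (E2 * L))))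
      = m * m' * (\<epsilon> * (2 * E3 * L + 6 * (E2 * L)\<^sup>2))" for m m'
    by (simp add: algebra_simps power2_eq_square)
  have factor: "- \<epsilon> * s - - \<epsilon> * t = - \<epsilon> * (s - t)" for s t by (simp add: algebra_simps)
  have "\<bar>sat (discrete_conv \<eta> dx dy r b (a + fst d) (c + snd d)) (discrete_conv \<eta> dx dy r b' (a + fst d) (c + snd d))
      - sat (discrete_conv \<eta> dx dy r b a c) (discrete_conv \<eta> dx dy r b' a c)\<bar>
      \<le> mesh dx dy d * (E2 * L) + mesh dx dy d * (E2 * L)"
    by (rule order_trans [OF sat_lipschitz add_mono [OF inc(1) [OF b d e] inc(1) [OF b' d e]]])
  from mult_left_mono [OF this \<epsilon>]
  show "\<bar>J (a + fst d) (c + snd d) - J a c\<bar> \<le> mesh dx dy d * (2 * \<epsilon> * E2 * L)"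
    unfolding eq factor abs_mult abs_minus_cancel abs_of_nonneg [OF \<epsilon>] regroup1 .
  have inc1': "\<bar>discrete_conv \<eta> dx dy r b0 (a + fst d + fst e) (c + snd d + snd e) - discrete_conv \<eta> dx dy r b0 (a + fst d) (c + snd d)\<bar>
      \<le> mesh dx dy e * (E2 * L)" if "b0 \<in> Basis" for b0
    by (rule inc(1) [OF that e d])
  have "\<bar>sat (discrete_conv \<eta> dx dy r b (a + fst d + fst e) (c + snd d + snd e)) (discrete_conv \<eta> dx dy r b' (a + fst d + fst e) (c + snd d + snd e))
      - sat (discrete_conv \<eta> dx dy r b (a + fst e) (c + snd e)) (discrete_conv \<eta> dx dy r b' (a + fst e) (c + snd e))
      - (sat (discrete_conv \<eta> dx dy r b (a + fst d) (c + snd d)) (discrete_conv \<eta> dx dy r b' (a + fst d) (c + snd d))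
        - sat (discrete_conv \<eta> dx dy r b a c) (discrete_conv \<eta> dx dy r b' a c))\<bar>
      \<le> 2 * (mesh dx dy d * mesh dx dy e * (E3 * L)) + 6 * ((mesh dx dy d * (E2 * L)) * (mesh dx dy e * (E2 * L)))"
    by (rule sat_second_difference)
      (rule inc(1) [OF b d e] inc(1) [OF b' d e] inc(1) [OF b e d] inc(1) [OF b' e d]
        inc1' [OF b] inc1' [OF b'] inc(2) [OF b d e] inc(2) [OF b' d e])+
  from mult_left_mono [OF this \<epsilon>]
  show "\<bar>J (a + fst d + fst e) (c + snd d + snd e) - J (a + fst e) (c + snd e)
        - (J (a + fst d) (c + snd d) - J a c)\<bar>
      \<le> mesh dx dy d * mesh dx dy e * (\<epsilon> * (2 * E3 * L + 6 * (E2 * L)\<^sup>2))"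
    unfolding eq factor abs_mult abs_minus_cancel abs_of_nonneg [OF \<epsilon>] regroup2 .
qed

section \<open>Cell averages and the flux function\<close>

text \<open>Open cells are disjoint, and they differ from the closed ones of \<^const>\<open>cell_average\<close> only by null
sets.\<close>

definition cell :: "real \<Rightarrow> real \<Rightarrow> int \<Rightarrow> int \<Rightarrow> (real \<times> real) set" where
  "cell dx dy i j = box (grid_pt dx (i - 1/2), grid_pt dy (j - 1/2)) (grid_pt dx (i + 1/2), grid_pt dy (j + 1/2))"

lemma cell_eq: "cell dx dy i j = {grid_pt dx (i - 1/2) <..< grid_pt dx (i + 1/2)} \<times> {grid_pt dy (j - 1/2) <..< grid_pt dy (j + 1/2)}"
  by (auto simp: cell_def box_def Basis_real2)

lemma grid_interval_unique:
  assumes "0 < dx" "grid_pt dx (of_int i - 1/2) < x" "x < grid_pt dx (of_int i + 1/2)"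
    "grid_pt dx (of_int i' - 1/2) < x" "x < grid_pt dx (of_int i' + 1/2)"
  shows "i = i'"
proof -
  have "real_of_int i - 1 < x / dx" "x / dx < real_of_int i" "real_of_int i' - 1 < x / dx" "x / dx < real_of_int i'"
    using assms by (simp_all add: grid_pt_def less_divide_eq divide_less_eq)
  then show ?thesis by linarith
qed

lemma cell_disjoint:
  assumes "0 < dx" "0 < dy"
  shows "disjoint_family_on (\<lambda>(i, j). cell dx dy i j) F"
proof -
  have "i = i' \<and> j = j'" if "z \<in> cell dx dy i j" "z \<in> cell dx dy i' j'" for z i j i' j'
    using that grid_interval_unique [OF assms(1), of i "fst z" i']
      grid_interval_unique [OF assms(2), of j "snd z" j'] by (auto simp: cell_eq)
  then show ?thesis by (fastforce simp: disjoint_family_on_def)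
qed

lemma cell_average_le:
  assumes u: "integrable lebesgue u" and pos: "0 < dx" "0 < dy"
  shows "ennreal (dx * dy * \<bar>cell_average dx dy u i j\<bar>)
    \<le> emeasure (density lebesgue (\<lambda>z. ennreal \<bar>u z\<bar>)) (cell dx dy i j)"
proof -
  define a b where "a = (grid_pt dx (i - 1/2), grid_pt dy (j - 1/2))"
    and "b = (grid_pt dx (i + 1/2), grid_pt dy (j + 1/2))"
  have cb: "{grid_pt dx (i - 1/2) .. grid_pt dx (i + 1/2)} \<times> {grid_pt dy (j - 1/2) .. grid_pt dy (j + 1/2)} = cbox a b"
    by (simp add: a_def b_def cbox_Pair_eq)
  have int: "integrable lebesgue (\<lambda>z. indicator (cbox a b) z *\<^sub>R u z)"
    using u by (intro integrable_mult_indicator) auto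
  have [measurable]: "u \<in> borel_measurable lebesgue" using u by simp
  have "dx * dy * \<bar>cell_average dx dy u i j\<bar> = \<bar>\<integral>z. indicator (cbox a b) z *\<^sub>R u z \<partial>lebesgue\<bar>"
    using pos unfolding cell_average_def cb set_lebesgue_integral_def by (simp add: abs_mult)
  also have "ennreal \<dots> \<le> (\<integral>\<^sup>+z. ennreal (norm (indicator (cbox a b) z *\<^sub>R u z)) \<partial>lebesgue)"
    using integral_norm_bound_ennreal [OF int] by simp
  also have "\<dots> = (\<integral>\<^sup>+z. ennreal \<bar>u z\<bar> * indicator (cell dx dy i j) z \<partial>lebesgue)"
  proof (rule nn_integral_cong_AE)
    have "cbox a b - box a b \<in> null_sets lebesgue"
      using negligible_frontier_interval negligible_iff_null_sets by blast
    then have "AE z in lebesgue. z \<notin> cbox a b - box a b" by (rule AE_not_in)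
    then show "AE z in lebesgue. ennreal (norm (indicator (cbox a b) z *\<^sub>R u z)) = ennreal \<bar>u z\<bar> * indicator (cell dx dy i j) z"
    proof eventually_elim
      case (elim z)
      then have "z \<in> cbox a b \<longleftrightarrow> z \<in> cell dx dy i j"
        using box_subset_cbox [of a b] unfolding cell_def a_def [symmetric] b_def [symmetric] by blast
      then show ?case by (auto split: split_indicator)
    qed
  qed
  also have "\<dots> = emeasure (density lebesgue (\<lambda>z. ennreal \<bar>u z\<bar>)) (cell dx dy i j)"
    by (rule emeasure_density [symmetric]) (auto simp: cell_def)
  finally show ?thesis .
qed

text \<open>The cells carry disjoint parts of the measure with density \<open>\<bar>u\<bar>\<close>, whose total mass is the norm of
\<open>u\<close>.\<close>

lemma grid_l1_cell_average:
  assumes u: "integrable lebesgue u" and pos: "0 < dx" "0 < dy"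
  shows "ennreal (dx * dy) * grid_l1 (cell_average dx dy u) \<le> L1_norm u"
proof -
  define \<nu> where "\<nu> = density lebesgue (\<lambda>z. ennreal \<bar>u z\<bar>)"
  have [measurable]: "u \<in> borel_measurable lebesgue" using u by simp
  have sets: "cell dx dy i j \<in> sets \<nu>" for i j by (simp add: \<nu>_def cell_def)
  have "ennreal (dx * dy) * grid_l1 (cell_average dx dy u) = grid_l1 (\<lambda>i j. dx * dy * cell_average dx dy u i j)"
    using pos by (intro grid_l1_cmult [symmetric]) simp
  also have "\<dots> \<le> L1_norm u"
    unfolding grid_l1_def
  proof (rule infsum_le_finite_sums)
    show "(\<lambda>(i, j). ennreal \<bar>dx * dy * cell_average dx dy u i j\<bar>) summable_on UNIV"
      by (rule nonneg_summable_on_complete) simp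
    fix F :: "(int \<times> int) set" assume F: "finite F"
    have "(\<Sum>(i, j)\<in>F. ennreal \<bar>dx * dy * cell_average dx dy u i j\<bar>) \<le> (\<Sum>p\<in>F. emeasure \<nu> (case p of (i, j) \<Rightarrow> cell dx dy i j))"
      using cell_average_le [OF u pos] pos unfolding \<nu>_def by (intro sum_mono) (auto simp: abs_mult)
    also have "\<dots> = emeasure \<nu> (\<Union>p\<in>F. case p of (i, j) \<Rightarrow> cell dx dy i j)"
      using F cell_disjoint [OF pos] sets by (intro sum_emeasure) auto
    also have "\<dots> \<le> emeasure \<nu> (space \<nu>)" by (rule emeasure_space)
    also have "\<dots> = L1_norm u"
      unfolding \<nu>_def L1_norm_def by (subst emeasure_density) auto
    finally show "(\<Sum>(i, j)\<in>F. ennreal \<bar>dx * dy * cell_average dx dy u i j\<bar>) \<le> L1_norm u" .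
  qed
  finally show ?thesis .
qed

lemma cell_average_nonneg:
  assumes "AE z in lebesgue. 0 \<le> u z" "0 < dx" "0 < dy"
  shows "0 \<le> cell_average dx dy u i j"
  unfolding cell_average_def set_lebesgue_integral_def
  using assms by (intro mult_nonneg_nonneg integral_nonneg_AE) (auto split: split_indicator elim: eventually_mono)

lemma smooth_heaviside_bounds:
  assumes "smooth_heaviside H"
  shows "0 \<le> H x" "H x \<le> 1"
proof -
  have H: "mono H" "(H \<longlongrightarrow> 0) at_bot" "(H \<longlongrightarrow> 1) at_top"
    using assms by (auto simp: smooth_heaviside_def)
  show "H x \<le> 1"
    using H(3) by (rule tendsto_lowerbound)
      (use H(1) in \<open>auto simp: mono_def intro: eventually_mono [OF eventually_ge_at_top [of x]]\<close>)
  show "0 \<le> H x"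
    using H(2) by (rule tendsto_upperbound)
      (use H(1) in \<open>auto simp: mono_def intro: eventually_mono [OF eventually_le_at_bot [of x]]\<close>)
qed

lemma crowd_flux_bounds:
  assumes H: "smooth_heaviside H"
  shows "\<bar>crowd_flux H \<rho>max r\<bar> \<le> \<bar>r\<bar>" "0 \<le> crowd_flux H \<rho>max r / r"
    "0 \<le> r \<Longrightarrow> r \<le> s \<Longrightarrow> crowd_flux H \<rho>max r \<le> crowd_flux H \<rho>max s"
proof -
  note b = smooth_heaviside_bounds [OF H]
  show "\<bar>crowd_flux H \<rho>max r\<bar> \<le> \<bar>r\<bar>"
    using b [of "r - \<rho>max"] by (simp add: crowd_flux_def abs_mult mult_left_le)
  show "0 \<le> crowd_flux H \<rho>max r / r"
    using b(1) by (simp add: crowd_flux_def)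
  have "mono H" using H by (simp add: smooth_heaviside_def)
  then show "0 \<le> r \<Longrightarrow> r \<le> s \<Longrightarrow> crowd_flux H \<rho>max r \<le> crowd_flux H \<rho>max s"
    unfolding crowd_flux_def using b(1) by (intro mult_mono) (auto simp: mono_def)
qed

lemma crowd_flux_derivative:
  assumes H: "smooth_heaviside H"
  shows "(crowd_flux H \<rho>max has_real_derivative deriv (crowd_flux H \<rho>max) r) (at r)"
    and "continuous_on UNIV (deriv (crowd_flux H \<rho>max))"
proof -
  have C: "C_class 1 H" using H by (simp add: smooth_heaviside_def)
  have dH: "(H has_real_derivative partial 1 H x) (at x)" for x
  proof -
    have "H differentiable (at x)" using C by simp
    then have d: "(H has_derivative frechet_derivative H (at x)) (at x)"
      using frechet_derivative_works by blast
    then obtain D where D: "(H has_real_derivative D) (at x)"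
      using real_differentiable_def \<open>H differentiable (at x)\<close> by blast
    then have "frechet_derivative H (at x) = (*) D"
      using has_derivative_unique [OF d] by (simp add: has_field_derivative_def)
    with D show ?thesis by (simp add: partial_def)
  qed
  have cH: "continuous_on UNIV (partial 1 H)" "continuous_on UNIV H"
    using C C_class_continuous [OF C] by simp_all
  have df: "(crowd_flux H \<rho>max has_real_derivative H (r - \<rho>max) + r * partial 1 H (r - \<rho>max)) (at r)" for r
  proof -
    have "((\<lambda>r. H (r - \<rho>max)) has_real_derivative partial 1 H (r - \<rho>max) * 1) (at r)"
      by (rule DERIV_chain2 [OF dH]) (auto intro!: derivative_eq_intros)
    from DERIV_mult [OF DERIV_ident this] show ?thesis
      unfolding crowd_flux_def by (simp add: algebra_simps)
  qed
  then have e: "deriv (crowd_flux H \<rho>max) = (\<lambda>r. H (r - \<rho>max) + r * partial 1 H (r - \<rho>max))"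
    by (intro ext DERIV_imp_deriv)
  show "(crowd_flux H \<rho>max has_real_derivative deriv (crowd_flux H \<rho>max) r) (at r)"
    unfolding e by (rule df)
  show "continuous_on UNIV (deriv (crowd_flux H \<rho>max))"
    unfolding e
    by (intro continuous_intros continuous_on_compose2 [OF cH(1)] continuous_on_compose2 [OF cH(2)]) auto
qed

lemma crowd_flux_lipschitz:
  assumes H: "smooth_heaviside H" and L: "Linf_norm (deriv (crowd_flux H \<rho>max)) \<le> ennreal L" "0 \<le> L"
  shows "\<bar>crowd_flux H \<rho>max r - crowd_flux H \<rho>max s\<bar> \<le> L * \<bar>r - s\<bar>"
proof -
  have "norm (crowd_flux H \<rho>max r - crowd_flux H \<rho>max s) \<le> L * norm (r - s)"
  proof (rule field_differentiable_bound [of UNIV])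
    show "(crowd_flux H \<rho>max has_field_derivative deriv (crowd_flux H \<rho>max) z) (at z within UNIV)" for z
      using crowd_flux_derivative(1) [OF H] by simp
    show "norm (deriv (crowd_flux H \<rho>max) z) \<le> L" for z
      by (rule Linf_norm_dominates [OF crowd_flux_derivative(2) [OF H] order_refl L])
  qed simp_all
  then show ?thesis by simp
qed

text \<open>Otherwise the flux would vanish identically, while \<open>H\<close> is positive for large arguments.\<close>

lemma crowd_flux_lipschitz_pos:
  assumes H: "smooth_heaviside H"
  shows "Linf_norm (deriv (crowd_flux H \<rho>max)) \<noteq> 0"
proof
  assume "Linf_norm (deriv (crowd_flux H \<rho>max)) = 0"
  then have z: "crowd_flux H \<rho>max r = 0" for r
    using crowd_flux_lipschitz [OF H, of \<rho>max 0 r 0] by (simp add: crowd_flux_def)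
  have "(H \<longlongrightarrow> 1) at_top" using H by (simp add: smooth_heaviside_def)
  then have "eventually (\<lambda>x. 0 < H x) at_top" by (rule order_tendstoD) simp
  then obtain N where N: "\<And>x. N \<le> x \<Longrightarrow> 0 < H x" by (auto simp: eventually_at_top_linorder)
  have "max N (1 - \<rho>max) + \<rho>max \<noteq> 0" by linarith
  have "0 < H (max N (1 - \<rho>max))" by (rule N) simp
  moreover have "H (max N (1 - \<rho>max)) = 0"
    using z [of "max N (1 - \<rho>max) + \<rho>max"] \<open>max N (1 - \<rho>max) + \<rho>max \<noteq> 0\<close>
    by (simp add: crowd_flux_def)
  ultimately show False by simp
qed

section \<open>The coefficients of the scheme\<close>

lemma velocity_increments:
  fixes v :: "real \<times> real \<Rightarrow> real \<times> real"
  assumes pos: "0 < dx" "0 < dy" and v: "C_class 2 v"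
    and v1: "\<forall>b\<in>Basis. \<forall>x. norm (partial b v x) \<le> V1"
    and v2: "\<forall>b\<in>Basis. \<forall>d\<in>Basis. \<forall>x. norm (partial d (partial b v) x) \<le> V2"
    and b: "b \<in> Basis" and d: "d \<in> Basis" and e: "e \<in> Basis"
  defines "c \<equiv> \<lambda>a c. grid_fun dx dy v a c \<bullet> b"
  shows "\<bar>c (x + fst d) (y + snd d) - c x y\<bar> \<le> mesh dx dy d * V1"
    and "\<bar>c (x + fst d + fst e) (y + snd d + snd e) - c (x + fst e) (y + snd e)
        - (c (x + fst d) (y + snd d) - c x y)\<bar> \<le> mesh dx dy d * mesh dx dy e * V2"
proof -
  have C: "C_class (Suc (Suc 0)) v" using v by (simp only: numeral_2_eq_2)
  note g = C_class_Suc_D(1) [OF C] and pg = C_class_Suc_D(1) [OF C_class_Suc_D(2) [OF C d]]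
  have "norm (grid_fun dx dy v (x + fst d) (y + snd d) - grid_fun dx dy v x y) \<le> V1 * mesh dx dy d"
    using v1 d by (intro grid_fun_increments(1) [OF pos d e g]) blast
  from order_trans [OF Basis_le_norm [OF b] this]
  show "\<bar>c (x + fst d) (y + snd d) - c x y\<bar> \<le> mesh dx dy d * V1"
    unfolding c_def inner_diff_left by (simp only: mult.commute)
  have "norm (grid_fun dx dy v (x + fst d + fst e) (y + snd d + snd e) - grid_fun dx dy v (x + fst e) (y + snd e)
      - (grid_fun dx dy v (x + fst d) (y + snd d) - grid_fun dx dy v x y)) \<le> V2 * mesh dx dy e * mesh dx dy d"
    using v2 d e by (intro grid_fun_increments(2) [OF pos d e g pg]) blast
  from order_trans [OF Basis_le_norm [OF b] this]
  show "\<bar>c (x + fst d + fst e) (y + snd d + snd e) - c (x + fst e) (y + snd e)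
        - (c (x + fst d) (y + snd d) - c x y)\<bar> \<le> mesh dx dy d * mesh dx dy e * V2"
    unfolding c_def inner_diff_left by (simp only: mult_ac)
qed

text \<open>The jump of the nonlocal term between neighbouring edges enters through the parameter \<open>sJ\<close>,
because it is estimated differently for short and for long time steps.\<close>

lemma roe_coefficients_scheme:
  fixes v :: "real \<times> real \<Rightarrow> real \<times> real" and \<eta> :: "real \<times> real \<Rightarrow> real"
  assumes pos: "0 < dx" "0 < dy" "0 < dt" "0 \<le> \<epsilon>" "0 \<le> Lf" "0 \<le> V1" "0 \<le> V2" "0 \<le> E2" "0 \<le> E3" "0 \<le> sJ"
    and f_bound: "\<And>r. \<bar>f r\<bar> \<le> \<bar>r\<bar>" and f_sign: "\<And>r. 0 \<le> f r / r"
    and f_lip: "\<And>r s. \<bar>f r - f s\<bar> \<le> Lf * \<bar>r - s\<bar>"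
    and f_mono: "\<And>r s. 0 \<le> r \<Longrightarrow> r \<le> s \<Longrightarrow> f r \<le> f s"
    and v: "C_class 2 v"
    and v1: "\<forall>b\<in>Basis. \<forall>x. norm (partial b v x) \<le> V1"
    and v2: "\<forall>b\<in>Basis. \<forall>d\<in>Basis. \<forall>x. norm (partial d (partial b v) x) \<le> V2"
    and cfl: "\<And>z. dt / dx * (\<bar>v z \<bullet> (1, 0)\<bar> + \<epsilon> * Lf) \<le> 1/3" "\<And>z. dt / dy * (\<bar>v z \<bullet> (0, 1)\<bar> + \<epsilon> * Lf) \<le> 1/3"
    and r: "ennreal (dx * dy) * grid_l1 r \<le> ennreal L" "0 \<le> L"
    and \<eta>: "C_class 3 \<eta>"
    and e1: "\<forall>b\<in>Basis. \<forall>x. \<bar>partial b \<eta> x\<bar> \<le> E1"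
    and e2: "\<forall>b\<in>Basis. \<forall>d\<in>Basis. \<forall>x. \<bar>partial d (partial b \<eta>) x\<bar> \<le> E2"
    and e3: "\<forall>b\<in>Basis. \<forall>d\<in>Basis. \<forall>e\<in>Basis. \<forall>x. \<bar>partial e (partial d (partial b \<eta>)) x\<bar> \<le> E3"
    and sJ: "\<And>b d x y. b \<in> Basis \<Longrightarrow> d \<in> Basis \<Longrightarrow>
      dt / mesh dx dy d * (\<bar>nonlocal \<epsilon> \<eta> dx dy r b (x + fst d) (y + snd d) - nonlocal \<epsilon> \<eta> dx dy r b x y\<bar> * Lf) \<le> sJ"
  shows "roe_coefficients dx dy dt Lf (V2 + \<epsilon> * (2 * E3 * L + 6 * (E2 * L)\<^sup>2)) (dt * V1 + sJ) f
    (\<lambda>i j. v (grid_pt dx (i + 1/2), grid_pt dy j) \<bullet> (1, 0))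
    (\<lambda>i j. nonlocal \<epsilon> \<eta> dx dy r (1, 0) (i + 1/2) j)
    (\<lambda>i j. v (grid_pt dx i, grid_pt dy (j + 1/2)) \<bullet> (0, 1))
    (\<lambda>i j. nonlocal \<epsilon> \<eta> dx dy r (0, 1) i (j + 1/2))"
proof -
  define c where "c = (\<lambda>b x y. grid_fun dx dy v x y \<bullet> b)"
  define J where "J = (\<lambda>b x y. nonlocal \<epsilon> \<eta> dx dy r b x y)"
  define S G where "S = dt * V1 + sJ" and "G = V2 + \<epsilon> * (2 * E3 * L + 6 * (E2 * L)\<^sup>2)"
  have first: "dt / mesh dx dy d * (\<bar>c b (x + fst d) (y + snd d) - c b x y\<bar>
      + \<bar>J b (x + fst d) (y + snd d) - J b x y\<bar> * Lf) \<le> S" if "b \<in> Basis" "d \<in> Basis" for b d x y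
  proof -
    have m: "0 < mesh dx dy d" by (rule mesh_pos [OF pos(1,2) that(2)])
    have "dt / mesh dx dy d * \<bar>c b (x + fst d) (y + snd d) - c b x y\<bar> \<le> dt / mesh dx dy d * (mesh dx dy d * V1)"
      unfolding c_def using velocity_increments(1) [OF pos(1,2) v v1 v2 that(1) that(2) that(2)] m pos(3)
      by (intro mult_left_mono) auto
    also have "\<dots> = dt * V1" using m by simp
    finally show ?thesis
      using sJ [OF that, of x y] unfolding J_def S_def distrib_left by linarith
  qed
  have second: "\<bar>c b (x + fst d + fst e) (y + snd d + snd e) - c b (x + fst e) (y + snd e)
        - (c b (x + fst d) (y + snd d) - c b x y)\<bar>
      + \<bar>J b (x + fst d + fst e) (y + snd d + snd e) - J b (x + fst e) (y + snd e)
        - (J b (x + fst d) (y + snd d) - J b x y)\<bar> \<le> G * (mesh dx dy d * mesh dx dy e)"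
    if "b \<in> Basis" "d \<in> Basis" "e \<in> Basis" for b d e x y
  proof -
    have "G * (mesh dx dy d * mesh dx dy e) = mesh dx dy d * mesh dx dy e * V2
        + mesh dx dy d * mesh dx dy e * (\<epsilon> * (2 * E3 * L + 6 * (E2 * L)\<^sup>2))"
      by (simp add: G_def algebra_simps)
    then show ?thesis
      using add_mono [OF velocity_increments(2) [OF pos(1,2) v v1 v2 that]
          nonlocal_increments(2) [OF pos(1,2) r \<eta> e1 e2 e3 that pos(4)]]
      unfolding c_def J_def by (simp only:)
  qed
  have m: "mesh dx dy (1, 0) = dx" "mesh dx dy (0, 1) = dy" by (simp_all add: mesh_def)
  have X: "(1, 0) \<in> (Basis :: (real \<times> real) set)" and Y: "(0, 1) \<in> (Basis :: (real \<times> real) set)"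
    by (simp_all add: Basis_real2)
  have J_le: "\<bar>J b x y\<bar> * Lf \<le> \<epsilon> * Lf" if "b \<in> Basis" for b x y
    unfolding J_def using abs_nonlocal_le [OF that pos(4)] pos(5) by (intro mult_right_mono)
  have G0: "0 \<le> G" unfolding G_def using pos r(2) by (intro add_nonneg_nonneg mult_nonneg_nonneg) auto
  have "roe_coefficients dx dy dt Lf G S f (\<lambda>i j. c (1, 0) (i + 1/2) j) (\<lambda>i j. J (1, 0) (i + 1/2) j)
      (\<lambda>i j. c (0, 1) i (j + 1/2)) (\<lambda>i j. J (0, 1) i (j + 1/2))"
  proof
    show "0 \<le> S" unfolding S_def using pos by simp
    fix i j :: int
    show "dt / dx * (\<bar>c (1, 0) (i + 1/2) j\<bar> + \<bar>J (1, 0) (i + 1/2) j\<bar> * Lf) \<le> 1/3"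
      using order_trans [OF mult_left_mono [OF add_left_mono [OF J_le [OF X]]]
          cfl(1) [of "(grid_pt dx (i + 1/2), grid_pt dy j)"]] pos(1,3)
      unfolding c_def grid_fun_def by (simp only: divide_nonneg_pos order_less_imp_le)
    show "dt / dy * (\<bar>c (0, 1) i (j + 1/2)\<bar> + \<bar>J (0, 1) i (j + 1/2)\<bar> * Lf) \<le> 1/3"
      using order_trans [OF mult_left_mono [OF add_left_mono [OF J_le [OF Y]]]
          cfl(2) [of "(grid_pt dx i, grid_pt dy (j + 1/2))"]] pos(2,3)
      unfolding c_def grid_fun_def by (simp only: divide_nonneg_pos order_less_imp_le)
    show "dt / dx * (\<bar>c (1, 0) (of_int (i + 1) + 1/2) j - c (1, 0) (i + 1/2) j\<bar>
        + \<bar>J (1, 0) (of_int (i + 1) + 1/2) j - J (1, 0) (i + 1/2) j\<bar> * Lf) \<le> S"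
      using first [OF X X, of "i + 1/2" j] by (simp add: m add_ac)
    show "dt / dy * (\<bar>c (1, 0) (i + 1/2) (of_int (j + 1)) - c (1, 0) (i + 1/2) j\<bar>
        + \<bar>J (1, 0) (i + 1/2) (of_int (j + 1)) - J (1, 0) (i + 1/2) j\<bar> * Lf) \<le> S"
      using first [OF X Y, of "i + 1/2" j] by (simp add: m add_ac)
    show "dt / dx * (\<bar>c (0, 1) (of_int (i + 1)) (j + 1/2) - c (0, 1) i (j + 1/2)\<bar>
        + \<bar>J (0, 1) (of_int (i + 1)) (j + 1/2) - J (0, 1) i (j + 1/2)\<bar> * Lf) \<le> S"
      using first [OF Y X, of i "j + 1/2"] by (simp add: m add_ac)
    show "dt / dy * (\<bar>c (0, 1) i (of_int (j + 1) + 1/2) - c (0, 1) i (j + 1/2)\<bar>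
        + \<bar>J (0, 1) i (of_int (j + 1) + 1/2) - J (0, 1) i (j + 1/2)\<bar> * Lf) \<le> S"
      using first [OF Y Y, of i "j + 1/2"] by (simp add: m add_ac)
    show "\<bar>c (1, 0) (of_int (i + 1) + 1/2) j - c (1, 0) (i + 1/2) j - (c (1, 0) (i + 1/2) j - c (1, 0) (of_int (i - 1) + 1/2) j)\<bar>
        + \<bar>J (1, 0) (of_int (i + 1) + 1/2) j - J (1, 0) (i + 1/2) j - (J (1, 0) (i + 1/2) j - J (1, 0) (of_int (i - 1) + 1/2) j)\<bar>
        \<le> G * (dx * dx)"
      using second [OF X X X, of "i - 1/2" j] by (simp add: m add_ac)
    show "\<bar>c (1, 0) (of_int (i + 1) + 1/2) j - c (1, 0) (i + 1/2) j
          - (c (1, 0) (of_int (i + 1) + 1/2) (of_int (j - 1)) - c (1, 0) (i + 1/2) (of_int (j - 1)))\<bar>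
        + \<bar>J (1, 0) (of_int (i + 1) + 1/2) j - J (1, 0) (i + 1/2) j
          - (J (1, 0) (of_int (i + 1) + 1/2) (of_int (j - 1)) - J (1, 0) (i + 1/2) (of_int (j - 1)))\<bar> \<le> G * (dx * dy)"
      using second [OF X X Y, of "i + 1/2" "j - 1"] by (simp add: m add_ac)
    show "\<bar>c (0, 1) (of_int (i + 1)) (j + 1/2) - c (0, 1) i (j + 1/2)
          - (c (0, 1) (of_int (i + 1)) (of_int (j - 1) + 1/2) - c (0, 1) i (of_int (j - 1) + 1/2))\<bar>
        + \<bar>J (0, 1) (of_int (i + 1)) (j + 1/2) - J (0, 1) i (j + 1/2)
          - (J (0, 1) (of_int (i + 1)) (of_int (j - 1) + 1/2) - J (0, 1) i (of_int (j - 1) + 1/2))\<bar> \<le> G * (dx * dy)"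
      using second [OF Y X Y, of i "j - 1/2"] by (simp add: m add_ac)
    show "\<bar>c (0, 1) i (of_int (j + 1) + 1/2) - c (0, 1) i (j + 1/2) - (c (0, 1) i (j + 1/2) - c (0, 1) i (of_int (j - 1) + 1/2))\<bar>
        + \<bar>J (0, 1) i (of_int (j + 1) + 1/2) - J (0, 1) i (j + 1/2) - (J (0, 1) i (j + 1/2) - J (0, 1) i (of_int (j - 1) + 1/2))\<bar>
        \<le> G * (dy * dy)"
      using second [OF Y Y Y, of i "j - 1/2"] by (simp add: m add_ac)
  qed (fact pos(1,2,3,5) f_bound f_sign f_lip f_mono G0)+
  then show ?thesis
    unfolding S_def G_def c_def J_def grid_fun_def .
qed

lemma (in roe_coefficients) step_eq_roe_step:
  assumes "v1 = (\<lambda>i j. v (grid_pt dx (i + 1/2), grid_pt dy j) \<bullet> (1, 0))"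
    and "J1 = (\<lambda>i j. nonlocal \<epsilon> \<eta> dx dy r (1, 0) (i + 1/2) j)"
    and "v2 = (\<lambda>i j. v (grid_pt dx i, grid_pt dy (j + 1/2)) \<bullet> (0, 1))"
    and "J2 = (\<lambda>i j. nonlocal \<epsilon> \<eta> dx dy r (0, 1) i (j + 1/2))"
  shows "roe_step \<epsilon> v f \<eta> dx dy dt r = step r"
  unfolding roe_step_def roe_half_def step_def flux_x_def flux_y_def x_flux_def y_flux_def
    upwind_x_def upwind_y_def V_flux_def F_flux_def
  unfolding assms by (intro ext) simp

section \<open>Iteration in time\<close>

text \<open>Discrete Gronwall lemma in which the source is measured by a supersolution \<open>U\<close>.\<close>

lemma affine_recursion_bound:
  fixes x :: "nat \<Rightarrow> ennreal" and m s U :: "nat \<Rightarrow> real"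
  assumes x: "\<And>n. x (Suc n) \<le> ennreal (m n) * x n + ennreal (s n)"
    and m: "\<And>n. 0 \<le> m n" "\<And>n. m n \<le> \<theta>" and s: "\<And>n. 0 \<le> s n"
    and U: "0 \<le> U 0" "\<And>n. m n * U n + s n \<le> U (Suc n)"
  shows "x n \<le> ennreal (\<theta> ^ n) * x 0 + ennreal (U n)"
proof -
  have U0: "0 \<le> U n" for n
  proof (induction n)
    case (Suc n)
    have "0 \<le> m n * U n + s n" using Suc m(1) s by simp
    with U(2) [of n] show ?case by linarith
  qed (rule U(1))
  have \<theta>: "0 \<le> \<theta>" using m [of 0] by linarith
  show ?thesis
  proof (induction n)
    case 0
    show ?case by (simp add: add_increasing2)
  next
    case (Suc n)
    have "x (Suc n) \<le> ennreal (m n) * (ennreal (\<theta> ^ n) * x 0 + ennreal (U n)) + ennreal (s n)"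
      by (rule order_trans [OF x add_right_mono [OF mult_left_mono [OF Suc]]]) simp
    also have "\<dots> = ennreal (m n * \<theta> ^ n) * x 0 + ennreal (m n * U n + s n)"
      using m(1) U0 s \<theta> by (simp add: distrib_left ennreal_mult mult.assoc add.assoc)
    also have "\<dots> \<le> ennreal (\<theta> ^ Suc n) * x 0 + ennreal (U (Suc n))"
      using m(2) U(2) \<theta> by (intro add_mono mult_right_mono ennreal_leI) (auto simp: mult_right_mono)
    finally show ?case .
  qed
qed

text \<open>The scheme with all norms of the data replaced by real bounds: \<open>V1\<close>, \<open>V2\<close> for the first and second
derivatives of \<open>v\<close>, \<open>E1\<close>, \<open>E2\<close>, \<open>E3\<close> for those of \<open>\<eta>\<close> up to order three, \<open>Lf\<close> for the slope of \<open>f\<close>, and \<open>L\<close> for the norm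
of the initial datum.\<close>

locale roe_scheme =
  fixes dx dy dt \<epsilon> Lf V1 V2 E1 E2 E3 L :: real
    and f :: "real \<Rightarrow> real" and v :: "real \<times> real \<Rightarrow> real \<times> real" and \<eta> :: "real \<times> real \<Rightarrow> real"
    and \<rho> :: "nat \<Rightarrow> int \<Rightarrow> int \<Rightarrow> real"
  assumes pos: "0 < dx" "0 < dy" "0 < dt" "0 \<le> \<epsilon>" "0 \<le> Lf" "0 \<le> V1" "0 \<le> V2" "0 \<le> E2" "0 \<le> E3" "0 \<le> L"
    and f_bound: "\<And>r. \<bar>f r\<bar> \<le> \<bar>r\<bar>" and f_sign: "\<And>r. 0 \<le> f r / r"
    and f_lip: "\<And>r s. \<bar>f r - f s\<bar> \<le> Lf * \<bar>r - s\<bar>"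
    and f_mono: "\<And>r s. 0 \<le> r \<Longrightarrow> r \<le> s \<Longrightarrow> f r \<le> f s"
    and v: "C_class 2 v"
    and v1: "\<forall>b\<in>Basis. \<forall>x. norm (partial b v x) \<le> V1"
    and v2: "\<forall>b\<in>Basis. \<forall>d\<in>Basis. \<forall>x. norm (partial d (partial b v) x) \<le> V2"
    and cfl: "\<And>z. dt / dx * (\<bar>v z \<bullet> (1, 0)\<bar> + \<epsilon> * Lf) \<le> 1/3" "\<And>z. dt / dy * (\<bar>v z \<bullet> (0, 1)\<bar> + \<epsilon> * Lf) \<le> 1/3"
    and \<eta>: "C_class 3 \<eta>"
    and e1: "\<forall>b\<in>Basis. \<forall>x. \<bar>partial b \<eta> x\<bar> \<le> E1"
    and e2: "\<forall>b\<in>Basis. \<forall>d\<in>Basis. \<forall>x. \<bar>partial d (partial b \<eta>) x\<bar> \<le> E2"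
    and e3: "\<forall>b\<in>Basis. \<forall>d\<in>Basis. \<forall>e\<in>Basis. \<forall>x. \<bar>partial e (partial d (partial b \<eta>)) x\<bar> \<le> E3"
    and \<rho>_Suc: "\<And>n. \<rho> (Suc n) = roe_step \<epsilon> v f \<eta> dx dy dt (\<rho> n)"
    and \<rho>_0: "ennreal (dx * dy) * grid_l1 (\<rho> 0) \<le> ennreal L" "\<And>i j. 0 \<le> \<rho> 0 i j"
begin

abbreviation next_level where "next_level \<equiv> roe_step \<epsilon> v f \<eta> dx dy dt"

text \<open>A bound for the second divided differences of the coefficients if the norm of the density is at
most \<open>l\<close>.\<close>

definition G where "G l = V2 + \<epsilon> * (2 * E3 * l + 6 * (E2 * l)\<^sup>2)"

lemma G_nonneg: "0 \<le> l \<Longrightarrow> 0 \<le> G l"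
  unfolding G_def using pos by (intro add_nonneg_nonneg mult_nonneg_nonneg) auto

definition jumps_le where
  "jumps_le r sJ \<longleftrightarrow> (\<forall>b\<in>Basis. \<forall>d\<in>Basis. \<forall>x y. dt / mesh dx dy d *
     (\<bar>nonlocal \<epsilon> \<eta> dx dy r b (x + fst d) (y + snd d) - nonlocal \<epsilon> \<eta> dx dy r b x y\<bar> * Lf) \<le> sJ)"

lemma one_step:
  assumes r: "ennreal (dx * dy) * grid_l1 r \<le> ennreal l" "0 \<le> l" and sJ: "jumps_le r sJ" "0 \<le> sJ"
  shows "grid_TV dx dy (next_level r) \<le> ennreal (3 + 3 * (dt * V1 + sJ)) * grid_TV dx dy r + ennreal (4 * dt * (G l * l))"
    and "grid_l1 (next_level r) \<le> ennreal (5/3) * grid_l1 r"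
    and "dt * V1 + sJ \<le> 1/6 \<Longrightarrow> grid_l1 (next_level r) \<le> grid_l1 r"
    and "dt * V1 + sJ \<le> 1/6 \<Longrightarrow> (\<And>i j. 0 \<le> r i j) \<Longrightarrow> 0 \<le> next_level r i j"
    and "dt * V1 + sJ \<le> 1/6 \<Longrightarrow> (\<And>i j. 0 \<le> r i j) \<Longrightarrow>
      grid_TV dx dy (next_level r) \<le> ennreal (1 + 3 * (dt * V1 + sJ)) * grid_TV dx dy r + ennreal (4 * dt * (G l * l))"
proof -
  interpret c: roe_coefficients dx dy dt Lf "G l" "dt * V1 + sJ" f
    "\<lambda>i j. v (grid_pt dx (i + 1/2), grid_pt dy j) \<bullet> (1, 0)"
    "\<lambda>i j. nonlocal \<epsilon> \<eta> dx dy r (1, 0) (i + 1/2) j"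
    "\<lambda>i j. v (grid_pt dx i, grid_pt dy (j + 1/2)) \<bullet> (0, 1)"
    "\<lambda>i j. nonlocal \<epsilon> \<eta> dx dy r (0, 1) i (j + 1/2)"
    unfolding G_def
    by (rule roe_coefficients_scheme [OF pos(1-9) sJ(2) f_bound f_sign f_lip f_mono v v1 v2 cfl r \<eta> e1 e2 e3])
      (use sJ(1) in \<open>auto simp: jumps_le_def\<close>)
  have step: "next_level r = c.step r"
    by (rule c.step_eq_roe_step [OF refl refl refl refl])
  have src: "ennreal (4 * dt * G l) * (ennreal (dx * dy) * grid_l1 r) \<le> ennreal (4 * dt * (G l * l))"
  proof -
    have "ennreal (4 * dt * G l) * (ennreal (dx * dy) * grid_l1 r) \<le> ennreal (4 * dt * G l) * ennreal l"
      by (rule mult_left_mono [OF r(1)]) simp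
    also have "\<dots> = ennreal (4 * dt * (G l * l))"
      using pos r(2) G_nonneg [OF r(2)] by (simp add: ennreal_mult [symmetric] mult.assoc)
    finally show ?thesis .
  qed
  show "grid_TV dx dy (next_level r) \<le> ennreal (3 + 3 * (dt * V1 + sJ)) * grid_TV dx dy r + ennreal (4 * dt * (G l * l))"
    unfolding step by (rule order_trans [OF c.grid_TV_step_le add_left_mono [OF src]])
  show "grid_l1 (next_level r) \<le> ennreal (5/3) * grid_l1 r"
    unfolding step by (rule c.grid_l1_step_le)
  show "dt * V1 + sJ \<le> 1/6 \<Longrightarrow> grid_l1 (next_level r) \<le> grid_l1 r"
    unfolding step by (rule c.grid_l1_step_nonincreasing)
  show "dt * V1 + sJ \<le> 1/6 \<Longrightarrow> (\<And>i j. 0 \<le> r i j) \<Longrightarrow> 0 \<le> next_level r i j"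
    unfolding step by (rule c.step_nonneg)
  show "dt * V1 + sJ \<le> 1/6 \<Longrightarrow> (\<And>i j. 0 \<le> r i j) \<Longrightarrow>
      grid_TV dx dy (next_level r) \<le> ennreal (1 + 3 * (dt * V1 + sJ)) * grid_TV dx dy r + ennreal (4 * dt * (G l * l))"
    unfolding step by (rule order_trans [OF c.grid_TV_step_mono add_left_mono [OF src]])
qed

lemma jumps_le_smooth:
  assumes r: "ennreal (dx * dy) * grid_l1 r \<le> ennreal L"
  shows "jumps_le r (2 * dt * \<epsilon> * Lf * E2 * L)"
  unfolding jumps_le_def
proof (intro ballI allI)
  fix b d :: "real \<times> real" and x y :: real assume b: "b \<in> Basis" and d: "d \<in> Basis"
  have m: "0 < mesh dx dy d" by (rule mesh_pos [OF pos(1,2) d])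
  have "dt / mesh dx dy d * (\<bar>nonlocal \<epsilon> \<eta> dx dy r b (x + fst d) (y + snd d) - nonlocal \<epsilon> \<eta> dx dy r b x y\<bar> * Lf)
      \<le> dt / mesh dx dy d * (mesh dx dy d * (2 * \<epsilon> * E2 * L) * Lf)"
    using nonlocal_increments(1) [OF pos(1,2) r pos(10) \<eta> e1 e2 e3 b d d pos(4)] m pos
    by (intro mult_left_mono mult_right_mono) auto
  also have "\<dots> = 2 * dt * \<epsilon> * Lf * E2 * L" using m by simp
  finally show "dt / mesh dx dy d * (\<bar>nonlocal \<epsilon> \<eta> dx dy r b (x + fst d) (y + snd d) - nonlocal \<epsilon> \<eta> dx dy r b x y\<bar> * Lf)
      \<le> 2 * dt * \<epsilon> * Lf * E2 * L" .
qed

text \<open>The nonlocal term takes values in \<open>[- \<epsilon>, \<epsilon>]\<close>, and \<open>\<epsilon> * Lf\<close> uses up at most one third in the CFL condition.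
This bound is independent of the norm of the density, which is out of control for long time steps.\<close>

lemma jumps_le_crude: "jumps_le r (2/3)"
  unfolding jumps_le_def
proof (intro ballI allI)
  fix b d :: "real \<times> real" and x y :: real assume b: "b \<in> Basis" and d: "d \<in> Basis"
  have m: "0 < mesh dx dy d" by (rule mesh_pos [OF pos(1,2) d])
  have "\<bar>nonlocal \<epsilon> \<eta> dx dy r b (x + fst d) (y + snd d) - nonlocal \<epsilon> \<eta> dx dy r b x y\<bar> \<le> \<epsilon> + \<epsilon>"
    by (rule order_trans [OF abs_triangle_ineq4 add_mono [OF abs_nonlocal_le [OF b pos(4)] abs_nonlocal_le [OF b pos(4)]]])
  then have "dt / mesh dx dy d * (\<bar>nonlocal \<epsilon> \<eta> dx dy r b (x + fst d) (y + snd d) - nonlocal \<epsilon> \<eta> dx dy r b x y\<bar> * Lf)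
      \<le> dt / mesh dx dy d * ((\<epsilon> + \<epsilon>) * Lf)"
    using m pos by (intro mult_left_mono mult_right_mono) auto
  also have "\<dots> = 2 * (dt / mesh dx dy d * (0 + \<epsilon> * Lf))" by (simp add: algebra_simps)
  also have "dt / mesh dx dy d * (0 + \<epsilon> * Lf) \<le> 1/3"
  proof -
    have "dt / dx * (0 + \<epsilon> * Lf) \<le> 1/3" "dt / dy * (0 + \<epsilon> * Lf) \<le> 1/3"
      using pos by (intro order_trans [OF mult_left_mono [OF add_right_mono] cfl(1)]
        order_trans [OF mult_left_mono [OF add_right_mono] cfl(2)]; simp)+
    then show ?thesis using d by (auto simp: Basis_real2 mesh_def)
  qed
  finally show "dt / mesh dx dy d * (\<bar>nonlocal \<epsilon> \<eta> dx dy r b (x + fst d) (y + snd d) - nonlocal \<epsilon> \<eta> dx dy r b x y\<bar> * Lf)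
      \<le> 2/3" by simp
qed

definition k1 where "k1 = 6 * (V1 + 2 * \<epsilon> * Lf * E2 * L)"
definition k2 where "k2 = (4 * \<epsilon> * (2 * E3 * L + 3 * E2\<^sup>2 * L\<^sup>2) + 3 * V2) * L"

lemma k_nonneg: "0 \<le> k1" "0 \<le> k2"
  unfolding k1_def k2_def using pos by simp_all

lemma source_le: "2 * (G L * L) \<le> k2"
proof -
  have "k2 - 2 * (G L * L) = (4 * \<epsilon> * (E3 * L) + V2) * L"
    by (simp add: k2_def G_def power2_eq_square algebra_simps)
  moreover have "0 \<le> (4 * \<epsilon> * (E3 * L) + V2) * L" using pos by simp
  ultimately show ?thesis by linarith
qed

text \<open>Here \<open>S = dt * k1 / 6\<close>, so that the hypothesis is the condition for positivity, and
\<open>1 + 3 * S = 1 + dt * k1 / 2\<close>.  Positivity and the bound on the norm are propagated together.\<close>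

lemma small_step_bound:
  assumes s: "dt * k1 \<le> 1" and U: "0 \<le> U 0"
    "\<And>n. (1 + dt * k1 / 2) * U n + 2 * dt * k2 \<le> U (Suc n)"
  shows "grid_TV dx dy (\<rho> n) \<le> ennreal (exp (2 * dt * k1) ^ n) * grid_TV dx dy (\<rho> 0) + ennreal (U n)"
proof -
  define sJ where "sJ = 2 * dt * \<epsilon> * Lf * E2 * L"
  have sJ0: "0 \<le> sJ" unfolding sJ_def using pos by simp
  have S: "dt * V1 + sJ = dt * k1 / 6" by (simp add: k1_def sJ_def algebra_simps)
  with s have S6: "dt * V1 + sJ \<le> 1/6" by simp
  have inv: "ennreal (dx * dy) * grid_l1 (\<rho> n) \<le> ennreal L \<and> (\<forall>i j. 0 \<le> \<rho> n i j)" for n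
  proof (induction n)
    case 0
    show ?case using \<rho>_0 by simp
  next
    case (Suc n)
    then have r: "ennreal (dx * dy) * grid_l1 (\<rho> n) \<le> ennreal L" and p: "\<And>i j. 0 \<le> \<rho> n i j" by auto
    note J = jumps_le_smooth [OF r, folded sJ_def]
    have "ennreal (dx * dy) * grid_l1 (\<rho> (Suc n)) \<le> ennreal L"
      unfolding \<rho>_Suc by (rule order_trans [OF mult_left_mono [OF one_step(3) [OF r pos(10) J sJ0 S6]] r]) simp
    moreover have "0 \<le> \<rho> (Suc n) i j" for i j
      unfolding \<rho>_Suc by (rule one_step(4) [OF r pos(10) J sJ0 S6 p])
    ultimately show ?case by blast
  qed
  show ?thesis
  proof (rule affine_recursion_bound [where m = "\<lambda>n. 1 + dt * k1 / 2" and s = "\<lambda>n. 4 * dt * (G L * L)"])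
    fix n
    have r: "ennreal (dx * dy) * grid_l1 (\<rho> n) \<le> ennreal L" and p: "\<And>i j. 0 \<le> \<rho> n i j" using inv by auto
    have e: "3 * (dt * V1 + sJ) = dt * k1 / 2" using S by simp
    show "grid_TV dx dy (\<rho> (Suc n)) \<le> ennreal (1 + dt * k1 / 2) * grid_TV dx dy (\<rho> n) + ennreal (4 * dt * (G L * L))"
      unfolding \<rho>_Suc e [symmetric]
      by (rule one_step(5) [OF r pos(10) jumps_le_smooth [OF r, folded sJ_def] sJ0 S6 p])
    show "0 \<le> 1 + dt * k1 / 2" using pos k_nonneg by simp
    have "1 + 2 * dt * k1 \<le> exp (2 * dt * k1)" by (rule exp_ge_add_one_self)
    moreover have "0 \<le> dt * k1" using pos k_nonneg by simp
    ultimately show "1 + dt * k1 / 2 \<le> exp (2 * dt * k1)" by linarith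
    show "0 \<le> 4 * dt * (G L * L)" using pos G_nonneg by simp
    have "4 * dt * (G L * L) \<le> 2 * dt * k2"
      using mult_left_mono [OF source_le, of "2 * dt"] pos by simp
    then show "(1 + dt * k1 / 2) * U n + 4 * dt * (G L * L) \<le> U (Suc n)" using U(2) [of n] by linarith
  qed (rule U(1))
qed

text \<open>The source is a polynomial in the norm of the density with nonnegative coefficients, without constant
term and of degree three.\<close>

lemma G_growth:
  assumes "1 \<le> g"
  shows "G (g * L) * (g * L) \<le> g ^ 3 * (G L * L)"
proof -
  have g: "g \<le> g\<^sup>2" "1 \<le> g\<^sup>2" using assms by (simp_all add: self_le_power one_le_power)
  have "G (g * L) = V2 * 1 + \<epsilon> * (2 * E3 * L * g + 6 * (E2 * L)\<^sup>2 * g\<^sup>2)"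
    by (simp add: G_def power_mult_distrib mult_ac)
  also have "\<dots> \<le> V2 * g\<^sup>2 + \<epsilon> * (2 * E3 * L * g\<^sup>2 + 6 * (E2 * L)\<^sup>2 * g\<^sup>2)"
    using g pos by (intro add_mono mult_left_mono) auto
  also have "\<dots> = g\<^sup>2 * G L" by (simp add: G_def algebra_simps)
  finally have "G (g * L) * (g * L) \<le> g\<^sup>2 * G L * (g * L)"
    using assms pos by (intro mult_right_mono) auto
  also have "\<dots> = g ^ 3 * (G L * L)" by (simp add: power2_eq_square power3_eq_cube mult_ac)
  finally show ?thesis .
qed

text \<open>The crude bound on the jumps gives \<open>S = dt * V1 + 2/3\<close>, and then \<open>3 + 3 * S \<le> 5 + dt * k1 / 2\<close>.\<close>

lemma large_step_bound:
  assumes s: "1 \<le> dt * k1" and U: "0 \<le> U 0"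
    "\<And>n. (5 + dt * k1 / 2) * U n + (125/27) ^ n * (2 * dt * k2) \<le> U (Suc n)"
    and \<theta>: "5 + dt * k1 / 2 \<le> exp (2 * dt * k1)"
  shows "grid_TV dx dy (\<rho> n) \<le> ennreal (exp (2 * dt * k1) ^ n) * grid_TV dx dy (\<rho> 0) + ennreal (U n)"
proof -
  have inv: "ennreal (dx * dy) * grid_l1 (\<rho> n) \<le> ennreal ((5/3) ^ n * L)" for n
  proof (induction n)
    case 0
    show ?case using \<rho>_0 by simp
  next
    case (Suc n)
    have l: "0 \<le> (5/3) ^ n * L" using pos by simp
    have "ennreal (dx * dy) * grid_l1 (\<rho> (Suc n)) \<le> ennreal (dx * dy) * (ennreal (5/3) * grid_l1 (\<rho> n))"
      unfolding \<rho>_Suc by (rule mult_left_mono [OF one_step(2) [OF Suc l jumps_le_crude]]) simp_all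
    also have "\<dots> = ennreal (5/3) * (ennreal (dx * dy) * grid_l1 (\<rho> n))" by (simp add: mult_ac)
    also have "\<dots> \<le> ennreal (5/3) * ennreal ((5/3) ^ n * L)" by (rule mult_left_mono [OF Suc]) simp
    also have "\<dots> = ennreal ((5/3) ^ Suc n * L)" using l by (simp add: ennreal_mult [symmetric] mult.assoc)
    finally show ?case .
  qed
  have V: "3 * (dt * V1) \<le> dt * k1 / 2"
  proof -
    have "0 \<le> 2 * \<epsilon> * Lf * E2 * L" using pos by simp
    then have "dt * (6 * V1) \<le> dt * k1" unfolding k1_def using pos by (intro mult_left_mono) auto
    then show ?thesis by simp
  qed
  show ?thesis
  proof (rule affine_recursion_bound [where m = "\<lambda>n. 5 + dt * k1 / 2"
      and s = "\<lambda>n. 4 * dt * (G ((5/3) ^ n * L) * ((5/3) ^ n * L))"])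
    fix n
    have l: "0 \<le> (5/3) ^ n * L" using pos by simp
    have "3 + 3 * (dt * V1 + 2/3) \<le> 5 + dt * k1 / 2" using V by simp
    then have "ennreal (3 + 3 * (dt * V1 + 2/3)) * grid_TV dx dy (\<rho> n) \<le> ennreal (5 + dt * k1 / 2) * grid_TV dx dy (\<rho> n)"
      by (intro mult_right_mono ennreal_leI) auto
    then show "grid_TV dx dy (\<rho> (Suc n)) \<le> ennreal (5 + dt * k1 / 2) * grid_TV dx dy (\<rho> n)
        + ennreal (4 * dt * (G ((5/3) ^ n * L) * ((5/3) ^ n * L)))"
      unfolding \<rho>_Suc
      by (intro order_trans [OF one_step(1) [OF inv l jumps_le_crude] add_right_mono]) simp_all
    show "0 \<le> 5 + dt * k1 / 2" using pos k_nonneg by simp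
    show "5 + dt * k1 / 2 \<le> exp (2 * dt * k1)" by (rule \<theta>)
    show "0 \<le> 4 * dt * (G ((5/3) ^ n * L) * ((5/3) ^ n * L))" using pos l G_nonneg [OF l] by simp
    have "4 * dt * (G ((5/3) ^ n * L) * ((5/3) ^ n * L)) \<le> 4 * dt * (((5/3) ^ n) ^ 3 * (G L * L))"
      using pos by (intro mult_left_mono G_growth) auto
    also have "((5/3 :: real) ^ n) ^ 3 = (125/27) ^ n"
      by (simp add: power3_eq_cube power_mult_distrib [symmetric])
    also have "4 * dt * ((125/27) ^ n * (G L * L)) = (125/27) ^ n * (2 * dt) * (2 * (G L * L))" by simp
    also have "\<dots> \<le> (125/27) ^ n * (2 * dt) * k2"
      using pos by (intro mult_left_mono source_le) auto
    finally have "4 * dt * (G ((5/3) ^ n * L) * ((5/3) ^ n * L)) \<le> (125/27) ^ n * (2 * dt * k2)"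
      by (simp only: mult.assoc)
    then show "(5 + dt * k1 / 2) * U n + 4 * dt * (G ((5/3) ^ n * L) * ((5/3) ^ n * L)) \<le> U (Suc n)"
      using U(2) [of n] by linarith
  qed (rule U(1))
qed

text \<open>Room for the factor \<open>5 + x / 2\<close> of the recursion and for an additional \<open>x\<close>, which absorbs the source.\<close>

lemma exp_large:
  fixes x :: real
  assumes "1 \<le> x"
  shows "5 + 3/2 * x \<le> exp (2 * x)"
proof -
  have "exp (2::real) = (exp (1/2)) ^ 4" by (simp add: exp_of_nat_mult [symmetric])
  moreover have "1 + 1/2 + (1/2)\<^sup>2 / 2 \<le> exp (1/2 :: real)" by (rule exp_lower_Taylor_quadratic) simp
  ultimately have e2: "(13/8 :: real) ^ 4 \<le> exp 2"
    by (simp add: power_mono power2_eq_square)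
  \<comment> \<open>the tangent of the exponential function at \<open>2\<close>, with \<open>exp 2\<close> replaced by \<open>13/2\<close>\<close>
  have "(13/2 :: real) * (2 * x - 1) \<le> exp 2 * exp (2 * x - 2)"
    using e2 assms exp_ge_add_one_self [of "2 * x - 2"]
    by (intro mult_mono) (simp_all add: power4_eq_xxxx)
  also have "\<dots> = exp (2 * x)" by (simp add: exp_add [symmetric])
  finally show ?thesis using assms by simp
qed

text \<open>The source terms of the claimed bound, \<open>2 * k2 / k1 * (exp (2 * dt * k1) ^ n - 1)\<close>, form a
supersolution in both regimes.  For \<open>k1 = 0\<close> this expression is zero, hence the hypothesis.\<close>

lemma grid_TV_bound:
  assumes "k1 = 0 \<Longrightarrow> k2 = 0"
  shows "grid_TV dx dy (\<rho> n) \<le> ennreal (exp (2 * dt * k1) ^ n) * grid_TV dx dy (\<rho> 0)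
    + ennreal (2 * k2 / k1 * (exp (2 * dt * k1) ^ n - 1))"
proof (cases "k1 = 0")
  case True
  have "grid_TV dx dy (\<rho> n) \<le> ennreal (exp (2 * dt * k1) ^ n) * grid_TV dx dy (\<rho> 0) + ennreal 0"
    by (rule small_step_bound) (use True assms in simp_all)
  then show ?thesis using True by simp
next
  case False
  define \<theta> where "\<theta> = exp (2 * dt * k1)"
  define \<kappa> where "\<kappa> = 2 * k2 / k1"
  have k1: "0 < k1" using False k_nonneg by simp
  have \<kappa>: "0 \<le> \<kappa>" unfolding \<kappa>_def using k1 k_nonneg by simp
  have \<kappa>k: "\<kappa> * (dt * k1) = 2 * dt * k2" unfolding \<kappa>_def using k1 by simp
  have x0: "0 \<le> dt * k1" using pos k1 by simp
  have \<theta>1: "1 + 2 * (dt * k1) \<le> \<theta>"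
    unfolding \<theta>_def mult.assoc by (rule exp_ge_add_one_self)
  have pow: "1 \<le> \<theta> ^ n" for n using \<theta>1 x0 by (intro one_le_power) simp
  show ?thesis
  proof (cases "dt * k1 \<le> 1")
    case True
    show ?thesis
      unfolding \<theta>_def [symmetric] \<kappa>_def [symmetric]
    proof (rule small_step_bound [OF True, where U = "\<lambda>n. 2 * k2 / k1 * (exp (2 * dt * k1) ^ n - 1)", folded \<theta>_def \<kappa>_def])
      fix n
      have "2 * dt * k2 \<le> \<kappa> * (2 * (dt * k1))"
        using \<kappa>k pos k_nonneg by (simp add: mult.left_commute [of \<kappa> 2])
      also have "\<dots> \<le> \<kappa> * (\<theta> - 1)" using \<theta>1 \<kappa> by (intro mult_left_mono) auto
      also have "\<dots> = \<kappa> * ((\<theta> - 1) - dt * k1 / 2) * 1 + \<kappa> * (dt * k1 / 2)"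
        by (simp add: algebra_simps)
      also have "\<dots> \<le> \<kappa> * ((\<theta> - 1) - dt * k1 / 2) * \<theta> ^ n + \<kappa> * (dt * k1 / 2)"
        using pow \<theta>1 x0 \<kappa> by (intro add_right_mono mult_left_mono) auto
      finally show "(1 + dt * k1 / 2) * (\<kappa> * (\<theta> ^ n - 1)) + 2 * dt * k2 \<le> \<kappa> * (\<theta> ^ Suc n - 1)"
        by (simp add: algebra_simps diff_divide_distrib)
    qed simp
  next
    case False
    then have x1: "1 \<le> dt * k1" by simp
    have \<theta>: "5 + 3/2 * (dt * k1) \<le> \<theta>" unfolding \<theta>_def using exp_large [OF x1] by (simp add: mult.assoc)
    show ?thesis
      unfolding \<theta>_def [symmetric] \<kappa>_def [symmetric]
    proof (rule large_step_bound [OF x1, where U = "\<lambda>n. 2 * k2 / k1 * (exp (2 * dt * k1) ^ n - 1)", folded \<theta>_def \<kappa>_def])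
      show "5 + dt * k1 / 2 \<le> \<theta>" using \<theta> x0 by simp
      fix n
      have "(125/27) ^ n * (2 * dt * k2) \<le> \<theta> ^ n * (2 * dt * k2)"
        using \<theta> x1 pos k_nonneg by (intro mult_right_mono power_mono) auto
      also have "\<dots> = \<kappa> * \<theta> ^ n * (dt * k1)" unfolding \<kappa>k [symmetric] by simp
      also have "\<dots> \<le> \<kappa> * \<theta> ^ n * (\<theta> - (5 + dt * k1 / 2)) + \<kappa> * (4 + dt * k1 / 2)"
        using \<theta> \<kappa> pow [of n] x0 by (intro add_increasing2 mult_left_mono mult_nonneg_nonneg) auto
      finally show "(5 + dt * k1 / 2) * (\<kappa> * (\<theta> ^ n - 1)) + (125/27) ^ n * (2 * dt * k2) \<le> \<kappa> * (\<theta> ^ Suc n - 1)"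
        by (simp add: algebra_simps diff_divide_distrib)
    qed simp
  qed
qed

end

section \<open>The bound on the total variation\<close>

lemma roe_zero:
  assumes "f 0 = 0" "\<And>i j. roe \<epsilon> v f \<eta> dx dy dt u 0 i j = 0"
  shows "roe \<epsilon> v f \<eta> dx dy dt u n = (\<lambda>i j. 0)"
proof (induction n)
  case 0
  show ?case using assms(2) by (intro ext)
next
  case (Suc n)
  show ?case
    unfolding roe.simps Suc
    by (intro ext) (simp add: roe_step_def roe_half_def x_flux_def y_flux_def V_flux_def F_flux_def assms(1))
qed

text \<open>An infinite speed would make the right-hand side of the CFL condition zero.\<close>

lemma cfl_real:
  assumes "ennreal q \<le> 1 / (3 * (ennreal \<epsilon> * ennreal l + A))" "0 < q" "0 < \<epsilon>" "0 < l"
  obtains a where "A = ennreal a" "0 \<le> a" "q * (a + \<epsilon> * l) \<le> 1/3"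
proof (cases A)
  case (real a)
  have p: "0 < \<epsilon> * l + a" using assms real(1) by (simp add: add_pos_nonneg)
  have "3 * (ennreal \<epsilon> * ennreal l + A) = ennreal (3 * (\<epsilon> * l + a))"
    using assms real by (simp add: ennreal_mult ennreal_plus)
  then have "1 / (3 * (ennreal \<epsilon> * ennreal l + A)) = ennreal (1 / (3 * (\<epsilon> * l + a)))"
    using p divide_ennreal [of 1 "3 * (\<epsilon> * l + a)"] by simp
  with assms(1) p have "q \<le> 1 / (3 * (\<epsilon> * l + a))" by simp
  then have "q * (a + \<epsilon> * l) \<le> 1/3" using p by (simp add: field_simps)
  with real that show thesis by blast
next
  case top
  with assms(1,2) show thesis by (simp add: ennreal_mult_top)
qed

lemma TV_bound_real:
  assumes "0 \<le> k1" "0 \<le> k2" "0 \<le> dt"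
  shows "TV_bound (ennreal k1) (ennreal k2) X (real n * dt)
    = ennreal (exp (2 * dt * k1) ^ n) * X + ennreal (2 * k2 / k1 * (exp (2 * dt * k1) ^ n - 1))"
proof -
  have "2 * ennreal (real n * dt) * ennreal k1 = ennreal (2 * (real n * dt) * k1)"
    using assms by (simp add: ennreal_mult)
  then have e: "ennexp (2 * ennreal (real n * dt) * ennreal k1) = ennreal (exp (2 * dt * k1) ^ n)"
    using assms by (simp add: ennexp_def exp_of_nat_mult [symmetric] mult_ac)
  have "1 \<le> exp (2 * dt * k1) ^ n" using assms by (intro one_le_power) simp
  then have d: "ennreal (exp (2 * dt * k1) ^ n) - 1 = ennreal (exp (2 * dt * k1) ^ n - 1)"
    using ennreal_minus [of 1 "exp (2 * dt * k1) ^ n"] by simp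
  show ?thesis
  proof (cases "k1 = 0")
    case True
    then show ?thesis unfolding TV_bound_def e d by simp
  next
    case False
    then have "2 * ennreal k2 / ennreal k1 = ennreal (2 * k2 / k1)"
      using assms divide_ennreal [of "2 * k2" k1] by (simp add: ennreal_mult)
    then show ?thesis
      unfolding TV_bound_def e d using assms \<open>1 \<le> exp (2 * dt * k1) ^ n\<close>
      by (simp add: ennreal_mult [symmetric])
  qed
qed

theorem proposition3p5:
  fixes \<epsilon> \<rho>max T \<Delta>x \<Delta>y \<Delta>t :: real
    and v :: "real \<times> real \<Rightarrow> real \<times> real"
    and H f :: "real \<Rightarrow> real"
    and \<eta> \<rho>o :: "real \<times> real \<Rightarrow> real"
    and \<rho> :: "nat \<Rightarrow> int \<Rightarrow> int \<Rightarrow> real"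
    and K1 K2 :: ennreal
    and n :: nat
  assumes "\<epsilon> > 0" "\<rho>max > 0" "T > 0"
    and "\<Delta>x > 0" "\<Delta>y > 0" "\<Delta>t > 0"
    and "C_class 2 v"
    and "smooth_heaviside H"
    and "f = crowd_flux H \<rho>max"
    and "bounded (range (deriv f))"
    and "C_W_inf 3 \<eta>" "\<forall>z. \<eta> z \<ge> 0"
    and "Linf_norm \<rho>o < \<infinity>" "BV \<rho>o" "AE z in lebesgue. \<rho>o z \<ge> 0"
    and "ennreal (\<Delta>t / \<Delta>x)
           \<le> 1 / (3 * (ennreal \<epsilon> * Linf_norm (deriv f) + Linf_norm (\<lambda>z. v z \<bullet> (1, 0))))"
    and "ennreal (\<Delta>t / \<Delta>y)
           \<le> 1 / (3 * (ennreal \<epsilon> * Linf_norm (deriv f) + Linf_norm (\<lambda>z. v z \<bullet> (0, 1))))"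
    and "\<rho> = roe \<epsilon> v f \<eta> \<Delta>x \<Delta>y \<Delta>t \<rho>o"
    and "K1 = K1_const \<epsilon> v f \<eta> \<rho>o"
    and "K2 = K2_const \<epsilon> v \<eta> \<rho>o"
    and "n \<le> nat \<lfloor>T / \<Delta>t\<rfloor>"
  shows "grid_TV \<Delta>x \<Delta>y (\<rho> n) \<le> TV_bound K1 K2 (grid_TV \<Delta>x \<Delta>y (\<rho> 0)) (real n * \<Delta>t)"
proof -
  note f = \<open>f = crowd_flux H \<rho>max\<close> and H = \<open>smooth_heaviside H\<close>
  note mesh_pos' = \<open>\<Delta>x > 0\<close> \<open>\<Delta>y > 0\<close>
  have f0: "f 0 = 0" by (simp add: f crowd_flux_def)
  have int: "integrable lebesgue \<rho>o" using \<open>BV \<rho>o\<close> by (simp add: BV_def)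
  have \<rho>0: "\<rho> 0 = cell_average \<Delta>x \<Delta>y \<rho>o" by (simp add: \<open>\<rho> = _\<close>)
  have l1: "ennreal (\<Delta>x * \<Delta>y) * grid_l1 (\<rho> 0) \<le> L1_norm \<rho>o"
    unfolding \<rho>0 by (rule grid_l1_cell_average [OF int mesh_pos'])
  have L_fin: "L1_norm \<rho>o < \<infinity>"
    using int by (simp add: L1_norm_def integrable_iff_bounded)
  define L where "L = enn2real (L1_norm \<rho>o)"
  have L: "L1_norm \<rho>o = ennreal L" "0 \<le> L" using L_fin by (simp_all add: L_def)
  have TV_zero: "grid_TV \<Delta>x \<Delta>y (\<rho> n) = 0" if "\<And>i j. \<rho> 0 i j = 0"
  proof -
    have "\<rho> n = (\<lambda>i j. 0)"
      using roe_zero [of f \<epsilon> v \<eta> \<Delta>x \<Delta>y \<Delta>t \<rho>o n] f0 that by (simp add: \<open>\<rho> = _\<close>)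
    then show ?thesis by (simp add: grid_TV_def case_prod_unfold)
  qed
  have bdd: "Linf_norm (deriv f) < \<infinity>"
  proof -
    obtain B where B: "\<And>r. norm (deriv f r) \<le> B"
      using \<open>bounded (range (deriv f))\<close> by (auto simp: bounded_iff)
    have "deriv f \<in> borel_measurable lebesgue"
      using crowd_flux_derivative(2) [OF H] unfolding f
      by (intro measurable_completion) (simp add: borel_measurable_continuous_onI)
    then have "Linf_norm (deriv f) \<le> ennreal B"
      unfolding Linf_norm_def using B by (intro esssup_I) (auto intro: ennreal_leI)
    then show ?thesis using ennreal_less_top le_less_trans infinity_ennreal_def by metis
  qed
  define Lf where "Lf = enn2real (Linf_norm (deriv f))"
  have Lf: "Linf_norm (deriv f) = ennreal Lf" "0 \<le> Lf" using bdd by (simp_all add: Lf_def)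
  have Lf_pos: "0 < Lf"
    using crowd_flux_lipschitz_pos [OF H, of \<rho>max] Lf unfolding f by (cases "Lf = 0") auto
  obtain A1 where A1: "Linf_norm (\<lambda>z. v z \<bullet> (1, 0)) = ennreal A1" "0 \<le> A1" "\<Delta>t / \<Delta>x * (A1 + \<epsilon> * Lf) \<le> 1/3"
    using cfl_real [of "\<Delta>t / \<Delta>x" \<epsilon> Lf "Linf_norm (\<lambda>z. v z \<bullet> (1, 0))"] assms(1,4,6,16) Lf Lf_pos by auto
  obtain A2 where A2: "Linf_norm (\<lambda>z. v z \<bullet> (0, 1)) = ennreal A2" "0 \<le> A2" "\<Delta>t / \<Delta>y * (A2 + \<epsilon> * Lf) \<le> 1/3"
    using cfl_real [of "\<Delta>t / \<Delta>y" \<epsilon> Lf "Linf_norm (\<lambda>z. v z \<bullet> (0, 1))"] assms(1,5,6,17) Lf Lf_pos by auto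
  have v: "C_class (Suc (Suc 0)) v" using \<open>C_class 2 v\<close> by (simp only: numeral_2_eq_2)
  have cv: "continuous_on UNIV v" by (rule C_class_continuous [OF v])
  have \<eta>: "C_class 3 \<eta>" "\<And>k. k \<le> 3 \<Longrightarrow> Linf_norm (nabla_norm k \<eta>) < \<infinity>"
    using \<open>C_W_inf 3 \<eta>\<close> by (auto simp: C_W_inf_def)
  have \<eta>3: "C_class (Suc (Suc (Suc 0))) \<eta>" using \<eta>(1) by (simp only: numeral_3_eq_3)
  define E1 E2 E3 where "E1 = enn2real (Linf_norm (nabla_norm 1 \<eta>))"
    and "E2 = enn2real (Linf_norm (nabla_norm 2 \<eta>))" and "E3 = enn2real (Linf_norm (nabla_norm 3 \<eta>))"
  have E: "Linf_norm (nabla_norm 1 \<eta>) = ennreal E1" "Linf_norm (nabla_norm 2 \<eta>) = ennreal E2"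
    "Linf_norm (nabla_norm 3 \<eta>) = ennreal E3" "0 \<le> E1" "0 \<le> E2" "0 \<le> E3"
    using \<eta>(2) by (simp_all add: E1_def E2_def E3_def)
  consider "n = 0" | "L = 0" | "0 < n" "L \<noteq> 0" by blast
  then show ?thesis
  proof cases
    case 1
    then show ?thesis by (simp add: TV_bound_def ennexp_def)
  next
    case 2
    then have "ennreal (\<Delta>x * \<Delta>y) * grid_l1 (\<rho> 0) = 0" using l1 L by simp
    then have "grid_l1 (\<rho> 0) = 0" using mesh_pos' by (simp add: ennreal_eq_0_iff mult_le_0_iff)
    then show ?thesis using TV_zero grid_l1_eq_0D by simp
  next
    case 3
    have t: "0 < real n * \<Delta>t" using 3 \<open>\<Delta>t > 0\<close> by simp
    show ?thesis
    proof (cases "Linf_norm (nabla_norm 1 v)")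
      case top
      then have K1: "K1 = \<infinity>" by (simp add: \<open>K1 = _\<close> K1_const_def ennreal_mult_top)
      have "grid_l1 (\<rho> 0) < \<infinity>"
        using l1 L mesh_pos' by (intro ennreal_scaled_finite [of "\<Delta>x * \<Delta>y" _ L]) auto
      then have z: "grid_TV \<Delta>x \<Delta>y (\<rho> 0) = 0 \<Longrightarrow> ?thesis"
        using TV_zero grid_TV_eq_0D [OF _ mesh_pos'] by simp
      have "2 * ennreal (real n * \<Delta>t) * K1 = \<infinity>"
        using 3 \<open>\<Delta>t > 0\<close> by (simp add: K1 ennreal_mult_eq_top_iff)
      then have "TV_bound K1 K2 (grid_TV \<Delta>x \<Delta>y (\<rho> 0)) (real n * \<Delta>t) = \<infinity>" if "grid_TV \<Delta>x \<Delta>y (\<rho> 0) \<noteq> 0"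
        using that by (simp add: TV_bound_def ennexp_def ennreal_top_mult)
      with z show ?thesis by (cases "grid_TV \<Delta>x \<Delta>y (\<rho> 0) = 0") simp_all
    next
      case (real V1)
      define k1 where "k1 = 6 * (V1 + 2 * \<epsilon> * Lf * E2 * L)"
      have k1: "K1 = ennreal k1" "0 \<le> k1"
        unfolding \<open>K1 = _\<close> K1_const_def real Lf E L k1_def
        using real(1) Lf(2) E L(2) \<open>\<epsilon> > 0\<close> by (simp_all add: ennreal_mult ennreal_plus mult.assoc)
      have k1_0: "V1 = 0" "E2 = 0" if "k1 = 0"
      proof -
        have "0 \<le> 2 * \<epsilon> * Lf * E2 * L" using Lf(2) E L(2) \<open>\<epsilon> > 0\<close> by simp
        with that real(1) have "V1 = 0 \<and> 2 * \<epsilon> * Lf * E2 * L = 0"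
          by (simp add: k1_def add_nonneg_eq_0_iff)
        then show "V1 = 0" "E2 = 0" using \<open>\<epsilon> > 0\<close> Lf_pos 3 by simp_all
      qed
      have V2_0: "Linf_norm (nabla_norm 2 v) = 0" if "k1 = 0"
        using Linf_nabla2_eq_0 [OF \<open>C_class 2 v\<close>] k1_0(1) [OF that] real by simp
      show ?thesis
      proof (cases "Linf_norm (nabla_norm 2 v)")
        case top
        with V2_0 have "k1 \<noteq> 0" by auto
        with k1 have p: "0 < k1" by simp
        have K2: "K2 = \<infinity>"
          using 3 L by (simp add: \<open>K2 = _\<close> K2_const_def Let_def top ennreal_mult_top ennreal_top_mult)
        have "2 * ennreal (real n * \<Delta>t) * K1 = ennreal (2 * (real n * \<Delta>t) * k1)"
          using t k1 by (simp add: ennreal_mult)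
        then have e: "ennexp (2 * ennreal (real n * \<Delta>t) * K1) = ennreal (exp (2 * (real n * \<Delta>t) * k1))"
          using t k1 by (simp add: ennexp_def)
        have "ennreal (exp (2 * (real n * \<Delta>t) * k1)) - 1 = ennreal (exp (2 * (real n * \<Delta>t) * k1) - 1)"
          using ennreal_minus [of 1 "exp (2 * (real n * \<Delta>t) * k1)"] by simp
        moreover have "0 < 2 * (real n * \<Delta>t) * k1"
          using mult_pos_pos [OF t p] by (simp add: mult_ac)
        ultimately have ne: "ennexp (2 * ennreal (real n * \<Delta>t) * K1) - 1 \<noteq> 0"
          unfolding e by (simp only: ennreal_eq_0_iff not_le diff_gt_0_iff_gt one_less_exp_iff simp_thms)
        have "2 * K2 / K1 = \<infinity>"
          unfolding K2 k1 by (simp add: ennreal_mult_top ennreal_top_divide)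
        then have "TV_bound K1 K2 (grid_TV \<Delta>x \<Delta>y (\<rho> 0)) (real n * \<Delta>t) = \<infinity>"
          unfolding TV_bound_def using ne by (simp add: ennreal_top_mult)
        then show ?thesis by simp
      next
        case V2: (real V2)
        define k2 where "k2 = (4 * \<epsilon> * (2 * E3 * L + 3 * E2\<^sup>2 * L\<^sup>2) + 3 * V2) * L"
        have k2: "K2 = ennreal k2" "0 \<le> k2"
          unfolding \<open>K2 = _\<close> K2_const_def V2 E L k2_def Let_def
          using V2(1) E L(2) \<open>\<epsilon> > 0\<close> by (simp_all add: ennreal_mult ennreal_plus ennreal_power [symmetric])
        have k2_0: "k2 = 0" if "k1 = 0"
        proof -
          have "V2 = 0" using V2_0 [OF that] V2 by simp
          moreover have "E3 = 0" using Linf_nabla3_eq_0 [OF \<eta>(1)] k1_0(2) [OF that] E by simp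
          ultimately show ?thesis using k1_0(2) [OF that] by (simp add: k2_def)
        qed
        interpret s: roe_scheme \<Delta>x \<Delta>y \<Delta>t \<epsilon> Lf V1 V2 E1 E2 E3 L f v \<eta> \<rho>
        proof
          show "\<bar>f r - f s\<bar> \<le> Lf * \<bar>r - s\<bar>" for r s
            unfolding f by (rule crowd_flux_lipschitz [OF H]) (use Lf f in simp_all)
          show "\<bar>f r\<bar> \<le> \<bar>r\<bar>" "0 \<le> f r / r" "0 \<le> r \<Longrightarrow> r \<le> s \<Longrightarrow> f r \<le> f s" for r s
            unfolding f by (rule crowd_flux_bounds [OF H]; assumption)+
          show "\<forall>b\<in>Basis. \<forall>x. norm (partial b v x) \<le> V1"
            using partial1_le [OF v, of V1] real by simp
          show "\<forall>b\<in>Basis. \<forall>d\<in>Basis. \<forall>x. norm (partial d (partial b v) x) \<le> V2"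
            using partial2_le [OF v, of V2] V2 by simp
          have "\<bar>v z \<bullet> (1, 0)\<bar> \<le> A1" "\<bar>v z \<bullet> (0, 1)\<bar> \<le> A2" for z
            using Linf_norm_dominates [of "\<lambda>z. v z \<bullet> (1, 0)" "\<lambda>z. v z \<bullet> (1, 0)" A1 z]
              Linf_norm_dominates [of "\<lambda>z. v z \<bullet> (0, 1)" "\<lambda>z. v z \<bullet> (0, 1)" A2 z] A1 A2 cv
            by (simp_all add: continuous_on_inner)
          then show "\<Delta>t / \<Delta>x * (\<bar>v z \<bullet> (1, 0)\<bar> + \<epsilon> * Lf) \<le> 1/3" "\<Delta>t / \<Delta>y * (\<bar>v z \<bullet> (0, 1)\<bar> + \<epsilon> * Lf) \<le> 1/3" for z
            using \<open>\<Delta>t > 0\<close> mesh_pos'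
            by (intro order_trans [OF mult_left_mono [OF add_right_mono] A1(3)]
              order_trans [OF mult_left_mono [OF add_right_mono] A2(3)]; simp)+
          show "\<forall>b\<in>Basis. \<forall>x. \<bar>partial b \<eta> x\<bar> \<le> E1"
            using partial1_le [OF \<eta>3, of E1] E by simp
          show "\<forall>b\<in>Basis. \<forall>d\<in>Basis. \<forall>x. \<bar>partial d (partial b \<eta>) x\<bar> \<le> E2"
            using partial2_le [OF \<eta>3, of E2] E by simp
          show "\<forall>b\<in>Basis. \<forall>d\<in>Basis. \<forall>e\<in>Basis. \<forall>x. \<bar>partial e (partial d (partial b \<eta>)) x\<bar> \<le> E3"
            using partial3_le [OF \<eta>3, of E3] E by simp
          show "\<rho> (Suc n) = roe_step \<epsilon> v f \<eta> \<Delta>x \<Delta>y \<Delta>t (\<rho> n)" for n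
            by (simp add: \<open>\<rho> = _\<close>)
          show "ennreal (\<Delta>x * \<Delta>y) * grid_l1 (\<rho> 0) \<le> ennreal L" using l1 L by simp
          show "0 \<le> \<rho> 0 i j" for i j
            unfolding \<rho>0 by (rule cell_average_nonneg [OF \<open>AE z in lebesgue. \<rho>o z \<ge> 0\<close> mesh_pos'])
        qed (use assms(1,4,5,6) Lf E L real V2 \<eta> \<open>C_class 2 v\<close> in simp_all)
        have "s.k1 = k1" "s.k2 = k2" by (simp_all add: s.k1_def s.k2_def k1_def k2_def)
        then show ?thesis
          unfolding k1 k2 using s.grid_TV_bound [of n] k2_0 k1 k2 \<open>\<Delta>t > 0\<close> by (simp add: TV_bound_real)
      qed
    qed
  qed
qed

end
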